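(* Let $\Theta$ be a compact set included in $$\left\{(p,\alpha,\beta)\in(0,1/2)\times[0,\pi)\times[0,\pi),\ \alpha\ne\beta\pmod{2\pi/3}\right\},$$ let $f$ be a density on $\mathbb{S}^1$ with $f^{\star l}\in\mathbb{R}\setminus\{0\}$ for all $l\in\{1,2,3,4\}$, and assume $\theta_0=(p_0,\alpha_0,\beta_0)\in\Theta$. Let $X_1,\dots,X_n$ be i.i.d. with density $g(x)=p_0f(x-\alpha_0)+(1-p_0)f(x-\beta_0)$ and let $\hat\theta_n=\operatorname{argmin}_{\theta\in\Theta}S_n(\theta)$. Let $\mathcal{A}$ be the Hessian matrix of $S$ at $\theta_0$: $$\mathcal{A}=\ddot S(\theta_0)=2\sum_{l=-4}^4\dot J^l(\theta_0)\dot J^l(\theta_0)^\top .$$ If $\mathcal{A}$ is invertible, then $$\sqrt n(\hat\theta_n-\theta_0)\overset{d}{\longrightarrow}\mathcal{N}(0,\Sigma),$$ where $\Sigma=\mathcal{A}^{-1}V\mathcal{A}^{-1}$, $V=4\,\mathbb{E}(UU^\top)$ and $U=\sum_{l=-4}^4\dot J^l(\theta_0)Z_1^l(\theta_0)$.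
   Context: $\mathbb{S}^1=\mathbb{R}/2\pi\mathbb{Z}$; a density $f$ on $\mathbb{S}^1$ is nonnegative with $\int_{\mathbb{S}^1}f\,dx=1$. Fourier coefficients: $\phi^{\star l}=\int_{\mathbb{S}^1}\phi(x)e^{-ilx}\frac{dx}{2\pi}$. For $\theta=(p,\alpha,\beta)$ and $l\in\mathbb{Z}$: $M^l(\theta)=pe^{-i\alpha l}+(1-p)e^{-i\beta l}$, $Z_k^l(\theta)=\Im\left(\frac{e^{ilX_k}}{2\pi}M^l(\theta)\right)$, $J^l(\theta)=\Im\left(\overline{g^{\star l}}M^l(\theta)\right)$. The contrast is $S(\theta)=\sum_{l=-4}^4\left(\Im\left(g^{\star l}\overline{M^l(\theta)}\right)\right)^2=\sum_{l=-4}^4J^l(\theta)^2$ and its empirical version is, for $n\ge2$, $S_n(\theta)=\frac{1}{n(n-1)}\sum_{l=-4}^4\sum_{1\le k\ne j\le n}Z_k^l(\theta)Z_j^l(\theta)$. $\dot\phi$ and $\ddot\phi$ denote the gradient (column vector in $\mathbb{R}^3$) and Hessian matrix of $\phi$ with respect to $\theta=(p,\alpha,\beta)$; $^\top$ is the transpose.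
   Formalization: The formal theorem additionally assumes that θ₀ lies in the interior of Θ (in ℝ³); without this the claim fails, e.g. for Θ={θ₀}, where the estimator equals θ₀ while Σ≠0, or at boundary points such as α₀=0. *)

theory Defs
  imports "HOL-Probability.Probability" "HOL-Library.Real_Mod"
begin


section \<open>The circle\<close>

text \<open>The circle \<open>\<real>/2\<pi>\<int>\<close> is represented by its fundamental domain
  \<open>[0, 2\<pi>)\<close> with Lebesgue measure of total mass \<open>2\<pi>\<close>. Points of the circle are given by their
  representative in \<open>[0, 2\<pi>)\<close>; functions on the circle are \<open>2\<pi>\<close>-periodic functions on \<open>\<real>\<close>, so that
  translates such as \<open>f (x - \<alpha>)\<close> make sense.\<close>

definition circle :: "real measure" where
  "circle = restrict_space lborel {0..<2 * pi}"

definition circle_density :: "(real \<Rightarrow> real) \<Rightarrow> bool" where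
  "circle_density f \<longleftrightarrow>
     f \<in> borel_measurable borel \<and> (\<forall>x. f (x + 2 * pi) = f x) \<and> (\<forall>x. 0 \<le> f x) \<and>
     has_bochner_integral circle f 1"

definition fourier_coeff :: "(real \<Rightarrow> real) \<Rightarrow> int \<Rightarrow> complex" where
  "fourier_coeff \<phi> l =
     (LINT x|circle. complex_of_real (\<phi> x) * exp (- \<i> * of_int l * of_real x)) / (2 * of_real pi)"

section \<open>The mixture model and the contrast\<close>

text \<open>A parameter \<open>\<theta> = (p, \<alpha>, \<beta>)\<close> is the vector with components \<open>\<theta> $ 1\<close>, \<open>\<theta> $ 2\<close>, \<open>\<theta> $ 3\<close>.\<close>

definition param_set :: "(real ^ 3) set" where
  "param_set = {\<theta>. \<theta> $ 1 \<in> {0<..<1/2} \<and> \<theta> $ 2 \<in> {0..<pi} \<and> \<theta> $ 3 \<in> {0..<pi} \<and>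
     \<not> [\<theta> $ 2 = \<theta> $ 3] (rmod (2 * pi / 3))}"

definition mixture :: "(real \<Rightarrow> real) \<Rightarrow> real ^ 3 \<Rightarrow> real \<Rightarrow> real" where
  "mixture f \<theta> x = \<theta> $ 1 * f (x - \<theta> $ 2) + (1 - \<theta> $ 1) * f (x - \<theta> $ 3)"

definition Mcoeff :: "int \<Rightarrow> real ^ 3 \<Rightarrow> complex" where
  "Mcoeff l \<theta> =
     of_real (\<theta> $ 1) * exp (- \<i> * of_real (\<theta> $ 2) * of_int l)
     + (1 - of_real (\<theta> $ 1)) * exp (- \<i> * of_real (\<theta> $ 3) * of_int l)"

definition Zvar :: "int \<Rightarrow> real \<Rightarrow> real ^ 3 \<Rightarrow> real" where
  "Zvar l x \<theta> = Im (exp (\<i> * of_int l * of_real x) / (2 * of_real pi) * Mcoeff l \<theta>)"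

definition Jfun :: "(real \<Rightarrow> real) \<Rightarrow> int \<Rightarrow> real ^ 3 \<Rightarrow> real" where
  "Jfun g l \<theta> = Im (cnj (fourier_coeff g l) * Mcoeff l \<theta>)"

definition contrast :: "(real \<Rightarrow> real) \<Rightarrow> real ^ 3 \<Rightarrow> real" where
  "contrast g \<theta> = (\<Sum>l\<in>{-4..4}. (Im (fourier_coeff g l * cnj (Mcoeff l \<theta>)))\<^sup>2)"

lemma contrast_eq_sum_Jfun: "contrast g \<theta> = (\<Sum>l\<in>{-4..4}. (Jfun g l \<theta>)\<^sup>2)"
  unfolding contrast_def Jfun_def
  by (intro sum.cong refl) (simp add: power2_eq_square algebra_simps)

definition empirical_contrast :: "nat \<Rightarrow> (nat \<Rightarrow> real) \<Rightarrow> real ^ 3 \<Rightarrow> real" where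
  "empirical_contrast n x \<theta> =
     1 / (real n * (real n - 1)) *
     (\<Sum>l\<in>{-4..4}. \<Sum>(k, j)\<in>{(k, j). k \<in> {1..n} \<and> j \<in> {1..n} \<and> k \<noteq> j}.
        Zvar l (x k) \<theta> * Zvar l (x j) \<theta>)"

section \<open>Gradient, Hessian and outer product\<close>

definition partial_deriv :: "'n \<Rightarrow> (real ^ 'n \<Rightarrow> real) \<Rightarrow> real ^ 'n \<Rightarrow> real" where
  "partial_deriv i \<phi> x = deriv (\<lambda>t. \<phi> (x + t *\<^sub>R axis i 1)) 0"

definition gradient :: "(real ^ 'n \<Rightarrow> real) \<Rightarrow> real ^ 'n \<Rightarrow> real ^ 'n" where
  "gradient \<phi> x = (\<chi> i. partial_deriv i \<phi> x)"

definition hessian :: "(real ^ 'n \<Rightarrow> real) \<Rightarrow> real ^ 'n \<Rightarrow> real ^ 'n ^ 'n" where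
  "hessian \<phi> x = (\<chi> i j. partial_deriv i (partial_deriv j \<phi>) x)"

definition outer :: "real ^ 'n \<Rightarrow> real ^ 'n ^ 'n" where
  "outer v = (columnvector v :: real ^ 1 ^ 'n) ** (rowvector v :: real ^ 'n ^ 1)"

section \<open>Multivariate normal law and convergence in distribution\<close>

text \<open>The normal law is defined through its characteristic function, which covers singular
  covariance matrices as well.\<close>

definition multivariate_normal ::
    "real ^ 'n \<Rightarrow> real ^ 'n ^ 'n \<Rightarrow> (real ^ 'n) measure \<Rightarrow> bool" where
  "multivariate_normal \<mu> \<Sigma> N \<longleftrightarrow>
     prob_space N \<and> sets N = sets borel \<and> transpose \<Sigma> = \<Sigma> \<and>
     (\<forall>t. (LINT x|N. exp (\<i> * of_real (t \<bullet> x)))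
        = exp (\<i> * of_real (t \<bullet> \<mu>) - of_real (t \<bullet> (\<Sigma> *v t)) / 2))"

definition converges_in_distribution ::
    "'w measure \<Rightarrow> (nat \<Rightarrow> 'w \<Rightarrow> 'a::topological_space) \<Rightarrow> 'a measure \<Rightarrow> bool" where
  "converges_in_distribution M Y N \<longleftrightarrow>
     (\<forall>h :: 'a \<Rightarrow> real. continuous_on UNIV h \<and> bounded (range h) \<longrightarrow>
        (\<lambda>n. LINT \<omega>|M. h (Y n \<omega>)) \<longlonglongrightarrow> (LINT y|N. h y))"

end

theory Submission
  imports Defs
begin

text \<open>The contrast \<open>S\<^sub>n\<close> depends on the sample only through the empirical Fourier coefficients
  \<open>e\<^sub>l\<close>, \<open>\<bar>l\<bar> \<le> 4\<close>, up to its diagonal part, which is of order \<open>1/n\<close> together with its gradient.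
  The minimiser is therefore controlled deterministically by the deviation \<open>D\<close> of these
  coefficients from their means, and \<open>D\<^sup>2\<close> has expectation \<open>O(1/n)\<close>. Identifiability
  (a Vandermonde argument in the cosines of the four angle differences) and compactness make the
  minimiser close to \<open>\<theta>0\<close> when \<open>D\<close> is small; there the first-order condition, linearised at
  \<open>\<theta>0\<close>, gives \<open>est - \<theta>0 = - 2 A\<^sup>-\<^sup>1 (U\<^sub>1 + \<dots> + U\<^sub>n) / n + O(D\<^sup>2 + 1/n)\<close>, and the remainder is negligible after
  scaling by \<open>\<surd>n\<close>.

  For the law of the linear term, the one-dimensional central limit theorem yields pointwise
  convergence of characteristic functions; this passes to bounded continuous test functions by
  approximating them with trigonometric polynomials on a large cube. A normal law with the limiting,
  possibly singular, covariance comes from writing a positive semidefinite matrix as a sum of outer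
  squares.\<close>

section \<open>Trigonometric polynomials and convergence in distribution\<close>

text \<open>A deterministic treatment is possible because \<theta> enters only through the nine
  smooth functions \<open>Mcoeff l\<close>: bounds uniform over \<Theta> come for free once nine
  complex numbers are controlled, and no uniform law of large numbers over the parameter set has to
  be proved. Since f has real coefficients at these frequencies, the l-th coefficient of g is a real
  multiple of M^l(\<theta>0), so every J^l vanishes at \<theta>0. Three things follow: \<theta>0 is
  a zero of the nonnegative contrast; the second derivatives of J^l drop out of the Hessian; and in
  each summand of the score one factor is already small of first order, so the other may be frozen
  at \<theta>0 at the price of a second-order error. Four frequencies suffice for identifiability
  because a cubic in the cosine can single out one of four values. Tightness is read off from second
  moments by Markov's inequality, so characteristic functions have to be compared only pointwise.
  Fixing a linear form reduces the three-dimensional limit to sums of real variables, whose variance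
  may be zero.\<close>

inductive trig_poly :: "('a::euclidean_space \<Rightarrow> real) \<Rightarrow> bool" where
  cos: "trig_poly (\<lambda>x. cos (t \<bullet> x))"
| sin: "trig_poly (\<lambda>x. sin (t \<bullet> x))"
| scale: "trig_poly p \<Longrightarrow> trig_poly (\<lambda>x. c * p x)"
| add: "trig_poly p \<Longrightarrow> trig_poly q \<Longrightarrow> trig_poly (\<lambda>x. p x + q x)"

lemma trig_poly_const: "trig_poly (\<lambda>_. c)"
  using trig_poly.scale[OF trig_poly.cos[of 0], of c] by simp

lemma trig_poly_continuous: "trig_poly p \<Longrightarrow> continuous_on S p"
  by (induction rule: trig_poly.induct) (auto intro!: continuous_intros)

lemma trig_poly_bounded: "trig_poly p \<Longrightarrow> \<exists>B. \<forall>x. \<bar>p x\<bar> \<le> B"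
proof (induction rule: trig_poly.induct)
  case (scale p c)
  then obtain B where "\<forall>x. \<bar>p x\<bar> \<le> B" by blast
  then have "\<forall>x. \<bar>c * p x\<bar> \<le> \<bar>c\<bar> * B" by (auto simp: abs_mult intro!: mult_left_mono)
  then show ?case by blast
next
  case (add p q)
  then obtain B C where "\<forall>x. \<bar>p x\<bar> \<le> B" "\<forall>x. \<bar>q x\<bar> \<le> C" by blast
  then have "\<forall>x. \<bar>p x + q x\<bar> \<le> B + C" by (meson abs_triangle_ineq add_mono order_trans)
  then show ?case by blast
qed (auto intro: exI[of _ 1])

lemma trig_poly_cong: "trig_poly p \<Longrightarrow> (\<And>x. p x = q x) \<Longrightarrow> trig_poly q"
  using ext[of p q] by simp

text \<open>Products are derived from the product-to-sum formulas rather than made a constructor: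
  convergence of expectations passes through linear operations but not through products, so the
  induction principle has to stay linear.\<close>

lemma trig_poly_mult:
  assumes "trig_poly p" "trig_poly q"
  shows "trig_poly (\<lambda>x. p x * q x)"
  using assms
proof (induction arbitrary: q rule: trig_poly.induct)
  case (cos t)
  from cos.prems show ?case
  proof (induction rule: trig_poly.induct)
    case (cos s)
    have "trig_poly (\<lambda>x. (1/2) * cos ((t - s) \<bullet> x) + (1/2) * cos ((t + s) \<bullet> x))"
      by (intro trig_poly.intros)
    then show ?case by (rule trig_poly_cong) (simp add: cos_times_cos inner_simps)
  next
    case (sin s)
    have "trig_poly (\<lambda>x. (1/2) * sin ((t + s) \<bullet> x) + (-1/2) * sin ((t - s) \<bullet> x))"
      by (intro trig_poly.intros)
    then show ?case by (rule trig_poly_cong) (simp add: cos_times_sin inner_simps)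
  next
    case (scale p c)
    from trig_poly.scale[OF scale.IH, of c] show ?case by (rule trig_poly_cong) simp
  next
    case (add p q)
    from trig_poly.add[OF add.IH] show ?case by (rule trig_poly_cong) (simp add: algebra_simps)
  qed
next
  case (sin t)
  from sin.prems show ?case
  proof (induction rule: trig_poly.induct)
    case (cos s)
    have "trig_poly (\<lambda>x. (1/2) * sin ((t + s) \<bullet> x) + (1/2) * sin ((t - s) \<bullet> x))"
      by (intro trig_poly.intros)
    then show ?case by (rule trig_poly_cong) (simp add: sin_times_cos inner_simps)
  next
    case (sin s)
    have "trig_poly (\<lambda>x. (1/2) * cos ((t - s) \<bullet> x) + (-1/2) * cos ((t + s) \<bullet> x))"
      by (intro trig_poly.intros)
    then show ?case by (rule trig_poly_cong) (simp add: sin_times_sin inner_simps)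
  next
    case (scale p c)
    from trig_poly.scale[OF scale.IH, of c] show ?case by (rule trig_poly_cong) simp
  next
    case (add p q)
    from trig_poly.add[OF add.IH] show ?case by (rule trig_poly_cong) (simp add: algebra_simps)
  qed
next
  case (scale p c)
  from trig_poly.scale[OF scale.IH[OF scale.prems], of c] show ?case
    by (rule trig_poly_cong) simp
next
  case (add p p')
  from trig_poly.add[OF add.IH[OF add.prems]] show ?case
    by (rule trig_poly_cong) (simp add: algebra_simps)
qed

lemma trig_poly_compose_polynomial:
  fixes q :: "real \<Rightarrow> real"
  assumes "real_polynomial_function q" "trig_poly p"
  shows "trig_poly (\<lambda>x. q (p x))"
  using assms(1)
proof (induction rule: real_polynomial_function.induct)
  case (linear q)
  then obtain c where "q = (\<lambda>x. x * c)" by (auto simp: real_bounded_linear)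
  with trig_poly.scale[OF assms(2), of c] show ?case by (simp add: mult.commute)
qed (auto intro: trig_poly_const trig_poly.add trig_poly_mult)

lemma trig_poly_approx_compact:
  fixes h :: "'a::euclidean_space \<Rightarrow> real"
  assumes "compact K" "continuous_on K h" "0 < e"
  obtains p where "trig_poly p" "\<And>x. x \<in> K \<Longrightarrow> \<bar>h x - p x\<bar> < e"
proof -
  have sep: "\<exists>f\<in>Collect trig_poly. f x \<noteq> f y" if "x \<noteq> y" for x y :: 'a
  proof -
    define d where "d = x - y"
    have d: "d \<bullet> d > 0" using that by (simp add: d_def)
    \<comment> \<open>This scaling makes the two phases differ by exactly 1, which is not a multiple
      of the period, so the cosine or the sine tells x and y apart.\<close>
    define s where "s = (1 / (d \<bullet> d)) *\<^sub>R d"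
    have s: "s \<bullet> x - s \<bullet> y = 1"
      using d by (simp add: s_def d_def inner_simps diff_divide_distrib[symmetric])
    have "\<not> (cos (s \<bullet> x) = cos (s \<bullet> y) \<and> sin (s \<bullet> x) = sin (s \<bullet> y))"
    proof
      assume "cos (s \<bullet> x) = cos (s \<bullet> y) \<and> sin (s \<bullet> x) = sin (s \<bullet> y)"
      then have "cos (s \<bullet> x - s \<bullet> y) = 1"
        by (simp only: cos_diff) (metis sin_cos_squared_add3)
      then have "cos (1::real) = 1" by (simp only: s)
      moreover have "cos (1::real) < cos 0"
        by (rule cos_monotone_0_pi) (use pi_gt3 in auto)
      ultimately show False by simp
    qed
    then show ?thesis using trig_poly.cos[of s] trig_poly.sin[of s] by (metis mem_Collect_eq)
  qed
  interpret function_ring_on "Collect trig_poly" K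
    by unfold_locales (use assms(1) sep in
      \<open>auto intro: trig_poly_continuous trig_poly.add trig_poly_mult trig_poly_const\<close>)
  from Stone_Weierstrass_basic[OF assms(2,3)] that show thesis by blast
qed

text \<open>Composing with a polynomial that approximates the truncation of the real line at \<open>\<plusminus>m\<close>
  makes the bound of the trigonometric polynomial independent of the compact set and of \<open>e\<close>.\<close>

lemma trig_poly_approx:
  fixes h :: "'a::euclidean_space \<Rightarrow> real"
  assumes K: "compact K" and h: "continuous_on K h" and e: "0 < e"
    and m: "\<And>x. x \<in> K \<Longrightarrow> \<bar>h x\<bar> \<le> m" "0 \<le> m"
  obtains p where "trig_poly p" "\<And>x. x \<in> K \<Longrightarrow> \<bar>h x - p x\<bar> < e" "\<And>x. \<bar>p x\<bar> < m + e"
proof -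
  obtain p where p: "trig_poly p" "\<And>x. x \<in> K \<Longrightarrow> \<bar>h x - p x\<bar> < e / 2"
    using trig_poly_approx_compact[OF K h, of "e / 2"] e by auto
  obtain B where B: "\<And>x. \<bar>p x\<bar> \<le> B" using trig_poly_bounded[OF p(1)] by blast
  define c where "c u = max (- m) (min m u)" for u :: real
  have cc: "continuous_on {-B..B} c"
    unfolding c_def by (intro continuous_intros)
  obtain q where q: "real_polynomial_function q" "\<And>u. u \<in> {-B..B} \<Longrightarrow> \<bar>c u - q u\<bar> < e / 2"
    using Stone_Weierstrass_real_polynomial_function[OF compact_Icc cc half_gt_zero[OF e]] by blast
  have qp: "\<bar>c (p x) - q (p x)\<bar> < e / 2" for x
    using B[of x] by (intro q(2)) (auto simp: abs_le_iff)
  show thesis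
  proof (rule that)
    show "trig_poly (\<lambda>x. q (p x))" by (rule trig_poly_compose_polynomial[OF q(1) p(1)])
    show "\<bar>h x - q (p x)\<bar> < e" if "x \<in> K" for x
    proof -
      \<comment> \<open>h x lies in [-m, m] already, so clamping p x to this interval can only bring
        it closer.\<close>
      have "\<bar>h x - c (p x)\<bar> \<le> \<bar>h x - p x\<bar>"
        using m(1)[OF that] unfolding c_def max_def min_def by (auto simp: abs_le_iff)
      with qp[of x] p(2)[OF that] show ?thesis by arith
    qed
    show "\<bar>q (p x)\<bar> < m + e" for x
    proof -
      have "\<bar>c (p x)\<bar> \<le> m" using m(2) unfolding c_def by auto
      with qp[of x] e show ?thesis by arith
    qed
  qed
qed

section \<open>Tails and the continuity theorem for characteristic functions\<close>

lemma (in prob_space) integrable_bounded_continuous_compose: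
  fixes h :: "'b::euclidean_space \<Rightarrow> real"
  assumes "continuous_on UNIV h" "\<And>x. \<bar>h x\<bar> \<le> B" "Y \<in> borel_measurable M"
  shows "integrable M (\<lambda>\<omega>. h (Y \<omega>))"
  by (rule integrable_const_bound[where B=B])
    (use assms borel_measurable_continuous_onI[OF assms(1)] in \<open>auto intro: measurable_compose\<close>)

text \<open>Inside the ball of radius R the integrands differ by at most e; outside, the crude bound
  m + (m + 1) is paid on the tail event only.\<close>

lemma (in prob_space) expectation_compose_approx:
  fixes h p :: "'b::euclidean_space \<Rightarrow> real"
  assumes [measurable]: "Y \<in> borel_measurable M"
    and h: "continuous_on UNIV h" "\<And>x. \<bar>h x\<bar> \<le> m"
    and p: "continuous_on UNIV p" "\<And>x. \<bar>p x\<bar> \<le> m + 1"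
    and hp: "\<And>x. norm x \<le> R \<Longrightarrow> \<bar>h x - p x\<bar> \<le> e" and e: "0 \<le> e"
  shows "\<bar>expectation (\<lambda>\<omega>. h (Y \<omega>)) - expectation (\<lambda>\<omega>. p (Y \<omega>))\<bar>
    \<le> e + (2 * m + 1) * prob {\<omega>\<in>space M. R < norm (Y \<omega>)}"
proof -
  let ?A = "{\<omega>\<in>space M. R < norm (Y \<omega>)}"
  have i: "integrable M (\<lambda>\<omega>. h (Y \<omega>))" "integrable M (\<lambda>\<omega>. p (Y \<omega>))"
    by (rule integrable_bounded_continuous_compose[OF h], simp)
      (rule integrable_bounded_continuous_compose[OF p], simp)
  have "\<bar>expectation (\<lambda>\<omega>. h (Y \<omega>)) - expectation (\<lambda>\<omega>. p (Y \<omega>))\<bar>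
      = \<bar>expectation (\<lambda>\<omega>. h (Y \<omega>) - p (Y \<omega>))\<bar>"
    using i by simp
  also have "\<dots> \<le> expectation (\<lambda>\<omega>. \<bar>h (Y \<omega>) - p (Y \<omega>)\<bar>)"
    by (rule integral_abs_bound)
  also have "\<dots> \<le> expectation (\<lambda>\<omega>. e + (2 * m + 1) * indicator ?A \<omega>)"
  proof (rule integral_mono)
    show "\<bar>h (Y \<omega>) - p (Y \<omega>)\<bar> \<le> e + (2 * m + 1) * indicator ?A \<omega>" if "\<omega> \<in> space M" for \<omega>
      using hp[of "Y \<omega>"] h(2)[of "Y \<omega>"] p(2)[of "Y \<omega>"] that e by (auto simp: indicator_def)
  qed (use i in \<open>auto simp: less_top[symmetric]\<close>)
  also have "\<dots> = expectation (\<lambda>_. e) + expectation (\<lambda>\<omega>. (2 * m + 1) * indicator ?A \<omega>)"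
    by (intro Bochner_Integration.integral_add integrable_const integrable_mult_right integrable_real_indicator)
      (auto simp: less_top[symmetric])
  also have "\<dots> = e + (2 * m + 1) * prob ?A" by (simp add: prob_space)
  finally show ?thesis .
qed

lemma (in prob_space) tendsto_prob_norm_gt:
  fixes Y :: "'a \<Rightarrow> 'b::euclidean_space"
  assumes [measurable]: "Y \<in> borel_measurable M"
  shows "(\<lambda>k. prob {\<omega>\<in>space M. real k < norm (Y \<omega>)}) \<longlonglongrightarrow> 0"
proof -
  have "(\<lambda>k. prob {\<omega>\<in>space M. real k < norm (Y \<omega>)}) \<longlonglongrightarrow> prob (\<Inter>k. {\<omega>\<in>space M. real k < norm (Y \<omega>)})"
    by (rule finite_Lim_measure_decseq) (auto simp: decseq_def)
  also have "(\<Inter>k. {\<omega>\<in>space M. real k < norm (Y \<omega>)}) = {}"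
    by auto (meson not_less_iff_gr_or_eq reals_Archimedean2)
  finally show ?thesis by simp
qed

text \<open>The real and imaginary parts of the characteristic function are the expectations of the
  cosine and sine generators; linearity does the rest. Measurability is assumed only eventually
  because the estimator is specified from n = 2 on.\<close>

lemma tendsto_expectation_trig_poly:
  fixes p :: "'a::euclidean_space \<Rightarrow> real"
  assumes M: "prob_space M" and N: "prob_space N" "sets N = sets borel"
    and Y: "\<forall>\<^sub>F n in sequentially. Y n \<in> borel_measurable M"
    and char: "\<And>t. (\<lambda>n. LINT \<omega>|M. exp (\<i> * of_real (t \<bullet> Y n \<omega>))) \<longlonglongrightarrow> (LINT x|N. exp (\<i> * of_real (t \<bullet> x)))"
    and p: "trig_poly p"
  shows "(\<lambda>n. LINT \<omega>|M. p (Y n \<omega>)) \<longlonglongrightarrow> (LINT x|N. p x)"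
proof -
  interpret M: prob_space M by fact
  interpret N: prob_space N by fact
  have [measurable_cong]: "sets N = sets borel" by fact
  have iM: "integrable M (\<lambda>\<omega>. p (Y n \<omega>))" if "trig_poly p" "Y n \<in> borel_measurable M" for p n
  proof -
    obtain B where "\<And>x. \<bar>p x\<bar> \<le> B" by (rule exE[OF trig_poly_bounded[OF \<open>trig_poly p\<close>]]) auto
    with that show ?thesis
      by (intro M.integrable_bounded_continuous_compose[where B=B]) (auto intro: trig_poly_continuous)
  qed
  have iN: "integrable N p" if "trig_poly p" for p
  proof -
    obtain B where "\<And>x. \<bar>p x\<bar> \<le> B" by (rule exE[OF trig_poly_bounded[OF \<open>trig_poly p\<close>]]) auto
    with that show ?thesis
      using N.integrable_bounded_continuous_compose[where B=B and Y="\<lambda>x. x" and h=p] by (auto intro: trig_poly_continuous)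
  qed
  have cM: "(LINT \<omega>|M. exp (\<i> * of_real (t \<bullet> Y n \<omega>))) = Complex (LINT \<omega>|M. cos (t \<bullet> Y n \<omega>)) (LINT \<omega>|M. sin (t \<bullet> Y n \<omega>))"
    if "Y n \<in> borel_measurable M" for n t
  proof -
    have [measurable]: "Y n \<in> borel_measurable M" by fact
    have i: "integrable M (\<lambda>\<omega>. exp (\<i> * of_real (t \<bullet> Y n \<omega>)))"
      by (rule M.integrable_iexp) auto
    show ?thesis
      by (rule complex_eqI) (simp_all add: integral_Re[OF i, symmetric] integral_Im[OF i, symmetric] Re_exp Im_exp)
  qed
  have cN: "(LINT x|N. exp (\<i> * of_real (t \<bullet> x))) = Complex (LINT x|N. cos (t \<bullet> x)) (LINT x|N. sin (t \<bullet> x))"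
    for t
  proof -
    have i: "integrable N (\<lambda>x. exp (\<i> * of_real (t \<bullet> x)))"
      by (rule N.integrable_iexp) auto
    show ?thesis
      by (rule complex_eqI) (simp_all add: integral_Re[OF i, symmetric] integral_Im[OF i, symmetric] Re_exp Im_exp)
  qed
  have base: "(\<lambda>n. Complex (LINT \<omega>|M. cos (t \<bullet> Y n \<omega>)) (LINT \<omega>|M. sin (t \<bullet> Y n \<omega>)))
     \<longlonglongrightarrow> Complex (LINT x|N. cos (t \<bullet> x)) (LINT x|N. sin (t \<bullet> x))" for t
    by (rule Lim_transform_eventually[OF char[of t, unfolded cN]])
      (use Y in eventually_elim, simp add: cM)
  show ?thesis using p
  proof (induction rule: trig_poly.induct)
    case (cos t)
    show ?case using tendsto_Re[OF base[of t]] by simp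
  next
    case (sin t)
    show ?case using tendsto_Im[OF base[of t]] by simp
  next
    case (scale p c)
    show ?case using tendsto_mult_left[OF scale.IH, of c] by simp
  next
    case (add p q)
    have "(\<lambda>n. (LINT \<omega>|M. p (Y n \<omega>)) + (LINT \<omega>|M. q (Y n \<omega>))) \<longlonglongrightarrow> (LINT x|N. p x) + (LINT x|N. q x)"
      by (intro tendsto_add add.IH)
    then have "(\<lambda>n. (LINT \<omega>|M. p (Y n \<omega>)) + (LINT \<omega>|M. q (Y n \<omega>))) \<longlonglongrightarrow> (LINT x|N. p x + q x)"
      using iN[OF add.hyps(1)] iN[OF add.hyps(2)] by simp
    then show ?case
      by (rule Lim_transform_eventually)
        (use Y in eventually_elim, use iM add.hyps in simp)
  qed
qed

text \<open>Tightness provides one ball that carries almost all mass of N and of every late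
  \<open>Y n\<close>. On it the test function is replaced by a trigonometric polynomial whose global
  bound does not depend on the ball, so the neglected mass enters with a fixed factor.\<close>

theorem levy_continuity_of_tight:
  fixes Y :: "nat \<Rightarrow> 'w \<Rightarrow> 'a::euclidean_space"
  assumes M: "prob_space M" and N: "prob_space N" "sets N = sets borel"
    and Y: "\<forall>\<^sub>F n in sequentially. Y n \<in> borel_measurable M"
    and tight: "\<And>e. 0 < e \<Longrightarrow> \<exists>R. \<forall>\<^sub>F n in sequentially. measure M {\<omega>\<in>space M. R < norm (Y n \<omega>)} \<le> e"
    and char: "\<And>t. (\<lambda>n. LINT \<omega>|M. exp (\<i> * of_real (t \<bullet> Y n \<omega>))) \<longlonglongrightarrow> (LINT x|N. exp (\<i> * of_real (t \<bullet> x)))"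
  shows "converges_in_distribution M Y N"
  unfolding converges_in_distribution_def
proof (intro allI impI)
  fix h :: "'a \<Rightarrow> real"
  assume hh: "continuous_on UNIV h \<and> bounded (range h)"
  then obtain m where m: "0 < m" "\<And>x. \<bar>h x\<bar> \<le> m"
    unfolding bounded_pos by auto
  interpret M: prob_space M by fact
  interpret N: prob_space N by fact
  have [measurable_cong]: "sets N = sets borel" by fact
  have idN: "(\<lambda>x. x) \<in> borel_measurable N" by (rule measurable_ident_sets[OF N(2)])
  show "(\<lambda>n. LINT \<omega>|M. h (Y n \<omega>)) \<longlonglongrightarrow> (LINT y|N. h y)"
  proof (rule tendstoI)
    fix \<epsilon> :: real assume "0 < \<epsilon>"
    \<comment> \<open>Two replacements of h by p cost e + (2m + 1)e each and the convergence for p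
      costs e, in total (5 + 4m)e. The cap at 1 turns the bound m + e for p into m + 1.\<close>
    define e where "e = min 1 (\<epsilon> / (5 + 4 * m))"
    have e: "0 < e" "e \<le> 1" using \<open>0 < \<epsilon>\<close> m(1) by (auto simp: e_def)
    have "e * (5 + 4 * m) \<le> \<epsilon> / (5 + 4 * m) * (5 + 4 * m)"
      using m(1) by (intro mult_right_mono) (auto simp: e_def)
    then have e\<epsilon>: "e * (5 + 4 * m) \<le> \<epsilon>" using m(1) by simp
    obtain R1 where R1: "\<forall>\<^sub>F n in sequentially. M.prob {\<omega>\<in>space M. R1 < norm (Y n \<omega>)} \<le> e"
      using tight[OF e(1)] by blast
    have "\<forall>\<^sub>F k in sequentially. N.prob {x\<in>space N. real k < norm x} < e"
      using N.tendsto_prob_norm_gt[OF idN] e(1) by (auto dest: order_tendstoD)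
    then obtain k where k: "N.prob {x\<in>space N. real k < norm x} < e"
      by (auto simp: eventually_sequentially)
    define R where "R = max R1 (real k)"
    have RM: "M.prob {\<omega>\<in>space M. R < norm (Y n \<omega>)} \<le> e"
      if "M.prob {\<omega>\<in>space M. R1 < norm (Y n \<omega>)} \<le> e" "Y n \<in> borel_measurable M" for n
    proof -
      have [measurable]: "Y n \<in> borel_measurable M" by fact
      have "M.prob {\<omega>\<in>space M. R < norm (Y n \<omega>)} \<le> M.prob {\<omega>\<in>space M. R1 < norm (Y n \<omega>)}"
        by (rule M.finite_measure_mono) (auto simp: R_def)
      with that(1) show ?thesis by linarith
    qed
    have "N.prob {x\<in>space N. R < norm x} \<le> N.prob {x\<in>space N. real k < norm x}"
      by (rule N.finite_measure_mono) (auto simp: R_def)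
    with k have RN: "N.prob {x\<in>space N. R < norm x} \<le> e" by linarith
    obtain p where p: "trig_poly p" "\<And>x. x \<in> cball 0 R \<Longrightarrow> \<bar>h x - p x\<bar> < e" "\<And>x. \<bar>p x\<bar> < m + e"
      using trig_poly_approx[of "cball 0 R" h e m] hh m e continuous_on_subset[of UNIV h "cball 0 R"]
      by auto
    have p1: "\<bar>p x\<bar> \<le> m + 1" for x using p(3)[of x] e(2) by linarith
    have bM: "\<bar>(LINT \<omega>|M. h (Y n \<omega>)) - (LINT \<omega>|M. p (Y n \<omega>))\<bar> \<le> e + (2 * m + 1) * e"
      if "M.prob {\<omega>\<in>space M. R1 < norm (Y n \<omega>)} \<le> e" "Y n \<in> borel_measurable M" for n
    proof -
      have "\<bar>(LINT \<omega>|M. h (Y n \<omega>)) - (LINT \<omega>|M. p (Y n \<omega>))\<bar>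
        \<le> e + (2 * m + 1) * M.prob {\<omega>\<in>space M. R < norm (Y n \<omega>)}"
        by (rule M.expectation_compose_approx)
          (use that hh m p(2) p1 e in \<open>auto intro: trig_poly_continuous[OF p(1)] less_imp_le\<close>)
      also have "\<dots> \<le> e + (2 * m + 1) * e"
        using RM[OF that] m(1) by (intro add_left_mono mult_left_mono) auto
      finally show ?thesis .
    qed
    have bN: "\<bar>(LINT x|N. h x) - (LINT x|N. p x)\<bar> \<le> e + (2 * m + 1) * e"
    proof -
      have "\<bar>(LINT x|N. h x) - (LINT x|N. p x)\<bar>
        \<le> e + (2 * m + 1) * N.prob {x\<in>space N. R < norm x}"
        by (rule N.expectation_compose_approx[OF idN])
          (use hh m p(2) p1 e in \<open>auto intro: trig_poly_continuous[OF p(1)] less_imp_le\<close>)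
      also have "\<dots> \<le> e + (2 * m + 1) * e"
        using RN m(1) by (intro add_left_mono mult_left_mono) auto
      finally show ?thesis .
    qed
    have "\<forall>\<^sub>F n in sequentially. dist (LINT \<omega>|M. p (Y n \<omega>)) (LINT x|N. p x) < e"
      using tendsto_expectation_trig_poly[OF M N Y char p(1)] e(1) by (rule tendstoD)
    with R1 Y show "\<forall>\<^sub>F n in sequentially. dist (LINT \<omega>|M. h (Y n \<omega>)) (LINT y|N. h y) < \<epsilon>"
    proof eventually_elim
      case (elim n)
      from bM[OF elim(1,2)] bN elim(3)
      have "dist (LINT \<omega>|M. h (Y n \<omega>)) (LINT y|N. h y) < e * (5 + 4 * m)"
        by (simp add: dist_real_def algebra_simps)
      with e\<epsilon> show ?case by linarith
    qed
  qed
qed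

section \<open>Existence of the normal law\<close>

lemma outer_nth: "outer v $ i $ j = v $ i * v $ j"
  by (simp add: outer_def columnvector_def rowvector_def matrix_matrix_mult_def)

lemma outer_mult_vec: "outer v *v x = (v \<bullet> x) *\<^sub>R v"
  by (simp add: vec_eq_iff matrix_vector_mult_def outer_nth inner_vec_def sum_distrib_left mult_ac)

lemma matrix_vector_mult_sum_left: "(\<Sum>i\<in>I. B i) *v x = (\<Sum>i\<in>I. (B i :: real^'n^'m) *v x)"
  by (induction I rule: infinite_finite_induct) (auto simp: matrix_vector_mult_add_rdistrib)

lemma inner_symmetric_matrix:
  fixes \<Sigma> :: "real^'n^'n"
  assumes "transpose \<Sigma> = \<Sigma>"
  shows "x \<bullet> (\<Sigma> *v y) = (\<Sigma> *v x) \<bullet> y"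
  by (metis assms dot_lmul_matrix transpose_matrix_vector)

text \<open>Cholesky's elimination: once \<open>q = \<Sigma>\<^bsub>ii\<^esub> > 0\<close>, subtracting the outer square of the scaled
  \<open>i\<close>-th column leaves a positive semidefinite matrix that kills the \<open>i\<close>-th axis.\<close>

lemma psd_eq_sum_outer_aux:
  fixes \<Sigma> :: "real^'n^'n" and I :: "'n set"
  assumes "finite I" "transpose \<Sigma> = \<Sigma>" "\<And>x. 0 \<le> x \<bullet> (\<Sigma> *v x)" "\<And>i. i \<notin> I \<Longrightarrow> \<Sigma> *v axis i 1 = 0"
  shows "\<exists>w. \<Sigma> = (\<Sum>i\<in>I. outer (w i))"
  using assms
proof (induction I arbitrary: \<Sigma> rule: finite_induct)
  case empty
  have "\<Sigma> $ j $ i = 0" for i j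
    using empty.prems(3)[of i] by (metis column_def matrix_vector_mul_component
      empty_iff matrix_vector_mult_basis vec_lambda_beta zero_index)
  then show ?case by (simp add: vec_eq_iff)
next
  case (insert k I)
  define c where "c = \<Sigma> *v axis k 1"
  define q where "q = axis k 1 \<bullet> c"
  have q0: "q \<ge> 0" unfolding q_def c_def by (rule insert.prems)
  have ck: "x \<bullet> c = (\<Sigma> *v x) \<bullet> axis k 1" for x
    unfolding c_def by (rule inner_symmetric_matrix[OF insert.prems(1)])
  \<comment> \<open>Cauchy-Schwarz for the semidefinite form: the quadratic polynomial in s obtained
    by moving x along the k-th axis is nonnegative. If its leading coefficient q is zero, its linear
    coefficient must vanish.\<close>
  have disc: "(x \<bullet> c)\<^sup>2 \<le> q * (x \<bullet> (\<Sigma> *v x))" for x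
  proof -
    have e: "(x + s *\<^sub>R axis k 1) \<bullet> (\<Sigma> *v (x + s *\<^sub>R axis k 1)) = x \<bullet> (\<Sigma> *v x) + 2 * s * (x \<bullet> c) + s\<^sup>2 * q" for s
    proof -
      have "axis k 1 \<bullet> (\<Sigma> *v x) = x \<bullet> c" using ck[of x] by (simp add: inner_commute)
      then show ?thesis
        by (simp add: matrix_vector_right_distrib matrix_vector_mult_scaleR inner_simps q_def c_def[symmetric] power2_eq_square algebra_simps)
    qed
    show ?thesis
    proof (cases "q = 0")
      case False
      with q0 have "q > 0" by simp
      have "0 \<le> x \<bullet> (\<Sigma> *v x) + 2 * (- (x \<bullet> c) / q) * (x \<bullet> c) + (- (x \<bullet> c) / q)\<^sup>2 * q"
        using insert.prems(2)[of "x + (- (x \<bullet> c) / q) *\<^sub>R axis k 1"] unfolding e .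
      also have "\<dots> = x \<bullet> (\<Sigma> *v x) - (x \<bullet> c)\<^sup>2 / q"
        using \<open>q > 0\<close> by (simp add: field_simps power2_eq_square)
      finally show ?thesis using \<open>q > 0\<close> by (simp add: field_simps)
    next
      case True
      have "x \<bullet> c = 0"
      proof (rule ccontr)
        assume nz: "x \<bullet> c \<noteq> 0"
        \<comment> \<open>Solves for the s at which the now affine expression equals -1.\<close>
        define s where "s = - (x \<bullet> (\<Sigma> *v x) + 1) / (2 * (x \<bullet> c))"
        have "0 \<le> x \<bullet> (\<Sigma> *v x) + 2 * s * (x \<bullet> c)"
          using insert.prems(2)[of "x + s *\<^sub>R axis k 1"] unfolding e True by simp
        also have "\<dots> = -1" using nz by (simp add: s_def field_simps)
        finally show False by simp
      qed
      then show ?thesis using True by simp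
    qed
  qed
  have c0: "c = 0" if "q = 0" using disc[of c] that by simp
  \<comment> \<open>If q = 0 then c = 0, and division by zero gives w = 0, so nothing is subtracted;
    the formula for \<open>\<Sigma>' *v x\<close> below holds in both cases.\<close>
  define w where "w = (1 / sqrt q) *\<^sub>R c"
  define \<Sigma>' where "\<Sigma>' = \<Sigma> - outer w"
  have \<Sigma>'x: "\<Sigma>' *v x = \<Sigma> *v x - ((x \<bullet> c) / q) *\<^sub>R c" for x
    using q0 by (simp add: \<Sigma>'_def matrix_vector_mult_diff_rdistrib outer_mult_vec w_def inner_commute)
  have "\<exists>w. \<Sigma>' = (\<Sum>i\<in>I. outer (w i))"
  proof (rule insert.IH)
    show "transpose \<Sigma>' = \<Sigma>'"
      using insert.prems(1) by (simp add: \<Sigma>'_def vec_eq_iff transpose_def outer_nth mult.commute)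
    show "0 \<le> x \<bullet> (\<Sigma>' *v x)" for x
      using disc[of x] q0 insert.prems(2)[of x] by (cases "q = 0")
        (auto simp: \<Sigma>'x inner_diff_right divide_simps power2_eq_square mult_ac)
    show "\<Sigma>' *v axis i 1 = 0" if "i \<notin> I" for i
    proof (cases "i = k")
      case True
      then show ?thesis using c0 by (cases "q = 0") (auto simp: \<Sigma>'x c_def[symmetric] q_def[symmetric])
    next
      case False
      then have 0: "\<Sigma> *v axis i 1 = 0" using insert.prems(3) that by auto
      then have "axis i 1 \<bullet> c = 0" unfolding ck by simp
      then show ?thesis by (simp add: \<Sigma>'x 0)
    qed
  qed
  then obtain w' where "\<Sigma>' = (\<Sum>i\<in>I. outer (w' i))" by blast
  then have "\<Sigma> = (\<Sum>i\<in>I. outer (w' i)) + outer w" by (simp add: \<Sigma>'_def diff_eq_eq)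
  also have "\<dots> = (\<Sum>i\<in>insert k I. outer ((w'(k := w)) i))"
  proof -
    have "(\<Sum>i\<in>I. outer ((w'(k := w)) i)) = (\<Sum>i\<in>I. outer (w' i))"
      using insert.hyps by (intro sum.cong) auto
    then show ?thesis using insert.hyps by (simp add: add.commute)
  qed
  finally show ?case by blast
qed

lemma psd_eq_sum_outer:
  fixes \<Sigma> :: "real^'n^'n"
  assumes "transpose \<Sigma> = \<Sigma>" "\<And>x. 0 \<le> x \<bullet> (\<Sigma> *v x)"
  obtains w :: "'n \<Rightarrow> real^'n" where "\<Sigma> = (\<Sum>i\<in>UNIV. outer (w i))"
  using psd_eq_sum_outer_aux[OF finite assms] by auto

text \<open>The law is the image of independent standard normals y under y -> sum of y_i w_i. Its
  characteristic function at t is a product of one-dimensional ones, at the points t \<bullet> w_i,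
  whose squares add up to t \<bullet> (\<Sigma> t).\<close>

theorem multivariate_normal_exists:
  fixes \<Sigma> :: "real^'n^'n"
  assumes "transpose \<Sigma> = \<Sigma>" "\<And>x. 0 \<le> x \<bullet> (\<Sigma> *v x)"
  shows "\<exists>N. multivariate_normal 0 \<Sigma> N"
proof -
  obtain w :: "'n \<Rightarrow> real^'n" where w: "\<Sigma> = (\<Sum>i\<in>UNIV. outer (w i))" using psd_eq_sum_outer[OF assms] by blast
  interpret real_distribution std_normal_distribution by (rule real_dist_normal_dist)
  interpret product_sigma_finite "\<lambda>_::'n. std_normal_distribution" by unfold_locales
  interpret P: product_prob_space "\<lambda>_::'n. std_normal_distribution" UNIV by unfold_locales
  let ?P = "PiM (UNIV :: 'n set) (\<lambda>_. std_normal_distribution)"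
  define L where "L y = (\<Sum>i\<in>UNIV. y i *\<^sub>R w i)" for y :: "'n \<Rightarrow> real"
  have L[measurable]: "L \<in> borel_measurable ?P"
    unfolding L_def by (intro borel_measurable_sum borel_measurable_scaleR borel_measurable_const)
      (rule measurable_compose[OF measurable_component_singleton], simp_all)
  define N where "N = distr ?P borel L"
  have "multivariate_normal 0 \<Sigma> N"
    unfolding multivariate_normal_def
  proof (intro conjI allI)
    show "prob_space N" unfolding N_def by (intro P.prob_space_distr L)
    show "sets N = sets borel" by (simp add: N_def)
    show "transpose \<Sigma> = \<Sigma>" by fact
    fix t :: "real^'n"
    have tL: "t \<bullet> L y = (\<Sum>i\<in>UNIV. (t \<bullet> w i) * y i)" for y
      by (simp add: L_def inner_sum_right mult.commute)
    have q: "t \<bullet> (\<Sigma> *v t) = (\<Sum>i\<in>UNIV. (t \<bullet> w i)\<^sup>2)"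
      by (simp add: w matrix_vector_mult_sum_left outer_mult_vec inner_sum_right power2_eq_square inner_commute)
    have "(LINT x|N. exp (\<i> * of_real (t \<bullet> x))) = (LINT y|?P. exp (\<i> * of_real (t \<bullet> L y)))"
      unfolding N_def by (rule integral_distr[OF L]) (intro borel_measurable_continuous_onI continuous_intros)
    also have "\<dots> = (LINT y|?P. (\<Prod>i\<in>UNIV. iexp ((t \<bullet> w i) * y i)))"
      by (simp add: tL exp_sum[symmetric] sum_distrib_left)
    also have "\<dots> = (\<Prod>i\<in>UNIV. (LINT y|std_normal_distribution. iexp ((t \<bullet> w i) * y)))"
      by (rule product_integral_prod) (auto intro!: integrable_iexp)
    also have "\<dots> = (\<Prod>i\<in>UNIV. char std_normal_distribution (t \<bullet> w i))"
      by (simp add: char_def)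
    also have "\<dots> = exp (\<Sum>i\<in>UNIV. - of_real ((t \<bullet> w i)\<^sup>2) / 2)"
      by (simp add: char_std_normal_distribution exp_sum exp_of_real[symmetric])
    also have "(\<Sum>i\<in>UNIV. - of_real ((t \<bullet> w i)\<^sup>2) / 2) = - of_real (t \<bullet> (\<Sigma> *v t)) / (2::complex)"
      by (simp add: q sum_divide_distrib[symmetric] sum_negf)
    finally show "(LINT x|N. exp (\<i> * of_real (t \<bullet> x)))
        = exp (\<i> * of_real (t \<bullet> 0) - of_real (t \<bullet> (\<Sigma> *v t)) / 2)" by simp
  qed
  then show ?thesis by blast
qed

section \<open>Sums of independent random variables\<close>

text \<open>The central limit theorem divides by the standard deviation, so v = 0 is treated apart;
  it does occur, for directions in the kernel of a singular covariance. No frequency variable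
  appears because the direction t will be absorbed into the summands.\<close>

lemma (in prob_space) tendsto_expectation_iexp_sum_iid:
  fixes \<xi> :: "nat \<Rightarrow> 'a \<Rightarrow> real"
  assumes indep: "indep_vars (\<lambda>_. borel) \<xi> UNIV"
    and mean: "\<And>n. expectation (\<xi> n) = 0"
    and int: "\<And>n. integrable M (\<lambda>\<omega>. (\<xi> n \<omega>)\<^sup>2)"
    and var: "\<And>n. expectation (\<lambda>\<omega>. (\<xi> n \<omega>)\<^sup>2) = v"
    and distr: "\<And>n. distr M borel (\<xi> n) = \<mu>"
  shows "(\<lambda>n. CLINT \<omega>|M. iexp ((\<Sum>i<n. \<xi> i \<omega>) / sqrt (real n))) \<longlonglongrightarrow> exp (- of_real v / 2)"
proof (cases "v = 0")
  case True
  have "AE \<omega> in M. (\<xi> n \<omega>)\<^sup>2 = 0" for n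
    by (subst integral_nonneg_eq_0_iff_AE[symmetric]) (use int var True in auto)
  then have "AE \<omega> in M. \<forall>n. \<xi> n \<omega> = 0" by (simp add: AE_all_countable)
  then have ae: "AE \<omega> in M. iexp ((\<Sum>i<n. \<xi> i \<omega>) / sqrt (real n)) = 1" for n
    by eventually_elim simp
  have [measurable]: "random_variable borel (\<xi> n)" for n
    using indep unfolding indep_vars_def2 by simp
  have "(CLINT \<omega>|M. iexp ((\<Sum>i<n. \<xi> i \<omega>) / sqrt (real n))) = (CLINT \<omega>|M. 1)" for n
    by (rule integral_cong_AE) (use ae in auto)
  with True show ?thesis by (simp add: prob_space)
next
  case False
  have [measurable]: "random_variable borel (\<xi> n)" for n
    using indep unfolding indep_vars_def2 by simp
  have "v \<ge> 0" unfolding var[of 0, symmetric] by (rule integral_nonneg_AE) simp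
  with False have v: "v > 0" by simp
  have "weak_conv_m (\<lambda>n. distr M borel (\<lambda>\<omega>. (\<Sum>i<n. \<xi> i \<omega>) / sqrt (n * (sqrt v)\<^sup>2))) std_normal_distribution"
    by (rule central_limit_theorem_zero_mean[OF indep mean _ int _ distr])
      (use v var mean in auto)
  \<comment> \<open>Evaluating at sqrt v undoes the normalisation of the sum by the standard
    deviation.\<close>
  then have "(\<lambda>n. char (distr M borel (\<lambda>\<omega>. (\<Sum>i<n. \<xi> i \<omega>) / sqrt (n * (sqrt v)\<^sup>2))) (sqrt v))
      \<longlonglongrightarrow> char std_normal_distribution (sqrt v)"
    by (intro levy_continuity1 real_dist_normal_dist real_distribution_distr) auto
  moreover have "char (distr M borel (\<lambda>\<omega>. (\<Sum>i<n. \<xi> i \<omega>) / sqrt (n * (sqrt v)\<^sup>2))) (sqrt v)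
    = (CLINT \<omega>|M. iexp ((\<Sum>i<n. \<xi> i \<omega>) / sqrt (real n)))" for n
    using v by (simp add: char_def integral_distr real_sqrt_mult)
  moreover have "char std_normal_distribution (sqrt v) = exp (- of_real v / 2)"
    using v by (simp add: char_std_normal_distribution exp_of_real[symmetric] of_real_power[symmetric] del: of_real_power)
  ultimately show ?thesis by simp
qed

lemma (in prob_space) second_moment_sum_indep:
  fixes \<xi> :: "'i \<Rightarrow> 'a \<Rightarrow> real"
  assumes "finite I" "indep_vars (\<lambda>_. borel) \<xi> I"
    and "\<And>i. i \<in> I \<Longrightarrow> expectation (\<xi> i) = 0" "\<And>i \<omega>. i \<in> I \<Longrightarrow> \<bar>\<xi> i \<omega>\<bar> \<le> B"
  shows "expectation (\<lambda>\<omega>. (\<Sum>i\<in>I. \<xi> i \<omega>)\<^sup>2) = (\<Sum>i\<in>I. expectation (\<lambda>\<omega>. (\<xi> i \<omega>)\<^sup>2))"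
  using assms
proof (induction I rule: finite_induct)
  case (insert k I)
  have [measurable]: "random_variable borel (\<xi> i)" if "i \<in> insert k I" for i
    using insert.prems(1) that unfolding indep_vars_def2 by auto
  define S where "S \<omega> = (\<Sum>i\<in>I. \<xi> i \<omega>)" for \<omega>
  have S[measurable]: "random_variable borel S" unfolding S_def by measurable
  have k[measurable]: "random_variable borel (\<xi> k)" by measurable
  have bk: "\<bar>\<xi> k \<omega>\<bar> \<le> B" for \<omega> using insert.prems by simp
  have bS: "\<bar>S \<omega>\<bar> \<le> real (card I) * B" for \<omega>
    unfolding S_def by (rule order_trans[OF sum_abs sum_bounded_above]) (use insert.prems(3) in auto)
  have ik: "integrable M (\<xi> k)" by (rule integrable_const_bound[where B=B]) (use bk in auto)
  have iS: "integrable M S" by (rule integrable_const_bound[where B="real (card I) * B"]) (use bS in auto)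
  have ik2: "integrable M (\<lambda>\<omega>. (\<xi> k \<omega>)\<^sup>2)"
    by (rule integrable_const_bound[where B="B\<^sup>2"]) (use power_mono[OF bk, where n=2] in auto)
  have iS2: "integrable M (\<lambda>\<omega>. (S \<omega>)\<^sup>2)"
    by (rule integrable_const_bound[where B="(real (card I) * B)\<^sup>2"]) (use power_mono[OF bS, where n=2] in auto)
  have ind: "indep_var borel (\<xi> k) borel S"
    unfolding S_def using insert by (intro indep_vars_sum) auto
  have ikS: "integrable M (\<lambda>\<omega>. \<xi> k \<omega> * S \<omega>)"
    by (rule indep_var_integrable[OF ind ik iS])
  have "expectation (\<lambda>\<omega>. \<xi> k \<omega> * S \<omega>) = expectation (\<xi> k) * expectation S"
    by (rule indep_var_lebesgue_integral[OF ind ik iS])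
  also have "\<dots> = 0" using insert.prems(2) by simp
  finally have z: "expectation (\<lambda>\<omega>. \<xi> k \<omega> * S \<omega>) = 0" .
  have "expectation (\<lambda>\<omega>. (\<Sum>i\<in>insert k I. \<xi> i \<omega>)\<^sup>2) = expectation (\<lambda>\<omega>. (\<xi> k \<omega>)\<^sup>2 + 2 * (\<xi> k \<omega> * S \<omega>) + (S \<omega>)\<^sup>2)"
    using insert.hyps by (simp add: S_def power2_sum algebra_simps)
  also have "\<dots> = expectation (\<lambda>\<omega>. (\<xi> k \<omega>)\<^sup>2) + expectation (\<lambda>\<omega>. (S \<omega>)\<^sup>2)"
    using ik2 iS2 ikS z by simp
  also have "expectation (\<lambda>\<omega>. (S \<omega>)\<^sup>2) = (\<Sum>i\<in>I. expectation (\<lambda>\<omega>. (\<xi> i \<omega>)\<^sup>2))"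
    unfolding S_def by (rule insert.IH) (use insert.prems in \<open>auto intro: indep_vars_subset\<close>)
  finally show ?case using insert.hyps by simp
qed simp

section \<open>Identifiability of the mixing parameters\<close>

text \<open>The quotients sin(kx)/sin x, k = 1..4, are the Chebyshev polynomials of the second kind
  in cos x and span the cubics. Hence four vanishing sine sums amount to orthogonality to sin x
  times every cubic in cos x.\<close>

lemma sin_times_poly_cos_identity:
  fixes x q0 q1 q2 q3 :: real
  shows "sin x * (q0 + q1 * cos x + q2 * (cos x)\<^sup>2 + q3 * (cos x)^3)
     = (q0 + q2 / 4) * sin x + (q1 / 2 + q3 / 4) * sin (2 * x) + q2 / 4 * sin (3 * x) + q3 / 8 * sin (4 * x)"
proof -
  have s2: "sin (2 * x) = 2 * sin x * cos x" by (rule sin_double)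
  have sq: "(sin x)\<^sup>2 = 1 - (cos x)\<^sup>2" by (simp add: sin_squared_eq)
  have c2: "cos (2 * x) = 2 * (cos x)\<^sup>2 - 1" by (rule cos_double_cos)
  have s3: "sin (3 * x) = sin x * (4 * (cos x)\<^sup>2 - 1)"
  proof -
    have "sin (3 * x) = sin (2 * x + x)" by simp
    also have "\<dots> = sin x * (4 * (cos x)\<^sup>2 - 1)"
      unfolding sin_add s2 c2 by (simp add: algebra_simps power2_eq_square)
    finally show ?thesis .
  qed
  have s4: "sin (4 * x) = sin x * (8 * (cos x)^3 - 4 * cos x)"
  proof -
    have "sin (4 * x) = sin (2 * (2 * x))" by simp
    also have "\<dots> = sin x * (8 * (cos x)^3 - 4 * cos x)"
      unfolding sin_double[of "2 * x"] s2 c2 by (simp add: algebra_simps power2_eq_square power3_eq_cube)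
    finally show ?thesis .
  qed
  show ?thesis unfolding s2 s3 s4 by (simp add: field_simps)
qed

lemma sum_sin_poly_cos_eq_0:
  fixes w x :: "'i \<Rightarrow> real"
  assumes "\<forall>l\<in>{1,2,3,4::nat}. (\<Sum>i\<in>I. w i * sin (real l * x i)) = 0"
  shows "(\<Sum>i\<in>I. w i * (sin (x i) * (q0 + q1 * cos (x i) + q2 * (cos (x i))\<^sup>2 + q3 * (cos (x i))^3))) = 0"
proof -
  have "(\<Sum>i\<in>I. w i * (sin (x i) * (q0 + q1 * cos (x i) + q2 * (cos (x i))\<^sup>2 + q3 * (cos (x i))^3)))
     = (q0 + q2 / 4) * (\<Sum>i\<in>I. w i * sin (x i)) + (q1 / 2 + q3 / 4) * (\<Sum>i\<in>I. w i * sin (2 * x i))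
       + q2 / 4 * (\<Sum>i\<in>I. w i * sin (3 * x i)) + q3 / 8 * (\<Sum>i\<in>I. w i * sin (4 * x i))"
    unfolding sin_times_poly_cos_identity
    by (simp add: sum_distrib_left sum.distrib[symmetric] algebra_simps)
  with assms show ?thesis by simp
qed

text \<open>The Vandermonde argument in interpolation form: test with a cubic in the cosine that
  vanishes at all nodes except those whose cosine equals cos x1. Distinct nodes may share a cosine,
  so these have to stay together.\<close>

lemma four_nodes_balance:
  fixes w1 w2 w3 w4 x1 x2 x3 x4 :: real
  assumes "\<forall>l\<in>{1,2,3,4::nat}. w1 * sin (real l * x1) + w2 * sin (real l * x2)
      + w3 * sin (real l * x3) + w4 * sin (real l * x4) = 0"
  shows "w1 * sin x1 + (if cos x2 = cos x1 then w2 * sin x2 else 0)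
      + (if cos x3 = cos x1 then w3 * sin x3 else 0)
      + (if cos x4 = cos x1 then w4 * sin x4 else 0) = 0"
proof -
  define r where "r x = (if cos x = cos x1 then 1 else 0 :: real)" for x
  \<comment> \<open>The factor belonging to a node: a linear root factor, or the constant 1 if its
    root would be cos x1 itself. \<open>a\<close> and \<open>b\<close> are its coefficients, from
    which those of the cubic are expanded.\<close>
  define d where "d x y = (if cos x = cos x1 then 1 else y - cos x)" for x y :: real
  define a b where "a x = (if cos x = cos x1 then 1 else - cos x)"
    and "b x = (if cos x = cos x1 then 0 else 1::real)" for x
  define q0 q1 q2 q3 where "q0 = a x2 * a x3 * a x4"
    and "q1 = b x2 * a x3 * a x4 + a x2 * b x3 * a x4 + a x2 * a x3 * b x4"
    and "q2 = b x2 * b x3 * a x4 + b x2 * a x3 * b x4 + a x2 * b x3 * b x4"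
    and "q3 = b x2 * b x3 * b x4"
  have dab: "d x y = a x + b x * y" for x y by (simp add: d_def a_def b_def)
  define P where "P y = d x2 y * d x3 y * d x4 y" for y
  have P: "P y = q0 + q1 * y + q2 * y\<^sup>2 + q3 * y^3" for y
    unfolding P_def dab q0_def q1_def q2_def q3_def
    by (simp add: algebra_simps power2_eq_square power3_eq_cube)
  have S: "w1 * (sin x1 * P (cos x1)) + w2 * (sin x2 * P (cos x2)) + w3 * (sin x3 * P (cos x3)) + w4 * (sin x4 * P (cos x4)) = 0"
    using sum_sin_poly_cos_eq_0[where I="{0..<4::nat}" and w="\<lambda>i. [w1,w2,w3,w4] ! i" and x="\<lambda>i. [x1,x2,x3,x4] ! i", of q0 q1 q2 q3] assms
    by (simp add: P eval_nat_numeral add.assoc)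
  have Px: "P (cos x) = P (cos x1) * r x" if "x \<in> {x1, x2, x3, x4}" for x
    using that by (auto simp: P_def d_def r_def)
  have "P (cos x1) \<noteq> 0" by (simp add: P_def d_def)
  have "P (cos x1) * (w1 * sin x1 + w2 * sin x2 * r x2 + w3 * sin x3 * r x3 + w4 * sin x4 * r x4) = 0"
    using S Px[of x2] Px[of x3] Px[of x4] by (simp add: algebra_simps)
  with \<open>P (cos x1) \<noteq> 0\<close>
  have "w1 * sin x1 + w2 * sin x2 * r x2 + w3 * sin x3 * r x3 + w4 * sin x4 * r x4 = 0" by simp
  then show ?thesis by (simp add: r_def split: if_splits)
qed

lemma cos_eq_iff_abs_eq:
  fixes x y :: real
  assumes "\<bar>x\<bar> \<le> pi" "\<bar>y\<bar> \<le> pi"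
  shows "cos x = cos y \<longleftrightarrow> x = y \<or> x = - y"
proof -
  have "cos x = cos y \<longleftrightarrow> cos \<bar>x\<bar> = cos \<bar>y\<bar>" by simp
  also have "\<dots> \<longleftrightarrow> \<bar>x\<bar> = \<bar>y\<bar>" using assms cos_inj_pi[of "\<bar>x\<bar>" "\<bar>y\<bar>"] by (auto dest: arg_cong[of _ _ cos])
  finally show ?thesis by (auto simp: abs_eq_iff)
qed

text \<open>On (-pi, pi) equal cosines mean equal or opposite angles, so every surviving sine is
  plus or minus sin x1; this is nonzero and cancels, leaving a signed balance of weights
  alone.\<close>

lemma four_nodes_balance_weights:
  fixes w1 w2 w3 w4 x1 x2 x3 x4 :: real
  assumes s: "\<forall>l\<in>{1,2,3,4::nat}. w1 * sin (real l * x1) + w2 * sin (real l * x2)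
      + w3 * sin (real l * x3) + w4 * sin (real l * x4) = 0"
    and x: "\<bar>x1\<bar> < pi" "\<bar>x2\<bar> < pi" "\<bar>x3\<bar> < pi" "\<bar>x4\<bar> < pi" and nz: "x1 \<noteq> 0"
  shows "w1 + (if x2 = x1 then w2 else if x2 = - x1 then - w2 else 0)
      + (if x3 = x1 then w3 else if x3 = - x1 then - w3 else 0)
      + (if x4 = x1 then w4 else if x4 = - x1 then - w4 else 0) = 0"
proof -
  have s1: "sin x1 \<noteq> 0"
  proof -
    have "sin \<bar>x1\<bar> > 0" using x nz by (intro sin_gt_zero) auto
    then show ?thesis by (auto simp: abs_if split: if_splits)
  qed
  have e: "(if cos y = cos x1 then w * sin y else 0) = sin x1 * (if y = x1 then w else if y = - x1 then - w else 0)"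
    if "\<bar>y\<bar> < pi" for y w :: real
    using cos_eq_iff_abs_eq[of y x1] that x(1) by auto
  from four_nodes_balance[OF s] have "sin x1 * (w1 + (if x2 = x1 then w2 else if x2 = - x1 then - w2 else 0)
      + (if x3 = x1 then w3 else if x3 = - x1 then - w3 else 0)
      + (if x4 = x1 then w4 else if x4 = - x1 then - w4 else 0)) = 0"
    unfolding e[OF x(2)] e[OF x(3)] e[OF x(4)] by (simp add: algebra_simps)
  with s1 show ?thesis by simp
qed

text \<open>Among the four angle differences the one of largest weight has to vanish, since the
  relation \<open>x1 + x4 = x2 + x3\<close> leaves no way to balance it; then the two mixed differences can only
  balance each other.\<close>

lemma mixture_identifiable:
  fixes p q a1 a2 b1 b2 :: real
  assumes p: "0 < p" "p < 1/2" and q: "0 < q" "q < 1/2"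
    and r: "0 \<le> a1" "a1 < pi" "0 \<le> a2" "a2 < pi" "0 \<le> b1" "b1 < pi" "0 \<le> b2" "b2 < pi"
    and d: "a1 \<noteq> a2" "b1 \<noteq> b2"
    and s: "\<forall>l\<in>{1,2,3,4::nat}. p * q * sin (real l * (a1 - b1)) + p * (1 - q) * sin (real l * (a1 - b2))
      + (1 - p) * q * sin (real l * (a2 - b1)) + (1 - p) * (1 - q) * sin (real l * (a2 - b2)) = 0"
  shows "p = q \<and> a1 = b1 \<and> a2 = b2"
proof -
  define x1 x2 x3 x4 where "x1 = a1 - b1" and "x2 = a1 - b2" and "x3 = a2 - b1" and "x4 = a2 - b2"
  define w1 w2 w3 w4 where "w1 = p * q" and "w2 = p * (1 - q)" and "w3 = (1 - p) * q" and "w4 = (1 - p) * (1 - q)"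
  note defs = x1_def x2_def x3_def x4_def
  have lin: "x1 + x4 = x2 + x3" by (simp add: defs)
  have ne: "x1 \<noteq> x2" "x1 \<noteq> x3" "x2 \<noteq> x4" "x3 \<noteq> x4" using d by (auto simp: defs)
  have b: "\<bar>x1\<bar> < pi" "\<bar>x2\<bar> < pi" "\<bar>x3\<bar> < pi" "\<bar>x4\<bar> < pi" using r by (auto simp: defs)
  have wpos: "0 < w1" "0 < w2" "0 < w3" "0 < w4"
    using p q by (simp_all add: w1_def w2_def w3_def w4_def)
  have w24: "w2 < w4" unfolding w2_def w4_def using p q by (intro mult_strict_right_mono) auto
  have w34: "w3 < w4" unfolding w3_def w4_def using p q by (intro mult_strict_left_mono) auto
  have w13: "w1 < w3" unfolding w1_def w3_def using p q by (intro mult_strict_right_mono) auto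
  have w12: "w1 < w2" unfolding w1_def w2_def using p q by (intro mult_strict_left_mono) auto
  have S: "\<forall>l\<in>{1,2,3,4::nat}. w1 * sin (real l * x1) + w2 * sin (real l * x2)
      + w3 * sin (real l * x3) + w4 * sin (real l * x4) = 0"
    using s by (simp add: defs w1_def w2_def w3_def w4_def)
  have S4: "\<forall>l\<in>{1,2,3,4::nat}. w4 * sin (real l * x4) + w2 * sin (real l * x2)
      + w3 * sin (real l * x3) + w1 * sin (real l * x1) = 0"
    using S by (simp add: algebra_simps)
  have S2: "\<forall>l\<in>{1,2,3,4::nat}. w2 * sin (real l * x2) + w1 * sin (real l * x1)
      + w3 * sin (real l * x3) + w4 * sin (real l * x4) = 0"
    using S by (simp add: algebra_simps)
  have S3: "\<forall>l\<in>{1,2,3,4::nat}. w3 * sin (real l * x3) + w1 * sin (real l * x1)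
      + w2 * sin (real l * x2) + w4 * sin (real l * x4) = 0"
    using S by (simp add: algebra_simps)
  note B1 = four_nodes_balance_weights[OF S b]
  note B2 = four_nodes_balance_weights[OF S2 b(2,1,3,4)]
  note B3 = four_nodes_balance_weights[OF S3 b(3,1,2,4)]
  note B4 = four_nodes_balance_weights[OF S4 b(4,2,3,1)]
  have x4: "x4 = 0"
  proof (rule ccontr)
    assume nz: "x4 \<noteq> 0"
    from B4[OF nz] ne(3,4) have e: "w4 + (if x2 = - x4 then - w2 else 0) + (if x3 = - x4 then - w3 else 0)
      + (if x1 = x4 then w1 else if x1 = - x4 then - w1 else 0) = 0" by (simp split: if_splits)
    \<comment> \<open>One of w2, w3 is smaller than w4, so x1 would have to help from -x4 as well;
      but then x1 would coincide with x2 or x3. w1 alone is too small too.\<close>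
    have x2: "x2 = - x4" and x3: "x3 = - x4"
      using e wpos w24 w34 w13 w12 ne by (auto split: if_splits)
    with lin have x1: "x1 = - 3 * x4" by simp
    then have "x1 \<noteq> 0" using nz by simp
    \<comment> \<open>With x1 = -3 x4 no other node lies at x1 or -x1, so the positive weight w1
      would have to balance by itself.\<close>
    from B1[OF this] x1 x2 x3 nz wpos show False by (auto split: if_splits)
  qed
  have a2: "a2 = b2" using x4 by (simp add: defs)
  have nz: "x2 \<noteq> 0" "x3 \<noteq> 0" using ne x4 by auto
  have l: "x1 = x2 + x3" using lin x4 by simp
  \<comment> \<open>Otherwise x2 can be balanced only from x1 = -x2, and x3 only from x1 = -x3 or in
    common with x2. Every case gives x2 = x3 and x1 = -x2, and x1 = x2 + x3 then forces 3 x2 =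
    0.\<close>
  have x32: "x3 = - x2"
  proof (rule ccontr)
    assume a: "x3 \<noteq> - x2"
    from B2[OF nz(1)] a ne x4 nz wpos have "x1 = - x2 \<or> x3 = x2"
      by (auto split: if_splits)
    moreover from B3[OF nz(2)] a ne x4 nz wpos have "x1 = - x3 \<or> x2 = x3"
      by (auto split: if_splits)
    moreover have "x1 = - x2" if "x3 = x2" using B2[OF nz(1)] that ne x4 nz wpos
      by (auto split: if_splits)
    ultimately show False using l nz by auto
  qed
  then have "x1 = 0" using l by simp
  \<comment> \<open>x3 = -x2 is the only partner of x2 because x1 and x4 are zero. Equality of the
    mixed weights reads p(1 - q) = (1 - p)q, that is, p = q.\<close>
  moreover have "w2 = w3" using B2[OF nz(1)] x32 x4 nz \<open>x1 = 0\<close> by (auto split: if_splits)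
  ultimately show ?thesis using a2 unfolding w2_def w3_def by (auto simp: defs algebra_simps)
qed

section \<open>Derivatives of the model\<close>

text \<open>The Frechet derivative of \<open>Mcoeff l\<close> at \<theta> in direction v, written
  out explicitly so that its dependence on the base point can be estimated.\<close>

definition DMcoeff :: "int \<Rightarrow> real ^ 3 \<Rightarrow> real ^ 3 \<Rightarrow> complex" where
  "DMcoeff l \<theta> v =
     of_real (v $ 1) * (exp (- \<i> * of_real (\<theta> $ 2) * of_int l) - exp (- \<i> * of_real (\<theta> $ 3) * of_int l))
     - \<i> * of_int l * (of_real (\<theta> $ 1) * exp (- \<i> * of_real (\<theta> $ 2) * of_int l) * of_real (v $ 2)
       + of_real (1 - \<theta> $ 1) * exp (- \<i> * of_real (\<theta> $ 3) * of_int l) * of_real (v $ 3))"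

lemmas has_derivative_vec_nth [derivative_intros] =
  bounded_linear.has_derivative[OF bounded_linear_vec_nth]

lemma has_derivative_exp_angle [derivative_intros]:
  "((\<lambda>\<theta>. exp (- \<i> * of_real (\<theta> $ i) * of_int l)) has_derivative
    (\<lambda>v. exp (- \<i> * of_real (\<theta> $ i) * of_int l) * (- \<i> * of_real (v $ i) * of_int l))) (at \<theta> within S)"
proof -
  have 1: "((\<lambda>\<theta>. - \<i> * of_real (\<theta> $ i) * of_int l) has_derivative (\<lambda>v. - \<i> * of_real (v $ i) * of_int l)) (at \<theta> within S)"
    by (rule derivative_eq_intros refl)+ simp
  have 2: "(exp has_derivative (*) (exp (- \<i> * of_real (\<theta> $ i) * of_int l))) (at (- \<i> * of_real (\<theta> $ i) * of_int l))"
    using DERIV_exp unfolding has_field_derivative_def .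
  from has_derivative_compose[OF 1 2] show ?thesis .
qed

lemma has_derivative_Mcoeff:
  "(Mcoeff l has_derivative DMcoeff l \<theta>) (at \<theta> within S)"
  unfolding Mcoeff_def[abs_def]
  by (rule derivative_eq_intros refl)+ (simp add: DMcoeff_def fun_eq_iff algebra_simps)

lemma DMcoeff_differentiable: "(\<lambda>\<theta>. DMcoeff l \<theta> v) differentiable (at \<theta>)"
  unfolding DMcoeff_def differentiable_def
  by (rule exI) (rule derivative_intros refl)+

section \<open>Size and Lipschitz bounds for the coefficients and their derivatives\<close>

lemma norm_exp_neg_angle [simp]: "norm (exp (- \<i> * of_real a * of_int l)) = 1"
  by (simp add: norm_exp_eq_Re)

lemma norm_exp_neg_angle_diff:
  "norm (exp (- \<i> * of_real a * of_int l) - exp (- \<i> * of_real b * of_int l)) \<le> \<bar>of_int l\<bar> * \<bar>a - b\<bar>"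
proof -
  have "exp (- \<i> * of_real a * of_int l) - exp (- \<i> * of_real b * of_int l)
    = iexp (- b * l) * (iexp ((b - a) * l) - 1)"
    by (simp add: algebra_simps exp_add[symmetric])
  moreover have "norm (iexp ((b - a) * l) - 1) \<le> \<bar>(b - a) * l\<bar>"
    using iexp_approx1[of "(b - a) * l" 0] by simp
  ultimately show ?thesis
    by (simp add: norm_mult abs_mult abs_minus_commute mult.commute)
qed

lemma norm_Mcoeff_le:
  assumes "0 \<le> \<theta> $ 1" "\<theta> $ 1 \<le> 1"
  shows "norm (Mcoeff l \<theta>) \<le> 1"
proof -
  have "norm (1 - complex_of_real (\<theta> $ 1)) = 1 - \<theta> $ 1"
    using assms norm_of_real[of "1 - \<theta> $ 1", where 'a=complex] by simp
  then have "norm (of_real (\<theta> $ 1) * exp (- \<i> * of_real (\<theta> $ 2) * of_int l)) = \<theta> $ 1"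
    "norm ((1 - complex_of_real (\<theta> $ 1)) * exp (- \<i> * of_real (\<theta> $ 3) * of_int l)) = 1 - \<theta> $ 1"
    using assms by (simp_all add: norm_mult)
  then show ?thesis unfolding Mcoeff_def
    using norm_triangle_ineq[of "of_real (\<theta> $ 1) * exp (- \<i> * of_real (\<theta> $ 2) * of_int l)"
      "(1 - complex_of_real (\<theta> $ 1)) * exp (- \<i> * of_real (\<theta> $ 3) * of_int l)"] by linarith
qed

text \<open>The common shape of \<open>DMcoeff\<close> and of a difference of two of its values, so
  that one estimate yields both the size and the Lipschitz bound. The 8 is the frequency bound 4
  times two angle terms.\<close>

lemma norm_DMcoeff_aux:
  fixes A B C :: complex
  assumes "norm A \<le> a" "norm B \<le> b" "norm C \<le> b" "\<bar>of_int l\<bar> \<le> (4::real)"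
  shows "norm (of_real (v $ 1) * A - \<i> * of_int l * (B * of_real (v $ 2) + C * of_real ((v::real^3) $ 3)))
     \<le> (a + 8 * b) * norm v"
proof -
  have "a \<ge> 0" "b \<ge> 0" using assms(1,2) norm_ge_zero order_trans by blast+
  have "norm (of_real (v $ 1) * A) \<le> norm v * a"
    unfolding norm_mult using assms(1) component_le_norm_cart[of v 1] by (intro mult_mono) auto
  moreover have "norm (B * of_real (v $ 2)) \<le> b * norm v" "norm (C * of_real (v $ 3)) \<le> b * norm v"
    unfolding norm_mult using assms(2,3) component_le_norm_cart[of v] \<open>b \<ge> 0\<close> by (auto intro!: mult_mono)
  then have "norm (B * of_real (v $ 2) + C * of_real (v $ 3)) \<le> 2 * b * norm v"
    using norm_triangle_ineq[of "B * of_real (v $ 2)" "C * of_real (v $ 3)"] by linarith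
  then have "norm (\<i> * of_int l * (B * of_real (v $ 2) + C * of_real (v $ 3))) \<le> 4 * (2 * b * norm v)"
    using assms(4) by (simp only: norm_mult[of "\<i> * of_int l"]) (intro mult_mono, auto simp: norm_mult)
  ultimately show ?thesis
    using norm_triangle_ineq4[of "of_real (v $ 1) * A" "\<i> * of_int l * (B * of_real (v $ 2) + C * of_real (v $ 3))"]
    by (simp add: algebra_simps)
qed

lemma abs_of_int_le_4: "l \<in> {-4..4} \<Longrightarrow> \<bar>of_int l\<bar> \<le> (4::real)"
  by (auto simp: abs_le_iff)

lemma norm_DMcoeff_le:
  assumes "0 \<le> \<theta> $ 1" "\<theta> $ 1 \<le> 1" "l \<in> {-4..4}"
  shows "norm (DMcoeff l \<theta> v) \<le> 10 * norm v"
proof -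
  have "norm (DMcoeff l \<theta> v) \<le> (2 + 8 * 1) * norm v"
    unfolding DMcoeff_def
  proof (rule norm_DMcoeff_aux)
    show "norm (exp (- \<i> * of_real (\<theta> $ 2) * of_int l) - exp (- \<i> * of_real (\<theta> $ 3) * of_int l)) \<le> 2"
      by (rule order_trans[OF norm_triangle_ineq4]) (simp only: norm_exp_neg_angle)
  qed (use assms abs_of_int_le_4 in \<open>auto simp: norm_mult simp del: of_real_diff\<close>)
  then show ?thesis by simp
qed

lemma norm_DMcoeff_diff_le:
  assumes "0 \<le> \<theta>0 $ 1" "\<theta>0 $ 1 \<le> 1" "l \<in> {-4..4}"
  shows "norm (DMcoeff l \<theta> v - DMcoeff l \<theta>0 v) \<le> 50 * norm (\<theta> - \<theta>0) * norm v"
proof -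
  let ?h = "norm (\<theta> - \<theta>0)"
  let ?e = "\<lambda>a. exp (- \<i> * of_real a * of_int l)"
  have c: "\<bar>\<theta> $ i - \<theta>0 $ i\<bar> \<le> ?h" for i
    using component_le_norm_cart[of "\<theta> - \<theta>0" i] by simp
  have e: "norm (?e (\<theta> $ i) - ?e (\<theta>0 $ i)) \<le> 4 * ?h" for i
    by (rule order_trans[OF norm_exp_neg_angle_diff]) (intro mult_mono c abs_of_int_le_4 assms; simp)
  have pe: "norm (of_real p * ?e (\<theta> $ i) - of_real q * ?e (\<theta>0 $ i)) \<le> 5 * ?h"
    if "\<bar>p - q\<bar> \<le> ?h" "0 \<le> q" "q \<le> 1" for p q i
  proof -
    \<comment> \<open>Splitting the difference this way leaves the weight q of the base point as the
      factor, and that weight lies in [0, 1].\<close>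
    have "of_real p * ?e (\<theta> $ i) - of_real q * ?e (\<theta>0 $ i)
      = of_real (p - q) * ?e (\<theta> $ i) + of_real q * (?e (\<theta> $ i) - ?e (\<theta>0 $ i))"
      by (simp add: algebra_simps)
    also have "norm \<dots> \<le> \<bar>p - q\<bar> + \<bar>q\<bar> * norm (?e (\<theta> $ i) - ?e (\<theta>0 $ i))"
      by (rule order_trans[OF norm_triangle_ineq]) (simp only: norm_mult norm_of_real norm_exp_neg_angle, simp)
    also have "\<dots> \<le> ?h + 1 * (4 * ?h)"
      using that e by (intro add_mono mult_mono) auto
    finally show ?thesis by simp
  qed
  have eq: "DMcoeff l \<theta> v - DMcoeff l \<theta>0 v =
     of_real (v $ 1) * ((?e (\<theta> $ 2) - ?e (\<theta>0 $ 2)) - (?e (\<theta> $ 3) - ?e (\<theta>0 $ 3)))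
     - \<i> * of_int l * ((of_real (\<theta> $ 1) * ?e (\<theta> $ 2) - of_real (\<theta>0 $ 1) * ?e (\<theta>0 $ 2)) * of_real (v $ 2)
       + (of_real (1 - \<theta> $ 1) * ?e (\<theta> $ 3) - of_real (1 - \<theta>0 $ 1) * ?e (\<theta>0 $ 3)) * of_real (v $ 3))"
    unfolding DMcoeff_def by (simp only: algebra_simps)
  have "norm (DMcoeff l \<theta> v - DMcoeff l \<theta>0 v) \<le> (8 * ?h + 8 * (5 * ?h)) * norm v"
    unfolding eq
  proof (rule norm_DMcoeff_aux)
    show "norm ((?e (\<theta> $ 2) - ?e (\<theta>0 $ 2)) - (?e (\<theta> $ 3) - ?e (\<theta>0 $ 3))) \<le> 8 * ?h"
      using e[of 2] e[of 3] norm_triangle_ineq4[of "?e (\<theta> $ 2) - ?e (\<theta>0 $ 2)" "?e (\<theta> $ 3) - ?e (\<theta>0 $ 3)"]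
      by linarith
    show "norm (of_real (\<theta> $ 1) * ?e (\<theta> $ 2) - of_real (\<theta>0 $ 1) * ?e (\<theta>0 $ 2)) \<le> 5 * ?h"
      using c[of 1] assms by (intro pe) auto
    show "norm (of_real (1 - \<theta> $ 1) * ?e (\<theta> $ 3) - of_real (1 - \<theta>0 $ 1) * ?e (\<theta>0 $ 3)) \<le> 5 * ?h"
      using c[of 1] assms by (intro pe) auto
  qed (use assms abs_of_int_le_4 in auto)
  also have "\<dots> = 48 * (?h * norm v)" by simp
  also have "\<dots> \<le> 50 * (?h * norm v)" by (intro mult_right_mono) auto
  finally show ?thesis by simp
qed

text \<open>The mean value inequality on the segment, applied to a derivative that is Lipschitz
  around its value at \<theta>0.\<close>

lemma norm_Mcoeff_linearization_le:
  assumes "0 \<le> \<theta>0 $ 1" "\<theta>0 $ 1 \<le> 1" "l \<in> {-4..4}"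
  shows "norm (Mcoeff l \<theta> - Mcoeff l \<theta>0 - DMcoeff l \<theta>0 (\<theta> - \<theta>0)) \<le> 50 * (norm (\<theta> - \<theta>0))\<^sup>2"
proof -
  have "norm (Mcoeff l \<theta> - Mcoeff l \<theta>0 - DMcoeff l \<theta>0 (\<theta> - \<theta>0)) \<le> norm (\<theta> - \<theta>0) * (50 * norm (\<theta> - \<theta>0))"
  proof (rule differentiable_bound_linearization[where S="closed_segment \<theta>0 \<theta>"])
    show "\<theta>0 + t *\<^sub>R (\<theta> - \<theta>0) \<in> closed_segment \<theta>0 \<theta>" if "t \<in> {0..1}" for t
      using that by (auto simp: in_segment algebra_simps)
    show "(Mcoeff l has_derivative DMcoeff l x) (at x within closed_segment \<theta>0 \<theta>)" for x
      by (rule has_derivative_Mcoeff)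
    show "onorm (DMcoeff l x - DMcoeff l \<theta>0) \<le> 50 * norm (\<theta> - \<theta>0)" if "x \<in> closed_segment \<theta>0 \<theta>" for x
    proof (rule onorm_le)
      fix v
      have "norm ((DMcoeff l x - DMcoeff l \<theta>0) v) \<le> 50 * norm (x - \<theta>0) * norm v"
        using norm_DMcoeff_diff_le[OF assms] by simp
      also have "\<dots> \<le> 50 * norm (\<theta> - \<theta>0) * norm v"
        using segment_bound1[OF that] by (intro mult_mono) (auto simp: norm_minus_commute)
      finally show "norm ((DMcoeff l x - DMcoeff l \<theta>0) v) \<le> 50 * norm (\<theta> - \<theta>0) * norm v" .
    qed
  qed simp
  then show ?thesis by (simp add: power2_eq_square)
qed

lemma norm_Mcoeff_diff_le:
  assumes "0 \<le> \<theta>0 $ 1" "\<theta>0 $ 1 \<le> 1" "l \<in> {-4..4}" "\<theta> $ 1 \<in> {0..1}"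
  shows "norm (Mcoeff l \<theta> - Mcoeff l \<theta>0) \<le> 10 * norm (\<theta> - \<theta>0)"
proof (rule differentiable_bound[where S="{\<theta>. \<theta> $ 1 \<in> {0..1}}"])
  show "convex {\<theta>::real^3. \<theta> $ 1 \<in> {0..1}}"
    using convex_linear_vimage[OF bounded_linear.linear[OF bounded_linear_vec_nth], of "{0..1::real}" "1::3"]
    by (simp add: vimage_def)
  show "onorm (DMcoeff l x) \<le> 10" if "x \<in> {\<theta>. \<theta> $ 1 \<in> {0..1}}" for x
    using norm_DMcoeff_le that assms(3) by (intro onorm_le) auto
qed (use assms has_derivative_Mcoeff in auto)

section \<open>Coordinate gradients and the Hessian of the contrast\<close>

lemma partial_deriv_eq:
  assumes "(\<phi> has_derivative D) (at x)"
  shows "partial_deriv i \<phi> x = D (axis i 1)"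
proof -
  interpret D: bounded_linear D using assms by (rule has_derivative_bounded_linear)
  have "((\<lambda>t. \<phi> (x + t *\<^sub>R axis i 1)) has_derivative (\<lambda>t. D (t *\<^sub>R axis i 1))) (at 0)"
  proof (rule has_derivative_compose[of "\<lambda>t. x + t *\<^sub>R axis i 1" _ 0 UNIV])
    show "((\<lambda>t. x + t *\<^sub>R axis i 1) has_derivative (\<lambda>t. t *\<^sub>R axis i 1)) (at 0)"
      by (auto intro!: derivative_eq_intros)
  qed (use assms in simp)
  then have "((\<lambda>t. \<phi> (x + t *\<^sub>R axis i 1)) has_real_derivative D (axis i 1)) (at 0)"
    by (simp add: has_field_derivative_def D.scaleR mult_commute_abs)
  then show ?thesis unfolding partial_deriv_def by (rule DERIV_imp_deriv)
qed

lemma inner_gradient: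
  assumes "(\<phi> has_derivative D) (at x)"
  shows "gradient \<phi> x \<bullet> v = D v"
proof -
  have "linear D" using assms by (rule has_derivative_linear)
  have "D v = D (\<Sum>i\<in>UNIV. v $ i *\<^sub>R axis i 1)"
    by (subst (1) basis_expansion[symmetric]) (simp add: scalar_mult_eq_scaleR)
  also have "\<dots> = (\<Sum>i\<in>UNIV. v $ i * D (axis i 1))"
    by (simp add: linear_sum[OF \<open>linear D\<close>] linear_scale[OF \<open>linear D\<close>])
  finally show ?thesis
    by (simp add: gradient_def partial_deriv_eq[OF assms] inner_vec_def mult.commute)
qed

lemma has_derivative_Jfun:
  "(Jfun g l has_derivative (\<lambda>v. Im (cnj (fourier_coeff g l) * DMcoeff l \<theta> v))) (at \<theta> within S)"
  unfolding Jfun_def[abs_def]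
  by (intro bounded_linear.has_derivative[OF bounded_linear_Im] has_derivative_mult_right has_derivative_Mcoeff)

text \<open>Differentiating J^2 twice gives twice the outer square of the gradient plus 2J times the
  Hessian of J, and the latter vanishes with J.\<close>

lemma hessian_contrast:
  assumes J0: "\<And>l. l \<in> {-4..4} \<Longrightarrow> Jfun g l \<theta>0 = 0"
  shows "hessian (contrast g) \<theta>0 = 2 *\<^sub>R (\<Sum>l\<in>{-4..4}. outer (gradient (Jfun g l) \<theta>0))"
proof -
  define J' where "J' l \<theta> v = Im (cnj (fourier_coeff g l) * DMcoeff l \<theta> v)" for l \<theta> v
  have dJ: "(Jfun g l has_derivative J' l \<theta>) (at \<theta>)" for l \<theta>
    unfolding J'_def by (rule has_derivative_Jfun)
  have "(contrast g has_derivative (\<lambda>v. 2 * (\<Sum>l\<in>{-4..4}. Jfun g l \<theta> * J' l \<theta> v))) (at \<theta>)" for \<theta>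
  proof -
    have "(contrast g has_derivative (\<lambda>v. \<Sum>l\<in>{-4..4}. Jfun g l \<theta> * J' l \<theta> v + J' l \<theta> v * Jfun g l \<theta>)) (at \<theta>)"
      unfolding contrast_eq_sum_Jfun[abs_def] power2_eq_square
      by (intro has_derivative_sum has_derivative_mult dJ)
    then show ?thesis by (simp add: sum_distrib_left mult_ac)
  qed
  then have p1: "partial_deriv j (contrast g) = (\<lambda>\<theta>. 2 * (\<Sum>l\<in>{-4..4}. Jfun g l \<theta> * J' l \<theta> (axis j 1)))" for j
    by (intro ext partial_deriv_eq)
  have dd: "\<exists>H. ((\<lambda>\<theta>. J' l \<theta> v) has_derivative H) (at \<theta>0)" for l v
  proof -
    obtain H where "((\<lambda>\<theta>. DMcoeff l \<theta> v) has_derivative H) (at \<theta>0)"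
      using DMcoeff_differentiable[of l v \<theta>0] unfolding differentiable_def by blast
    from bounded_linear.has_derivative[OF bounded_linear_Im has_derivative_mult_right[OF this]]
    show ?thesis unfolding J'_def by blast
  qed
  have p2: "partial_deriv i (partial_deriv j (contrast g)) \<theta>0
    = (\<Sum>l\<in>{-4..4}. 2 * J' l \<theta>0 (axis i 1) * J' l \<theta>0 (axis j 1))" for i j
  proof -
    \<comment> \<open>The second derivative of J^l is only known to exist; its value is immaterial
      because it gets multiplied by J^l(\<theta>0) = 0.\<close>
    define H where "H l = (SOME H. ((\<lambda>\<theta>. J' l \<theta> (axis j 1)) has_derivative H) (at \<theta>0))" for l
    have H: "((\<lambda>\<theta>. J' l \<theta> (axis j 1)) has_derivative H l) (at \<theta>0)" for l
      unfolding H_def by (rule someI_ex[OF dd])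
    have "((\<lambda>\<theta>. 2 * (\<Sum>l\<in>{-4..4}. Jfun g l \<theta> * J' l \<theta> (axis j 1))) has_derivative
      (\<lambda>v. 2 * (\<Sum>l\<in>{-4..4}. Jfun g l \<theta>0 * H l v + J' l \<theta>0 v * J' l \<theta>0 (axis j 1)))) (at \<theta>0)"
      by (intro has_derivative_mult_right has_derivative_sum has_derivative_mult dJ H)
    from partial_deriv_eq[OF this, of i] show ?thesis unfolding p1 by (simp add: J0 sum_distrib_left mult.assoc)
  qed
  have "gradient (Jfun g l) \<theta>0 $ i = J' l \<theta>0 (axis i 1)" for l i
    unfolding gradient_def by (simp add: partial_deriv_eq[OF dJ])
  then show ?thesis
    by (simp add: vec_eq_iff hessian_def p2 outer_nth sum_distrib_left mult_ac)
qed

section \<open>The empirical contrast\<close>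

text \<open>The exponent is positive, so this is an unbiased estimator of the conjugate of the l-th
  coefficient of g, the factor that multiplies \<open>Mcoeff\<close> in \<open>Jfun\<close>.\<close>

definition emp_coeff :: "nat \<Rightarrow> (nat \<Rightarrow> real) \<Rightarrow> int \<Rightarrow> complex" where
  "emp_coeff n x l = (\<Sum>k\<in>{1..n}. exp (\<i> * of_int l * of_real (x k)) / (2 * of_real pi)) / of_nat n"

lemma norm_exp_mode: "norm (exp (\<i> * of_int l * of_real x) / (2 * of_real pi)) \<le> 1"
  using pi_gt3 by (simp add: norm_divide norm_exp_eq_Re)

lemma abs_Zvar_le:
  assumes "0 \<le> \<theta> $ 1" "\<theta> $ 1 \<le> 1"
  shows "\<bar>Zvar l x \<theta>\<bar> \<le> 1"
proof -
  have "\<bar>Zvar l x \<theta>\<bar> \<le> norm (exp (\<i> * of_int l * of_real x) / (2 * of_real pi)) * norm (Mcoeff l \<theta>)"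
    unfolding Zvar_def norm_mult[symmetric] by (rule abs_Im_le_cmod)
  also have "\<dots> \<le> 1 * 1"
    by (intro mult_mono norm_exp_mode norm_Mcoeff_le assms) auto
  finally show ?thesis by simp
qed

lemma sum_Zvar:
  assumes "n > 0"
  shows "(\<Sum>k\<in>{1..n}. Zvar l (x k) \<theta>) = real n * Im (emp_coeff n x l * Mcoeff l \<theta>)"
proof -
  have "(\<Sum>k\<in>{1..n}. Zvar l (x k) \<theta>)
    = Im ((\<Sum>k\<in>{1..n}. exp (\<i> * of_int l * of_real (x k)) / (2 * of_real pi)) * Mcoeff l \<theta>)"
    unfolding Zvar_def by (simp only: Im_sum[symmetric] sum_distrib_right)
  also have "(\<Sum>k\<in>{1..n}. exp (\<i> * of_int l * of_real (x k)) / (2 * of_real pi)) = of_nat n * emp_coeff n x l"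
    using assms by (simp add: emp_coeff_def)
  also have "Im (of_nat n * emp_coeff n x l * Mcoeff l \<theta>) = real n * Im (emp_coeff n x l * Mcoeff l \<theta>)"
    by (simp add: mult.assoc)
  finally show ?thesis .
qed

lemma sum_offdiag:
  fixes z :: "'i \<Rightarrow> real"
  assumes "finite I"
  shows "(\<Sum>(k, j)\<in>{(k, j). k \<in> I \<and> j \<in> I \<and> k \<noteq> j}. z k * z j) = (\<Sum>k\<in>I. z k)\<^sup>2 - (\<Sum>k\<in>I. (z k)\<^sup>2)"
proof -
  have "(\<Sum>k\<in>I. z k)\<^sup>2 = (\<Sum>(k, j)\<in>I \<times> I. z k * z j)"
    by (simp add: power2_eq_square sum_product sum.cartesian_product)
  also have "I \<times> I = {(k, j). k \<in> I \<and> j \<in> I \<and> k \<noteq> j} \<union> (\<lambda>k. (k, k)) ` I" by auto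
  also have "(\<Sum>(k, j)\<in>\<dots>. z k * z j) = (\<Sum>(k, j)\<in>{(k, j). k \<in> I \<and> j \<in> I \<and> k \<noteq> j}. z k * z j)
     + (\<Sum>(k, j)\<in>(\<lambda>k. (k, k)) ` I. z k * z j)"
  proof (rule sum.union_disjoint)
    show "finite {(k, j). k \<in> I \<and> j \<in> I \<and> k \<noteq> j}"
      by (rule finite_subset[of _ "I \<times> I"]) (use assms in auto)
  qed (use assms in auto)
  also have "(\<Sum>(k, j)\<in>(\<lambda>k. (k, k)) ` I. z k * z j) = (\<Sum>k\<in>I. (z k)\<^sup>2)"
    by (subst sum.reindex) (auto simp: inj_on_def power2_eq_square)
  finally show ?thesis by simp
qed

text \<open>Normalised by n^2 rather than n(n - 1), to match the square of an empirical mean; this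
  is why S_n appears with the factor (n - 1)/n, which does not move its minimiser.\<close>

definition diag_term :: "nat \<Rightarrow> (nat \<Rightarrow> real) \<Rightarrow> real ^ 3 \<Rightarrow> real" where
  "diag_term n x \<theta> = (\<Sum>l\<in>{-4..4}. \<Sum>k\<in>{1..n}. (Zvar l (x k) \<theta>)\<^sup>2) / (real n)\<^sup>2"

text \<open>The U-statistic is a sum of squares of empirical Fourier coefficients, up to its diagonal,
  which is of order \<open>1/n\<close>.\<close>

lemma empirical_contrast_eq:
  assumes "n \<ge> 2"
  shows "(real n - 1) / real n * empirical_contrast n x \<theta>
    = (\<Sum>l\<in>{-4..4}. (Im (emp_coeff n x l * Mcoeff l \<theta>))\<^sup>2) - diag_term n x \<theta>"
proof -
  have n: "real n > 1" and n0: "n > 0" using assms by simp_all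
  have dg: "(real n)\<^sup>2 * diag_term n x \<theta> = (\<Sum>l\<in>{-4..4}. \<Sum>k\<in>{1..n}. (Zvar l (x k) \<theta>)\<^sup>2)"
    unfolding diag_term_def using n by (intro nonzero_mult_div_cancel_left[THEN trans[OF times_divide_eq_right]]) auto
  have "empirical_contrast n x \<theta> = 1 / (real n * (real n - 1)) *
     (\<Sum>l\<in>{-4..4}. (real n)\<^sup>2 * (Im (emp_coeff n x l * Mcoeff l \<theta>))\<^sup>2 - (\<Sum>k\<in>{1..n}. (Zvar l (x k) \<theta>)\<^sup>2))"
    unfolding empirical_contrast_def sum_offdiag[OF finite_atLeastAtMost]
    by (simp only: sum_Zvar[OF n0] power_mult_distrib)
  also have "\<dots> = 1 / (real n * (real n - 1)) *
     ((real n)\<^sup>2 * (\<Sum>l\<in>{-4..4}. (Im (emp_coeff n x l * Mcoeff l \<theta>))\<^sup>2) - (real n)\<^sup>2 * diag_term n x \<theta>)"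
    unfolding dg sum_subtractf sum_distrib_left ..
  also have "(real n - 1) / real n * \<dots> = (\<Sum>l\<in>{-4..4}. (Im (emp_coeff n x l * Mcoeff l \<theta>))\<^sup>2) - diag_term n x \<theta>"
    using n by (simp add: divide_simps power2_eq_square) (simp add: algebra_simps)
  finally show ?thesis .
qed

lemma diag_term_bounds:
  assumes "n > 0" "0 \<le> \<theta> $ 1" "\<theta> $ 1 \<le> 1"
  shows "0 \<le> diag_term n x \<theta>" "diag_term n x \<theta> \<le> 9 / real n"
proof -
  show "0 \<le> diag_term n x \<theta>" unfolding diag_term_def by (intro divide_nonneg_nonneg sum_nonneg) auto
  have z: "(Zvar l (x k) \<theta>)\<^sup>2 \<le> 1" for l k
    using abs_Zvar_le[OF assms(2,3)] by (simp add: abs_square_le_1)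
  have "(\<Sum>l\<in>{-4..4::int}. \<Sum>k\<in>{1..n}. (Zvar l (x k) \<theta>)\<^sup>2) \<le> (\<Sum>l\<in>{-4..4::int}. \<Sum>k\<in>{1..n}. 1)"
    by (intro sum_mono z)
  also have "\<dots> = 9 * real n" by simp
  finally have "diag_term n x \<theta> \<le> 9 * real n / (real n)\<^sup>2"
    unfolding diag_term_def by (rule divide_right_mono) simp
  then show "diag_term n x \<theta> \<le> 9 / real n" using assms(1) by (simp add: power2_eq_square)
qed

lemma has_derivative_Im_mult_Mcoeff:
  "((\<lambda>\<theta>. Im (c * Mcoeff l \<theta>)) has_derivative (\<lambda>v. Im (c * DMcoeff l \<theta> v))) (at \<theta> within S)"
  by (intro bounded_linear.has_derivative[OF bounded_linear_Im] has_derivative_mult_right has_derivative_Mcoeff)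

text \<open>The derivative of S_n vanishes at a minimum over an open set, so the score of the
  squared means equals that of the diagonal: nine frequencies times n observations, each at most 10
  \<open>norm v\<close>, divided by n^2.\<close>

lemma empirical_score_bound:
  assumes n: "n \<ge> 2" and S: "open S" "\<theta> \<in> S" and p: "0 \<le> \<theta> $ 1" "\<theta> $ 1 \<le> 1"
    and min: "\<And>\<theta>'. \<theta>' \<in> S \<Longrightarrow> empirical_contrast n x \<theta> \<le> empirical_contrast n x \<theta>'"
  shows "\<bar>\<Sum>l\<in>{-4..4}. Im (emp_coeff n x l * Mcoeff l \<theta>) * Im (emp_coeff n x l * DMcoeff l \<theta> v)\<bar> \<le> 90 / real n * norm v"
proof -
  define E where "E l k = exp (\<i> * of_int l * of_real (x k)) / (2 * of_real pi)" for l k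
  define F where "F \<theta> = (\<Sum>l\<in>{-4..4}. (Im (emp_coeff n x l * Mcoeff l \<theta>))\<^sup>2)
    - (\<Sum>l\<in>{-4..4}. \<Sum>k\<in>{1..n}. (Im (E l k * Mcoeff l \<theta>))\<^sup>2) / (real n)\<^sup>2" for \<theta>
  define s where "s v = (\<Sum>l\<in>{-4..4}. Im (emp_coeff n x l * Mcoeff l \<theta>) * Im (emp_coeff n x l * DMcoeff l \<theta> v))" for v
  define r where "r v = (\<Sum>l\<in>{-4..4}. \<Sum>k\<in>{1..n}. Im (E l k * Mcoeff l \<theta>) * Im (E l k * DMcoeff l \<theta> v))" for v
  have F: "F \<theta> = (real n - 1) / real n * empirical_contrast n x \<theta>" for \<theta>
    unfolding F_def E_def empirical_contrast_eq[OF n] diag_term_def Zvar_def by simp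
  have sq: "((\<lambda>\<theta>. (Im (c * Mcoeff l \<theta>))\<^sup>2) has_derivative
      (\<lambda>v. 2 * (Im (c * Mcoeff l \<theta>) * Im (c * DMcoeff l \<theta> v)))) (at \<theta>)" for c l
    using has_derivative_power[OF has_derivative_Im_mult_Mcoeff[of c l \<theta> UNIV], where n=2]
    by (simp add: mult_ac del: times_complex.sel)
  have "(F has_derivative (\<lambda>v. (\<Sum>l\<in>{-4..4}. 2 * (Im (emp_coeff n x l * Mcoeff l \<theta>) * Im (emp_coeff n x l * DMcoeff l \<theta> v)))
     - (\<Sum>l\<in>{-4..4}. \<Sum>k\<in>{1..n}. 2 * (Im (E l k * Mcoeff l \<theta>) * Im (E l k * DMcoeff l \<theta> v))) / (real n)\<^sup>2)) (at \<theta>)"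
    unfolding F_def[abs_def] divide_inverse
    by (intro has_derivative_diff has_derivative_sum has_derivative_mult_left sq)
  also have "(\<lambda>v. (\<Sum>l\<in>{-4..4}. 2 * (Im (emp_coeff n x l * Mcoeff l \<theta>) * Im (emp_coeff n x l * DMcoeff l \<theta> v)))
     - (\<Sum>l\<in>{-4..4}. \<Sum>k\<in>{1..n}. 2 * (Im (E l k * Mcoeff l \<theta>) * Im (E l k * DMcoeff l \<theta> v))) / (real n)\<^sup>2)
     = (\<lambda>v. 2 * s v - 2 * r v / (real n)\<^sup>2)"
    unfolding s_def r_def sum_distrib_left ..
  finally have "(\<lambda>v. 2 * s v - 2 * r v / (real n)\<^sup>2) = (\<lambda>v. 0)"
  proof (rule differential_zero_maxmin[OF S(2,1)], intro disjI2 ballI)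
    show "F \<theta> \<le> F y" if "y \<in> S" for y
      unfolding F using min[OF that] n by (intro mult_left_mono) auto
  qed
  from fun_cong[OF this, of v] have "s v = r v / (real n)\<^sup>2" by simp
  moreover have "\<bar>r v\<bar> \<le> 90 * real n * norm v"
  proof -
    have "\<bar>Im (E l k * Mcoeff l \<theta>) * Im (E l k * DMcoeff l \<theta> v)\<bar> \<le> 10 * norm v" if "l \<in> {-4..4}" for l k
    proof -
      have "\<bar>Im (E l k * Mcoeff l \<theta>)\<bar> \<le> 1"
        using abs_Zvar_le[OF p] unfolding E_def Zvar_def .
      moreover have "\<bar>Im (E l k * DMcoeff l \<theta> v)\<bar> \<le> norm (E l k) * norm (DMcoeff l \<theta> v)"
        unfolding norm_mult[symmetric] by (rule abs_Im_le_cmod)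
      moreover have "norm (E l k) * norm (DMcoeff l \<theta> v) \<le> 1 * (10 * norm v)"
        unfolding E_def by (intro mult_mono norm_exp_mode norm_DMcoeff_le p that) auto
      ultimately have "\<bar>Im (E l k * Mcoeff l \<theta>)\<bar> * \<bar>Im (E l k * DMcoeff l \<theta> v)\<bar> \<le> 1 * (10 * norm v)"
        by (intro mult_mono) auto
      then show ?thesis by (simp add: abs_mult)
    qed
    then have "\<bar>r v\<bar> \<le> (\<Sum>l\<in>{-4..4::int}. \<Sum>k\<in>{1..n}. 10 * norm v)"
      unfolding r_def by (intro order_trans[OF sum_abs] sum_mono) auto
    then show ?thesis by simp
  qed
  ultimately have "\<bar>s v\<bar> \<le> 90 * real n * norm v / (real n)\<^sup>2"
    by (simp add: abs_divide divide_right_mono)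
  also have "\<dots> = 90 / real n * norm v" using n by (simp add: power2_eq_square)
  finally show ?thesis unfolding s_def .
qed

section \<open>Linearisation of the score at the true parameter\<close>

text \<open>Write s = \<open>norm (\<theta> - \<theta>0)\<close> + D. The first factor is zero at
  (m, \<theta>0), so it is O(s) and its linearisation errs by O(s^2); the second is O(1) and may
  therefore be replaced by its value at (m, \<theta>0) with error O(s). The product errs by
  O(s^2).\<close>

lemma score_linearization:
  assumes p0: "0 \<le> \<theta>0 $ 1" "\<theta>0 $ 1 \<le> 1" and p: "0 \<le> \<theta> $ 1" "\<theta> $ 1 \<le> 1" and l: "l \<in> {-4..4}"
    and m: "norm m \<le> 1" and J0: "Im (m * Mcoeff l \<theta>0) = 0"
    and d: "norm (e - m) \<le> D" "D \<le> 1"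
  shows "\<bar>Im (e * Mcoeff l \<theta>) * Im (e * DMcoeff l \<theta> v)
     - (Im (m * DMcoeff l \<theta>0 (\<theta> - \<theta>0)) + Im (e * Mcoeff l \<theta>0)) * Im (m * DMcoeff l \<theta>0 v)\<bar>
     \<le> 1500 * (norm (\<theta> - \<theta>0) + D)\<^sup>2 * norm v"
proof -
  define h s where "h = norm (\<theta> - \<theta>0)" and "s = h + D"
  have h: "0 \<le> h" by (simp add: h_def)
  have D: "0 \<le> D" using d(1) norm_ge_zero order_trans by blast
  then have s: "0 \<le> s" "h \<le> s" "D \<le> s" using h by (auto simp: s_def)
  have e: "norm e \<le> 2" using norm_triangle_ineq[of "e - m" m] d m by simp
  have prod: "\<bar>Im (a * b)\<bar> \<le> A * B" if "norm a \<le> A" "norm b \<le> B" for a b A B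
  proof -
    have "\<bar>Im (a * b)\<bar> \<le> norm a * norm b" unfolding norm_mult[symmetric] by (rule abs_Im_le_cmod)
    also have "\<dots> \<le> A * B" using that order_trans[OF norm_ge_zero that(1)] by (intro mult_mono) auto
    finally show ?thesis .
  qed
  define X where "X = Im (e * Mcoeff l \<theta>)"
  define X0 where "X0 = Im (m * DMcoeff l \<theta>0 (\<theta> - \<theta>0)) + Im (e * Mcoeff l \<theta>0)"
  define Y where "Y = Im (e * DMcoeff l \<theta> v)"
  define Y0 where "Y0 = Im (m * DMcoeff l \<theta>0 v)"
  have p': "\<theta> $ 1 \<in> {0..1}" using p by simp
  \<comment> \<open>The deviation of e is kept exactly at \<theta>0; its interaction with the move
    from \<theta>0 to \<theta> is a product of two small quantities.\<close>
  have "X - X0 = Im ((e - m) * (Mcoeff l \<theta> - Mcoeff l \<theta>0))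
      + Im (m * (Mcoeff l \<theta> - Mcoeff l \<theta>0 - DMcoeff l \<theta>0 (\<theta> - \<theta>0)))"
    unfolding X_def X0_def by (simp add: algebra_simps)
  moreover have "\<bar>Im ((e - m) * (Mcoeff l \<theta> - Mcoeff l \<theta>0))\<bar> \<le> D * (10 * h)"
    unfolding h_def by (intro prod d norm_Mcoeff_diff_le p0 l p')
  moreover have "\<bar>Im (m * (Mcoeff l \<theta> - Mcoeff l \<theta>0 - DMcoeff l \<theta>0 (\<theta> - \<theta>0)))\<bar> \<le> 1 * (50 * h\<^sup>2)"
    unfolding h_def by (intro prod m norm_Mcoeff_linearization_le p0 l)
  moreover have "D * (10 * h) + 1 * (50 * h\<^sup>2) \<le> 50 * s\<^sup>2"
    using mult_nonneg_nonneg[OF D h] by (simp add: s_def power2_sum)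
  ultimately have XX: "\<bar>X - X0\<bar> \<le> 50 * s\<^sup>2" by linarith
  have "\<bar>Im (m * DMcoeff l \<theta>0 (\<theta> - \<theta>0))\<bar> \<le> 1 * (10 * h)"
    unfolding h_def by (intro prod m norm_DMcoeff_le p0 l)
  moreover have "Im (e * Mcoeff l \<theta>0) = Im ((e - m) * Mcoeff l \<theta>0)"
    using J0 by (simp add: algebra_simps)
  moreover have "\<bar>Im ((e - m) * Mcoeff l \<theta>0)\<bar> \<le> D * 1"
    by (intro prod d norm_Mcoeff_le p0)
  ultimately have X0: "\<bar>X0\<bar> \<le> 10 * s" using h D unfolding X0_def s_def by simp
  have Y: "\<bar>Y\<bar> \<le> 2 * (10 * norm v)"
    unfolding Y_def by (intro prod e norm_DMcoeff_le p l)
  have "Y - Y0 = Im ((e - m) * DMcoeff l \<theta> v) + Im (m * (DMcoeff l \<theta> v - DMcoeff l \<theta>0 v))"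
    unfolding Y_def Y0_def by (simp add: algebra_simps)
  moreover have "\<bar>Im ((e - m) * DMcoeff l \<theta> v)\<bar> \<le> D * (10 * norm v)"
    by (intro prod d norm_DMcoeff_le p l)
  moreover have "\<bar>Im (m * (DMcoeff l \<theta> v - DMcoeff l \<theta>0 v))\<bar> \<le> 1 * (50 * h * norm v)"
    unfolding h_def by (intro prod m norm_DMcoeff_diff_le p0 l)
  moreover have "D * (10 * norm v) + 1 * (50 * h * norm v) \<le> 50 * s * norm v"
    using mult_nonneg_nonneg[OF D norm_ge_zero[of v]] by (simp add: s_def algebra_simps)
  ultimately have YY: "\<bar>Y - Y0\<bar> \<le> 50 * s * norm v" by linarith
  \<comment> \<open>Here 1500 = 50 * 20 + 10 * 50.\<close>
  have "X * Y - X0 * Y0 = (X - X0) * Y + X0 * (Y - Y0)" by (simp add: algebra_simps)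
  also have "\<bar>\<dots>\<bar> \<le> \<bar>X - X0\<bar> * \<bar>Y\<bar> + \<bar>X0\<bar> * \<bar>Y - Y0\<bar>"
    unfolding abs_mult[symmetric] by (rule abs_triangle_ineq)
  also have "\<dots> \<le> (50 * s\<^sup>2) * (2 * (10 * norm v)) + (10 * s) * (50 * s * norm v)"
    using s by (intro add_mono mult_mono XX YY Y X0) auto
  also have "\<dots> = 1500 * s\<^sup>2 * norm v" by (simp add: power2_eq_square algebra_simps)
  finally show ?thesis unfolding X_def X0_def Y_def Y0_def s_def h_def .
qed

section \<open>Deterministic expansion of the minimiser\<close>

text \<open>Off the ball the population contrast has a positive minimum \<mu> on a compact set,
  while a minimiser of S_n has population contrast at most 54 D + 9/n, by comparison with
  \<theta>0.\<close>

lemma argmin_consistent: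
  fixes m :: "int \<Rightarrow> complex"
  assumes \<Theta>: "compact \<Theta>" "\<And>\<theta>. \<theta> \<in> \<Theta> \<Longrightarrow> 0 \<le> \<theta> $ 1 \<and> \<theta> $ 1 \<le> 1" and \<theta>0: "\<theta>0 \<in> \<Theta>"
    and m: "\<And>l. norm (m l) \<le> 1" and J0: "\<And>l. l \<in> {-4..4} \<Longrightarrow> Im (m l * Mcoeff l \<theta>0) = 0"
    and ident: "\<And>\<theta>. \<theta> \<in> \<Theta> \<Longrightarrow> (\<And>l. l \<in> {-4..4} \<Longrightarrow> Im (m l * Mcoeff l \<theta>) = 0) \<Longrightarrow> \<theta> = \<theta>0"
    and \<rho>: "0 < \<rho>"
  obtains \<mu> where "0 < \<mu>"
    "\<And>n x \<theta> D. n \<ge> 2 \<Longrightarrow> is_arg_min (empirical_contrast n x) (\<lambda>\<theta>. \<theta> \<in> \<Theta>) \<theta> \<Longrightarrow>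
       (\<And>l. l \<in> {-4..4} \<Longrightarrow> norm (emp_coeff n x l - m l) \<le> D) \<Longrightarrow> D \<le> 1 \<Longrightarrow> 54 * D + 9 / real n < \<mu> \<Longrightarrow>
       norm (\<theta> - \<theta>0) < \<rho>"
proof -
  define T where "T e \<theta> = (\<Sum>l\<in>{-4..4}. (Im (e l * Mcoeff l \<theta>))\<^sup>2)" for e :: "int \<Rightarrow> complex" and \<theta>
  have cont: "continuous_on S (T m)" for S
  proof -
    have "continuous_on S (Mcoeff l)" for l
      using has_derivative_Mcoeff by (intro has_derivative_continuous_on) blast
    then show ?thesis unfolding T_def by (intro continuous_intros)
  qed
  have T0: "T m \<theta>0 = 0" unfolding T_def by (intro sum.neutral) (auto simp: J0 simp del: times_complex.sel)
  define K where "K = \<Theta> - ball \<theta>0 \<rho>"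
  have K: "compact K" unfolding K_def by (intro compact_diff \<Theta> open_ball)
  have Tpos: "T m \<theta> > 0" if "\<theta> \<in> K" for \<theta>
  proof -
    have "\<theta> \<noteq> \<theta>0" "\<theta> \<in> \<Theta>" using that \<rho> by (auto simp: K_def)
    with ident obtain l where l: "l \<in> {-4..4}" "Im (m l * Mcoeff l \<theta>) \<noteq> 0" by blast
    then have "0 < (Im (m l * Mcoeff l \<theta>))\<^sup>2" by (simp only: zero_less_power2) simp
    also have "\<dots> \<le> T m \<theta>" unfolding T_def
      using l(1) by (intro member_le_sum[of l "{-4..4}" "\<lambda>l. (Im (m l * Mcoeff l \<theta>))\<^sup>2"]) auto
    finally show ?thesis .
  qed
  obtain \<mu> where \<mu>: "0 < \<mu>" "\<And>\<theta>. \<theta> \<in> K \<Longrightarrow> \<mu> \<le> T m \<theta>"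
  proof (cases "K = {}")
    case True
    then show ?thesis using that[of 1] by auto
  next
    case False
    obtain \<theta>1 where "\<theta>1 \<in> K" "\<forall>\<theta>\<in>K. T m \<theta>1 \<le> T m \<theta>"
      using continuous_attains_inf[OF K False cont] by blast
    with Tpos show ?thesis using that[of "T m \<theta>1"] by blast
  qed
  show thesis
  proof (rule that[OF \<mu>(1)])
    fix n :: nat and x \<theta> D
    assume n: "n \<ge> 2" and am: "is_arg_min (empirical_contrast n x) (\<lambda>\<theta>. \<theta> \<in> \<Theta>) \<theta>"
      and d: "\<And>l. l \<in> {-4..4} \<Longrightarrow> norm (emp_coeff n x l - m l) \<le> D" and D: "D \<le> 1"
      and small: "54 * D + 9 / real n < \<mu>"
    have \<theta>: "\<theta> \<in> \<Theta>" and le: "empirical_contrast n x \<theta> \<le> empirical_contrast n x \<theta>0"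
      using am \<theta>0 unfolding is_arg_min_def by (auto simp: not_less)
    define e where "e = emp_coeff n x"
    have close: "\<bar>T e \<theta> - T m \<theta>\<bar> \<le> 27 * D" if "\<theta> \<in> \<Theta>" for \<theta>
    proof -
      have "\<bar>(Im (e l * Mcoeff l \<theta>))\<^sup>2 - (Im (m l * Mcoeff l \<theta>))\<^sup>2\<bar> \<le> 3 * D" if l: "l \<in> {-4..4}" for l
      proof -
        have M: "norm (Mcoeff l \<theta>) \<le> 1" using \<Theta>(2)[OF \<open>\<theta> \<in> \<Theta>\<close>] by (intro norm_Mcoeff_le) auto
        have prod: "\<bar>Im (c * Mcoeff l \<theta>)\<bar> \<le> norm c" for c
        proof -
          have "\<bar>Im (c * Mcoeff l \<theta>)\<bar> \<le> norm c * norm (Mcoeff l \<theta>)"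
            unfolding norm_mult[symmetric] by (rule abs_Im_le_cmod)
          also have "\<dots> \<le> norm c * 1" by (intro mult_left_mono M) auto
          finally show ?thesis by simp
        qed
        have dl: "norm (e l - m l) \<le> D" using d[OF l] by (simp add: e_def)
        \<comment> \<open>A difference of squares expressed through the deviation and the population
          term alone; D \<le> 1 then bounds D + 2 by 3.\<close>
        have "(Im (e l * Mcoeff l \<theta>))\<^sup>2 - (Im (m l * Mcoeff l \<theta>))\<^sup>2
          = Im ((e l - m l) * Mcoeff l \<theta>) * (Im ((e l - m l) * Mcoeff l \<theta>) + 2 * Im (m l * Mcoeff l \<theta>))"
          by (simp add: algebra_simps power2_eq_square)
        also have "\<bar>\<dots>\<bar> \<le> D * (D + 2 * 1)"
          unfolding abs_mult
        proof (intro mult_mono)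
          show 1: "\<bar>Im ((e l - m l) * Mcoeff l \<theta>)\<bar> \<le> D" using prod dl order_trans by blast
          have "\<bar>Im (m l * Mcoeff l \<theta>)\<bar> \<le> 1" using prod m order_trans by blast
          with 1 show "\<bar>Im ((e l - m l) * Mcoeff l \<theta>) + 2 * Im (m l * Mcoeff l \<theta>)\<bar> \<le> D + 2 * 1" by linarith
          show "0 \<le> D" using dl norm_ge_zero order_trans by blast
        qed auto
        also have "\<dots> \<le> D * 3"
          using D order_trans[OF norm_ge_zero dl] by (intro mult_left_mono) auto
        finally show ?thesis by simp
      qed
      then have "\<bar>T e \<theta> - T m \<theta>\<bar> \<le> (\<Sum>l\<in>{-4..4::int}. 3 * D)"
        unfolding T_def sum_subtractf[symmetric] by (intro order_trans[OF sum_abs] sum_mono) auto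
      then show ?thesis by simp
    qed
    have pp: "0 \<le> \<theta> $ 1" "\<theta> $ 1 \<le> 1" "0 \<le> \<theta>0 $ 1" "\<theta>0 $ 1 \<le> 1" using \<Theta>(2) \<theta> \<theta>0 by auto
    have n0: "n > 0" using n by simp
    have "T e \<theta> - diag_term n x \<theta> \<le> T e \<theta>0 - diag_term n x \<theta>0"
      unfolding T_def e_def empirical_contrast_eq[OF n, symmetric]
      using n le by (intro mult_left_mono) auto
    moreover have "diag_term n x \<theta> \<le> 9 / real n" "0 \<le> diag_term n x \<theta>0"
      by (intro diag_term_bounds n0 pp)+
    \<comment> \<open>The error 27 D, which is nine frequencies times 3 D, is paid at \<theta> and
      at \<theta>0; the diagonal term at \<theta>0 enters with a favourable sign.\<close>
    ultimately have "T m \<theta> \<le> 54 * D + 9 / real n"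
      using close[OF \<theta>] close[OF \<theta>0] T0 by linarith
    with small have "T m \<theta> < \<mu>" by linarith
    with \<mu>(2) have "\<theta> \<notin> K" by force
    with \<theta> show "norm (\<theta> - \<theta>0) < \<rho>" by (simp add: K_def dist_norm norm_minus_commute)
  qed
qed

text \<open>Summing the linearised scores produces half of A(\<theta> - \<theta>0) plus the noise at
  \<theta>0, up to a small vector r; applying B, the inverse of A, solves for \<theta> - \<theta>0.
  The constant 13500 is nine times 1500.\<close>

lemma one_step_expansion:
  fixes m e :: "int \<Rightarrow> complex" and a :: "int \<Rightarrow> real ^ 3" and A B :: "real ^ 3 ^ 3"
  assumes p0: "0 \<le> \<theta>0 $ 1" "\<theta>0 $ 1 \<le> 1" and p: "0 \<le> \<theta> $ 1" "\<theta> $ 1 \<le> 1"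
    and m: "\<And>l. norm (m l) \<le> 1" and J0: "\<And>l. l \<in> {-4..4} \<Longrightarrow> Im (m l * Mcoeff l \<theta>0) = 0"
    and a: "\<And>l v. a l \<bullet> v = Im (m l * DMcoeff l \<theta>0 v)"
    and A: "A = 2 *\<^sub>R (\<Sum>l\<in>{-4..4}. outer (a l))" and B: "B ** A = mat 1"
    and \<beta>: "\<And>x. norm (B *v x) \<le> \<beta> * norm x" "0 \<le> \<beta>"
    and d: "\<And>l. l \<in> {-4..4} \<Longrightarrow> norm (e l - m l) \<le> D" "D \<le> 1"
    and \<kappa>: "\<And>v. \<bar>\<Sum>l\<in>{-4..4}. Im (e l * Mcoeff l \<theta>) * Im (e l * DMcoeff l \<theta> v)\<bar> \<le> \<kappa> * norm v"
  shows "norm (\<theta> - \<theta>0 + 2 *\<^sub>R (B *v (\<Sum>l\<in>{-4..4}. Im (e l * Mcoeff l \<theta>0) *\<^sub>R a l)))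
     \<le> 2 * \<beta> * (13500 * (norm (\<theta> - \<theta>0) + D)\<^sup>2 + \<kappa>)"
proof -
  define h where "h = \<theta> - \<theta>0"
  define s where "s = norm h + D"
  define \<zeta> where "\<zeta> l = Im (e l * Mcoeff l \<theta>0)" for l
  define r where "r = (\<Sum>l\<in>{-4..4}. (a l \<bullet> h + \<zeta> l) *\<^sub>R a l)"
  have rv: "r \<bullet> v = (\<Sum>l\<in>{-4..4}. (a l \<bullet> h + \<zeta> l) * (a l \<bullet> v))" for v
    by (simp add: r_def inner_sum_left)
  have "\<bar>r \<bullet> v\<bar> \<le> (13500 * s\<^sup>2 + \<kappa>) * norm v" for v
  proof -
    let ?XY = "\<lambda>l. Im (e l * Mcoeff l \<theta>) * Im (e l * DMcoeff l \<theta> v)"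
    have "\<bar>?XY l - (a l \<bullet> h + \<zeta> l) * (a l \<bullet> v)\<bar> \<le> 1500 * s\<^sup>2 * norm v" if "l \<in> {-4..4}" for l
      unfolding a \<zeta>_def s_def h_def by (intro score_linearization p0 p that m J0 d)
    then have "\<bar>(\<Sum>l\<in>{-4..4}. ?XY l) - r \<bullet> v\<bar> \<le> (\<Sum>l\<in>{-4..4::int}. 1500 * s\<^sup>2 * norm v)"
      unfolding rv sum_subtractf[symmetric] by (intro order_trans[OF sum_abs] sum_mono) auto
    also have "\<dots> = 13500 * s\<^sup>2 * norm v" by simp
    finally show ?thesis using \<kappa>[of v] by (simp add: algebra_simps)
  qed
  \<comment> \<open>Testing the linear form with r itself turns its bound into a bound on the norm
    of r.\<close>
  from this[of r] have "norm r * norm r \<le> (13500 * s\<^sup>2 + \<kappa>) * norm r"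
    by (simp add: dot_square_norm power2_eq_square)
  moreover have "0 \<le> 13500 * s\<^sup>2 + \<kappa>"
    using \<kappa>[of "axis 1 1"] by (intro add_nonneg_nonneg) (auto intro: order_trans[OF abs_ge_zero])
  ultimately have r: "norm r \<le> 13500 * s\<^sup>2 + \<kappa>"
    by (cases "norm r = 0") auto
  have "A *v h = 2 *\<^sub>R (\<Sum>l\<in>{-4..4}. (a l \<bullet> h) *\<^sub>R a l)"
    by (simp add: A scaleR_matrix_vector_assoc[symmetric] matrix_vector_mult_sum_left outer_mult_vec)
  then have "2 *\<^sub>R r = A *v h + 2 *\<^sub>R (\<Sum>l\<in>{-4..4}. \<zeta> l *\<^sub>R a l)"
    by (simp add: r_def scaleR_add_left sum.distrib scaleR_add_right)
  then have "B *v (2 *\<^sub>R r) = B *v (A *v h) + 2 *\<^sub>R (B *v (\<Sum>l\<in>{-4..4}. \<zeta> l *\<^sub>R a l))"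
    by (simp add: matrix_vector_right_distrib matrix_vector_mult_scaleR)
  also have "B *v (A *v h) = h" by (simp add: matrix_vector_mul_assoc B)
  finally have "norm (h + 2 *\<^sub>R (B *v (\<Sum>l\<in>{-4..4}. \<zeta> l *\<^sub>R a l))) = norm (B *v (2 *\<^sub>R r))" by simp
  also have "\<dots> \<le> \<beta> * (2 * norm r)" using \<beta>(1)[of "2 *\<^sub>R r"] by simp
  also have "\<dots> \<le> \<beta> * (2 * (13500 * s\<^sup>2 + \<kappa>))" using r \<beta>(2) by (intro mult_left_mono) auto
  finally show ?thesis unfolding h_def s_def \<zeta>_def by (simp add: algebra_simps)
qed

text \<open>Because the mean coefficients contribute nothing at \<theta>0, each e_l may be replaced
  by its deviation, so the whole term is of order D. The constant is 2 times nine frequencies times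
  the gradient bound 10.\<close>

lemma norm_linear_term_le:
  fixes m e :: "int \<Rightarrow> complex" and a :: "int \<Rightarrow> real ^ 3" and B :: "real ^ 3 ^ 3"
  assumes p0: "0 \<le> \<theta>0 $ 1" "\<theta>0 $ 1 \<le> 1"
    and m: "\<And>l. norm (m l) \<le> 1" and J0: "\<And>l. l \<in> {-4..4} \<Longrightarrow> Im (m l * Mcoeff l \<theta>0) = 0"
    and a: "\<And>l v. a l \<bullet> v = Im (m l * DMcoeff l \<theta>0 v)"
    and \<beta>: "\<And>x. norm (B *v x) \<le> \<beta> * norm x" "0 \<le> \<beta>"
    and d: "\<And>l. l \<in> {-4..4} \<Longrightarrow> norm (e l - m l) \<le> D"
  shows "norm (2 *\<^sub>R (B *v (\<Sum>l\<in>{-4..4}. Im (e l * Mcoeff l \<theta>0) *\<^sub>R a l))) \<le> 180 * \<beta> * D"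
proof -
  have al: "norm (a l) \<le> 10" if "l \<in> {-4..4}" for l
  proof -
    have "norm (a l) * norm (a l) = a l \<bullet> a l" by (simp add: dot_square_norm power2_eq_square)
    also have "\<dots> \<le> norm (m l * DMcoeff l \<theta>0 (a l))" unfolding a by (rule order_trans[OF abs_ge_self abs_Im_le_cmod])
    also have "\<dots> \<le> 1 * (10 * norm (a l))"
      unfolding norm_mult by (intro mult_mono m norm_DMcoeff_le p0 that) auto
    finally show ?thesis by (cases "norm (a l) = 0") auto
  qed
  have "norm (Im (e l * Mcoeff l \<theta>0) *\<^sub>R a l) \<le> D * 10" if l: "l \<in> {-4..4}" for l
  proof -
    have "Im (e l * Mcoeff l \<theta>0) = Im ((e l - m l) * Mcoeff l \<theta>0)"
      using J0[OF l] by (simp add: algebra_simps)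
    also have "\<bar>\<dots>\<bar> \<le> norm (e l - m l) * norm (Mcoeff l \<theta>0)"
      unfolding norm_mult[symmetric] by (rule abs_Im_le_cmod)
    also have "\<dots> \<le> D * 1" using d[OF l] order_trans[OF norm_ge_zero d[OF l]]
      by (intro mult_mono norm_Mcoeff_le p0) auto
    finally show ?thesis unfolding norm_scaleR using al[OF l] by (intro mult_mono) auto
  qed
  then have "norm (\<Sum>l\<in>{-4..4}. Im (e l * Mcoeff l \<theta>0) *\<^sub>R a l) \<le> (\<Sum>l\<in>{-4..4::int}. D * 10)"
    by (intro order_trans[OF norm_sum] sum_mono)
  then have "norm (\<Sum>l\<in>{-4..4}. Im (e l * Mcoeff l \<theta>0) *\<^sub>R a l) \<le> 90 * D" by simp
  then have "\<beta> * norm (\<Sum>l\<in>{-4..4}. Im (e l * Mcoeff l \<theta>0) *\<^sub>R a l) \<le> \<beta> * (90 * D)"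
    using \<beta>(2) by (rule mult_left_mono)
  from order_trans[OF \<beta>(1) this] show ?thesis by (simp add: mult_ac del: times_complex.sel)
qed

text \<open>The bound of \<open>one_step_expansion\<close> is quadratic in the unknown \<open>h\<close>; once \<open>h\<close> is small it can
  be absorbed, leaving an error of order \<open>D\<^sup>2 + \<kappa>\<close>.\<close>

lemma absorb_quadratic:
  fixes h y :: "'a::real_normed_vector" and \<beta> D \<kappa> :: real
  assumes 1: "norm (h + y) \<le> 2 * \<beta> * (13500 * (norm h + D)\<^sup>2 + \<kappa>)" and 2: "norm y \<le> 180 * \<beta> * D"
    and small: "norm h + D \<le> 1 / (54000 * \<beta>)" and \<beta>: "1 \<le> \<beta>" and D: "0 \<le> D" and \<kappa>: "0 \<le> \<kappa>" "\<kappa> \<le> 1"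
  shows "norm (h + y) \<le> 2 * \<beta> * (13500 * (2 * (400 * \<beta>)\<^sup>2) + 1) * (D\<^sup>2 + \<kappa>)"
proof -
  define s where "s = norm h + D"
  have s: "0 \<le> s" using D by (simp add: s_def)
  \<comment> \<open>The smallness threshold is chosen so that 27000 \<beta> s is at most 1/2; half
    of s can then be moved to the other side.\<close>
  have "27000 * \<beta> * s * s \<le> 27000 * \<beta> * (1 / (54000 * \<beta>)) * s"
    using small s \<beta> unfolding s_def[symmetric] by (intro mult_right_mono mult_left_mono) auto
  also have "\<dots> = s / 2" using \<beta> by simp
  finally have "27000 * \<beta> * s\<^sup>2 \<le> s / 2" by (simp add: power2_eq_square)
  moreover have "2 * \<beta> * (13500 * s\<^sup>2 + \<kappa>) = 27000 * \<beta> * s\<^sup>2 + 2 * \<beta> * \<kappa>"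
    by (simp add: algebra_simps)
  ultimately have "norm (h + y) \<le> s / 2 + 2 * \<beta> * \<kappa>" using 1 unfolding s_def by linarith
  moreover have "norm h \<le> norm (h + y) + norm y" using norm_triangle_ineq4[of "h + y" y] by simp
  ultimately have "s \<le> (360 * \<beta> + 2) * D + 4 * \<beta> * \<kappa>" using 2
    unfolding s_def mult.assoc distrib_right by argo
  \<comment> \<open>As \<beta> is at least 1, 360 \<beta> + 2 is at most 362 \<beta>; 400 is a round
    upper bound.\<close>
  also have "\<dots> \<le> (400 * \<beta>) * D + (400 * \<beta>) * \<kappa>"
    using \<beta> D \<kappa> by (intro add_mono mult_right_mono) auto
  finally have sle: "s \<le> 400 * \<beta> * (D + \<kappa>)" by (simp add: algebra_simps)
  have D\<kappa>: "(D + \<kappa>)\<^sup>2 \<le> 2 * (D\<^sup>2 + \<kappa>)"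
  proof -
    \<comment> \<open>This is where \<kappa> \<le> 1 enters: the error keeps \<kappa> to the first
      power, matching D^2, as both are of order 1/n.\<close>
    have "\<kappa>\<^sup>2 \<le> \<kappa>" using \<kappa> by (simp add: power2_eq_square mult_left_le)
    moreover have "0 \<le> (D - \<kappa>)\<^sup>2" by simp
    ultimately show ?thesis by (simp add: power2_sum power2_diff)
  qed
  have "s\<^sup>2 \<le> (400 * \<beta> * (D + \<kappa>))\<^sup>2" using s sle by (intro power_mono)
  also have "\<dots> = (400 * \<beta>)\<^sup>2 * (D + \<kappa>)\<^sup>2" by (simp add: power_mult_distrib)
  also have "\<dots> \<le> (400 * \<beta>)\<^sup>2 * (2 * (D\<^sup>2 + \<kappa>))"
    by (rule mult_left_mono[OF D\<kappa>]) simp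
  finally have "s\<^sup>2 \<le> 2 * (400 * \<beta>)\<^sup>2 * (D\<^sup>2 + \<kappa>)"
    by (simp add: algebra_simps)
  moreover have "\<kappa> \<le> 1 * (D\<^sup>2 + \<kappa>)" by simp
  ultimately have "13500 * s\<^sup>2 + \<kappa> \<le> 13500 * (2 * (400 * \<beta>)\<^sup>2 * (D\<^sup>2 + \<kappa>)) + 1 * (D\<^sup>2 + \<kappa>)"
    by linarith
  then have "2 * \<beta> * (13500 * s\<^sup>2 + \<kappa>) \<le> 2 * \<beta> * (13500 * (2 * (400 * \<beta>)\<^sup>2 * (D\<^sup>2 + \<kappa>)) + 1 * (D\<^sup>2 + \<kappa>))"
    using \<beta> by (intro mult_left_mono) auto
  with 1 show ?thesis unfolding s_def[symmetric] by (simp add: algebra_simps)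
qed

text \<open>Consistency first places the minimiser in a ball inside \<Theta>, where it is an
  unconstrained local minimum and the first-order condition holds; the expansion is then absorbed. D
  is a free bound on the deviations, so that a random one can be inserted later.\<close>

theorem argmin_expansion:
  fixes m :: "int \<Rightarrow> complex" and a :: "int \<Rightarrow> real ^ 3" and A B :: "real ^ 3 ^ 3"
  assumes \<Theta>: "compact \<Theta>" "\<And>\<theta>. \<theta> \<in> \<Theta> \<Longrightarrow> 0 \<le> \<theta> $ 1 \<and> \<theta> $ 1 \<le> 1" and \<theta>0: "\<theta>0 \<in> interior \<Theta>"
    and m: "\<And>l. norm (m l) \<le> 1" and J0: "\<And>l. l \<in> {-4..4} \<Longrightarrow> Im (m l * Mcoeff l \<theta>0) = 0"
    and ident: "\<And>\<theta>. \<theta> \<in> \<Theta> \<Longrightarrow> (\<And>l. l \<in> {-4..4} \<Longrightarrow> Im (m l * Mcoeff l \<theta>) = 0) \<Longrightarrow> \<theta> = \<theta>0"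
    and a: "\<And>l v. a l \<bullet> v = Im (m l * DMcoeff l \<theta>0 v)"
    and A: "A = 2 *\<^sub>R (\<Sum>l\<in>{-4..4}. outer (a l))" and B: "B ** A = mat 1"
  obtains C \<delta> n0 where "0 < C" "0 < \<delta>"
    "\<And>n x \<theta> D. n \<ge> n0 \<Longrightarrow> is_arg_min (empirical_contrast n x) (\<lambda>\<theta>. \<theta> \<in> \<Theta>) \<theta> \<Longrightarrow>
       (\<And>l. l \<in> {-4..4} \<Longrightarrow> norm (emp_coeff n x l - m l) \<le> D) \<Longrightarrow> D \<le> \<delta> \<Longrightarrow>
       norm (\<theta> - \<theta>0 + 2 *\<^sub>R (B *v (\<Sum>l\<in>{-4..4}. Im (emp_coeff n x l * Mcoeff l \<theta>0) *\<^sub>R a l)))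
         \<le> C * (D\<^sup>2 + 1 / real n)"
    "\<And>n x D. (\<And>l. l \<in> {-4..4} \<Longrightarrow> norm (emp_coeff n x l - m l) \<le> D) \<Longrightarrow>
       norm (2 *\<^sub>R (B *v (\<Sum>l\<in>{-4..4}. Im (emp_coeff n x l * Mcoeff l \<theta>0) *\<^sub>R a l))) \<le> C * D"
proof -
  have p0: "0 \<le> \<theta>0 $ 1" "\<theta>0 $ 1 \<le> 1" using \<Theta>(2) \<theta>0 interior_subset by blast+
  define \<beta> where "\<beta> = max 1 (onorm ((*v) B))"
  have \<beta>: "norm (B *v x) \<le> \<beta> * norm x" for x
  proof -
    have "norm (B *v x) \<le> onorm ((*v) B) * norm x" by (rule onorm[OF matrix_vector_mul_bounded_linear])
    also have "\<dots> \<le> \<beta> * norm x" unfolding \<beta>_def by (intro mult_right_mono) auto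
    finally show ?thesis .
  qed
  have \<beta>1: "1 \<le> \<beta>" by (simp add: \<beta>_def)
  obtain \<rho>1 where \<rho>1: "0 < \<rho>1" "ball \<theta>0 \<rho>1 \<subseteq> \<Theta>" using \<theta>0 mem_interior by blast
  \<comment> \<open>Half of the threshold 1/(54000 \<beta>) of \<open>absorb_quadratic\<close>;
    \<delta> takes the other half.\<close>
  define \<rho> where "\<rho> = min \<rho>1 (1 / (108000 * \<beta>))"
  have \<rho>: "0 < \<rho>" using \<rho>1 \<beta>1 by (simp add: \<rho>_def)
  have "\<theta>0 \<in> \<Theta>" using \<theta>0 interior_subset by blast
  obtain \<mu> where \<mu>: "0 < \<mu>"
    and cons: "\<And>n x \<theta> D. n \<ge> 2 \<Longrightarrow> is_arg_min (empirical_contrast n x) (\<lambda>\<theta>. \<theta> \<in> \<Theta>) \<theta> \<Longrightarrow>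
       (\<And>l. l \<in> {-4..4} \<Longrightarrow> norm (emp_coeff n x l - m l) \<le> D) \<Longrightarrow> D \<le> 1 \<Longrightarrow> 54 * D + 9 / real n < \<mu> \<Longrightarrow>
       norm (\<theta> - \<theta>0) < \<rho>"
    using argmin_consistent[OF \<Theta> \<open>\<theta>0 \<in> \<Theta>\<close> m J0 ident \<rho>] by blast
  \<comment> \<open>The bound \<mu>/200 keeps 54 D below \<mu>/2; the other half of \<mu> is left
    for 9/n, through \<open>n1\<close>.\<close>
  define \<delta> where "\<delta> = min (1 / (108000 * \<beta>)) (\<mu> / 200)"
  have \<delta>: "0 < \<delta>" "\<delta> \<le> 1 / (108000 * \<beta>)" "54 * \<delta> < \<mu> / 2" using \<mu> \<beta>1 by (auto simp: \<delta>_def min_def)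
  have "1 / (108000 * \<beta>) \<le> 1" using \<beta>1 by simp
  with \<delta> have \<delta>1: "\<delta> \<le> 1" by linarith
  obtain n1 where n1: "18 / \<mu> < real n1" using reals_Archimedean2 by blast
  \<comment> \<open>From n = 90 on the score error 90/n is at most 1, as the absorption
    requires.\<close>
  define n0 where "n0 = max 90 n1"
  define c where "c = 2 * \<beta> * (13500 * (2 * (400 * \<beta>)\<^sup>2) + 1)"
  \<comment> \<open>One constant for both conclusions: 90 c after replacing 90/n by 1/n, and 180
    \<beta> for the linear term.\<close>
  define C where "C = max (90 * c) (180 * \<beta>)"
  have c: "0 \<le> c" using \<beta>1 by (simp add: c_def)
  show thesis
  proof (rule that[of C \<delta> n0])
    show "0 < C" using \<beta>1 by (simp add: C_def)
    show "0 < \<delta>" by fact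
  next
    fix n x D
    assume d: "\<And>l. l \<in> {-4..4} \<Longrightarrow> norm (emp_coeff n x l - m l) \<le> D"
    have "norm (2 *\<^sub>R (B *v (\<Sum>l\<in>{-4..4}. Im (emp_coeff n x l * Mcoeff l \<theta>0) *\<^sub>R a l))) \<le> 180 * \<beta> * D"
      by (rule norm_linear_term_le[OF p0 m J0 a \<beta>]) (use \<beta>1 d in auto)
    also have "\<dots> \<le> C * D"
      using order_trans[OF norm_ge_zero d[of 0]] by (intro mult_right_mono) (auto simp: C_def)
    finally show "norm (2 *\<^sub>R (B *v (\<Sum>l\<in>{-4..4}. Im (emp_coeff n x l * Mcoeff l \<theta>0) *\<^sub>R a l))) \<le> C * D" .
  next
    fix n x \<theta> D
    assume n: "n0 \<le> n" and am: "is_arg_min (empirical_contrast n x) (\<lambda>\<theta>. \<theta> \<in> \<Theta>) \<theta>"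
      and d: "\<And>l. l \<in> {-4..4} \<Longrightarrow> norm (emp_coeff n x l - m l) \<le> D" and D: "D \<le> \<delta>"
    have D0: "0 \<le> D" using order_trans[OF norm_ge_zero d[of 0]] by simp
    have n2: "n \<ge> 2" "90 \<le> real n" "real n1 \<le> real n" using n by (auto simp: n0_def)
    have "18 / \<mu> < real n" using n1 n2 by linarith
    then have "9 / real n < \<mu> / 2" using \<mu> n2 by (simp add: field_simps)
    then have "norm (\<theta> - \<theta>0) < \<rho>"
      using D \<delta> \<delta>1 by (intro cons[OF n2(1) am d]) auto
    then have b: "\<theta> \<in> ball \<theta>0 \<rho>1" and h: "norm (\<theta> - \<theta>0) \<le> 1 / (108000 * \<beta>)"
      by (auto simp: \<rho>_def dist_norm norm_minus_commute)
    have \<theta>: "\<theta> \<in> \<Theta>" using b \<rho>1 by blast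
    then have p: "0 \<le> \<theta> $ 1" "\<theta> $ 1 \<le> 1" using \<Theta>(2) by auto
    have \<kappa>: "\<bar>\<Sum>l\<in>{-4..4}. Im (emp_coeff n x l * Mcoeff l \<theta>) * Im (emp_coeff n x l * DMcoeff l \<theta> v)\<bar> \<le> 90 / real n * norm v" for v
    proof (rule empirical_score_bound[OF n2(1) open_ball b p])
      show "empirical_contrast n x \<theta> \<le> empirical_contrast n x \<theta>'" if "\<theta>' \<in> ball \<theta>0 \<rho>1" for \<theta>'
      proof -
        have "\<theta>' \<in> \<Theta>" using that \<rho>1(2) by blast
        then show ?thesis using am unfolding is_arg_min_def by (auto simp: not_less)
      qed
    qed
    let ?y = "2 *\<^sub>R (B *v (\<Sum>l\<in>{-4..4}. Im (emp_coeff n x l * Mcoeff l \<theta>0) *\<^sub>R a l))"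
    have "norm (\<theta> - \<theta>0 + ?y) \<le> c * (D\<^sup>2 + 90 / real n)"
      unfolding c_def
    proof (rule absorb_quadratic)
      show "norm (\<theta> - \<theta>0 + ?y) \<le> 2 * \<beta> * (13500 * (norm (\<theta> - \<theta>0) + D)\<^sup>2 + 90 / real n)"
        by (rule one_step_expansion[OF p0 p m J0 a A B \<beta> _ d _ \<kappa>]) (use \<beta>1 D \<delta>1 in auto)
      show "norm ?y \<le> 180 * \<beta> * D"
        by (rule norm_linear_term_le[OF p0 m J0 a \<beta>]) (use \<beta>1 d in auto)
      have "1 / (108000 * \<beta>) + 1 / (108000 * \<beta>) = 1 / (54000 * \<beta>)" using \<beta>1 by (simp add: field_simps)
      with h D \<delta>(2) show "norm (\<theta> - \<theta>0) + D \<le> 1 / (54000 * \<beta>)" by linarith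
    qed (use \<beta>1 D0 n2 in auto)
    also have "\<dots> \<le> c * (90 * (D\<^sup>2 + 1 / real n))"
      using c by (intro mult_left_mono) auto
    also have "\<dots> = (90 * c) * (D\<^sup>2 + 1 / real n)" by simp
    also have "\<dots> \<le> C * (D\<^sup>2 + 1 / real n)"
      by (intro mult_right_mono) (auto simp: C_def)
    finally show "norm (\<theta> - \<theta>0 + ?y) \<le> C * (D\<^sup>2 + 1 / real n)" .
  qed
qed

section \<open>Fourier coefficients of the mixture\<close>

lemma circle_sets: "{0..<2*pi} \<inter> space lborel \<in> sets lborel" by simp

lemma borel_measurable_circle: "f \<in> borel_measurable borel \<Longrightarrow> f \<in> borel_measurable circle"
  unfolding circle_def by (intro measurable_restrict_space1) simp

text \<open>The fundamental domain is cut at 2 pi - \<alpha>. Translation carries the left piece to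
  [\<alpha>, 2 pi), while the right piece wraps around to [0, \<alpha>), where periodicity
  identifies the values.\<close>

lemma has_bochner_integral_circle_shift:
  fixes F :: "real \<Rightarrow> 'b::{banach, second_countable_topology}"
  assumes per: "\<And>x. F (x + 2 * pi) = F x" and F: "has_bochner_integral circle F I"
    and \<alpha>: "0 \<le> \<alpha>" "\<alpha> \<le> 2 * pi"
  shows "has_bochner_integral circle (\<lambda>x. F (x - \<alpha>)) I"
proof -
  define P1 P2 where "P1 = {0..<2*pi - \<alpha>}" and "P2 = {2*pi - \<alpha>..<2*pi}"
  have F': "has_bochner_integral lborel (\<lambda>x. indicator {0..<2*pi} x *\<^sub>R F x) I"
    using F unfolding circle_def has_bochner_integral_restrict_space[OF circle_sets] .
  have int: "integrable lborel (\<lambda>x. indicator P x *\<^sub>R F x)" if "P \<in> {P1, P2}" for P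
  proof -
    have "integrable lborel (\<lambda>x. indicator P x *\<^sub>R (indicator {0..<2*pi} x *\<^sub>R F x))"
    proof (rule integrable_mult_indicator)
      show "P \<in> sets lborel" using that by (auto simp: P1_def P2_def)
      show "integrable lborel (\<lambda>x. indicator {0..<2*pi} x *\<^sub>R F x)"
        using F' unfolding has_bochner_integral_iff by blast
    qed
    also have "(\<lambda>x. indicator P x *\<^sub>R (indicator {0..<2*pi} x *\<^sub>R F x)) = (\<lambda>x. indicator P x *\<^sub>R F x)"
      using that \<alpha> by (auto simp: fun_eq_iff P1_def P2_def indicator_def)
    finally show ?thesis .
  qed
  define i1 i2 where "i1 = (LINT x|lborel. indicator P1 x *\<^sub>R F x)" and "i2 = (LINT x|lborel. indicator P2 x *\<^sub>R F x)"
  have h1: "has_bochner_integral lborel (\<lambda>x. indicator P1 x *\<^sub>R F x) i1"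
    and h2: "has_bochner_integral lborel (\<lambda>x. indicator P2 x *\<^sub>R F x) i2"
    unfolding i1_def i2_def by (intro has_bochner_integral_integrable int; simp)+
  have "has_bochner_integral lborel (\<lambda>x. indicator P1 x *\<^sub>R F x + indicator P2 x *\<^sub>R F x) (i1 + i2)"
    by (rule has_bochner_integral_add[OF h1 h2])
  also have "(\<lambda>x. indicator P1 x *\<^sub>R F x + indicator P2 x *\<^sub>R F x) = (\<lambda>x. indicator {0..<2*pi} x *\<^sub>R F x)"
    using \<alpha> by (auto simp: fun_eq_iff P1_def P2_def indicator_def)
  finally have I: "I = i1 + i2" using F' by (auto simp: has_bochner_integral_iff)
  have s1: "has_bochner_integral lborel (\<lambda>x. indicator P1 (- \<alpha> + 1 * x) *\<^sub>R F (- \<alpha> + 1 * x)) (i1 /\<^sub>R \<bar>1\<bar>)"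
    by (rule iffD1[OF lborel_has_bochner_integral_real_affine_iff[OF one_neq_zero] h1])
  have s2: "has_bochner_integral lborel (\<lambda>x. indicator P2 (2*pi - \<alpha> + 1 * x) *\<^sub>R F (2*pi - \<alpha> + 1 * x)) (i2 /\<^sub>R \<bar>1\<bar>)"
    by (rule iffD1[OF lborel_has_bochner_integral_real_affine_iff[OF one_neq_zero] h2])
  have per': "F (2*pi - \<alpha> + x) = F (x - \<alpha>)" for x
    using per[of "x - \<alpha>"] by (simp add: algebra_simps)
  have "(\<lambda>x. indicator P1 (- \<alpha> + 1 * x) *\<^sub>R F (- \<alpha> + 1 * x) + indicator P2 (2*pi - \<alpha> + 1 * x) *\<^sub>R F (2*pi - \<alpha> + 1 * x))
     = (\<lambda>x. indicator {0..<2*pi} x *\<^sub>R F (x - \<alpha>))"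
    using \<alpha> by (auto simp: fun_eq_iff P1_def P2_def indicator_def per')
  with has_bochner_integral_add[OF s1 s2] show ?thesis
    unfolding circle_def has_bochner_integral_restrict_space[OF circle_sets] by (simp add: I)
qed

lemma exp_mode_periodic: "exp (- \<i> * of_int l * of_real (x + 2 * pi)) = exp (- \<i> * of_int l * of_real x)"
proof -
  have "- \<i> * of_int l * of_real (x + 2 * pi) = - \<i> * of_int l * of_real x + \<i> * (of_int (- l) * (of_real pi * 2))"
    by (simp add: algebra_simps)
  then show ?thesis by (simp only: exp_plus_2pin)
qed

lemma integrable_circle_density_mode:
  assumes "circle_density f"
  shows "integrable circle (\<lambda>x. complex_of_real (f x) * exp (- \<i> * of_int l * of_real x))"
proof (rule Bochner_Integration.integrable_bound)
  show "integrable circle f" using assms by (auto simp: circle_density_def has_bochner_integral_iff)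
  have "f \<in> borel_measurable borel" using assms by (simp add: circle_density_def)
  then show "(\<lambda>x. complex_of_real (f x) * exp (- \<i> * of_int l * of_real x)) \<in> borel_measurable circle"
    by (intro borel_measurable_circle borel_measurable_times borel_measurable_of_real)
      (auto intro!: borel_measurable_continuous_onI continuous_intros)
qed (auto simp: norm_mult norm_exp_eq_Re)

lemma circle_density_shift:
  assumes f: "circle_density f" and \<alpha>: "0 \<le> \<alpha>" "\<alpha> \<le> 2 * pi"
  shows "circle_density (\<lambda>x. f (x - \<alpha>))"
proof -
  have per: "f (x + 2 * pi) = f x" for x using f by (simp add: circle_density_def)
  have [measurable]: "f \<in> borel_measurable borel" using f by (simp add: circle_density_def)
  have "has_bochner_integral circle (\<lambda>x. f (x - \<alpha>)) 1"
    using f by (intro has_bochner_integral_circle_shift per \<alpha>) (simp add: circle_density_def)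
  then show ?thesis
    using f per[of "x - \<alpha>" for x] unfolding circle_density_def by (auto simp: algebra_simps)
qed

lemma fourier_coeff_shift:
  assumes f: "circle_density f" and \<alpha>: "0 \<le> \<alpha>" "\<alpha> \<le> 2 * pi"
  shows "fourier_coeff (\<lambda>x. f (x - \<alpha>)) l = exp (- \<i> * of_real \<alpha> * of_int l) * fourier_coeff f l"
proof -
  define G where "G x = complex_of_real (f x) * exp (- \<i> * of_int l * of_real x)" for x
  have per: "G (x + 2 * pi) = G x" for x
    using f unfolding G_def exp_mode_periodic by (simp add: circle_density_def)
  have "has_bochner_integral circle (\<lambda>x. G (x - \<alpha>)) (LINT x|circle. G x)"
    by (intro has_bochner_integral_circle_shift per \<alpha> has_bochner_integral_integrable)
      (use integrable_circle_density_mode[OF f] in \<open>simp add: G_def\<close>)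
  then have I: "(LINT x|circle. G (x - \<alpha>)) = (LINT x|circle. G x)" by (simp add: has_bochner_integral_iff)
  have e: "complex_of_real (f (x - \<alpha>)) * exp (- \<i> * of_int l * of_real x)
      = exp (- \<i> * of_real \<alpha> * of_int l) * G (x - \<alpha>)" for x
    by (simp add: G_def exp_add[symmetric] algebra_simps)
  show ?thesis unfolding fourier_coeff_def e integral_mult_right_zero I by (simp add: G_def[abs_def])
qed

lemma param_setD:
  assumes "\<theta> \<in> param_set"
  shows "0 < \<theta> $ 1" "\<theta> $ 1 < 1/2" "0 \<le> \<theta> $ 2" "\<theta> $ 2 < pi" "0 \<le> \<theta> $ 3" "\<theta> $ 3 < pi" "\<theta> $ 2 \<noteq> \<theta> $ 3"
  using assms by (auto simp: param_set_def)

lemma mixture_eq: "mixture f \<theta> = (\<lambda>x. \<theta> $ 1 * f (x - \<theta> $ 2) + (1 - \<theta> $ 1) * f (x - \<theta> $ 3))"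
  by (simp add: fun_eq_iff mixture_def)

lemma circle_density_mixture:
  assumes f: "circle_density f" and \<theta>: "\<theta> \<in> param_set"
  shows "circle_density (mixture f \<theta>)"
proof -
  note p = param_setD[OF \<theta>]
  have 2: "circle_density (\<lambda>x. f (x - \<theta> $ 2))" and 3: "circle_density (\<lambda>x. f (x - \<theta> $ 3))"
    using p pi_gt3 by (auto intro!: circle_density_shift f)
  have "has_bochner_integral circle (mixture f \<theta>) (\<theta> $ 1 * 1 + (1 - \<theta> $ 1) * 1)"
    using 2 3 unfolding mixture_eq circle_density_def
    by (intro has_bochner_integral_add has_bochner_integral_mult_right) auto
  then show ?thesis using 2 3 p unfolding circle_density_def mixture_eq by auto
qed

lemma fourier_coeff_mixture:
  assumes f: "circle_density f" and \<theta>: "\<theta> \<in> param_set"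
  shows "fourier_coeff (mixture f \<theta>) l = fourier_coeff f l * Mcoeff l \<theta>"
proof -
  note p = param_setD[OF \<theta>]
  have 2: "circle_density (\<lambda>x. f (x - \<theta> $ 2))" and 3: "circle_density (\<lambda>x. f (x - \<theta> $ 3))"
    using p pi_gt3 by (auto intro!: circle_density_shift f)
  have "fourier_coeff (mixture f \<theta>) l = of_real (\<theta> $ 1) * fourier_coeff (\<lambda>x. f (x - \<theta> $ 2)) l
     + (1 - of_real (\<theta> $ 1)) * fourier_coeff (\<lambda>x. f (x - \<theta> $ 3)) l"
    using integrable_circle_density_mode[OF 2, of l] integrable_circle_density_mode[OF 3, of l]
    unfolding fourier_coeff_def mixture_eq by (simp add: distrib_right mult.assoc add_divide_distrib)
  also have "\<dots> = fourier_coeff f l * Mcoeff l \<theta>"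
    using p pi_gt3 by (simp add: fourier_coeff_shift[OF f] Mcoeff_def algebra_simps)
  finally show ?thesis .
qed

lemma fourier_coeff_uminus: "fourier_coeff f (- l) = cnj (fourier_coeff f l)"
proof -
  have "cnj (LINT x|circle. complex_of_real (f x) * exp (- \<i> * of_int l * of_real x))
    = (LINT x|circle. cnj (complex_of_real (f x) * exp (- \<i> * of_int l * of_real x)))"
    by (rule Bochner_Integration.integral_cnj[symmetric])
  then show ?thesis by (simp add: fourier_coeff_def exp_cnj)
qed

text \<open>Negative frequencies follow from conjugate symmetry, and frequency 0 is its own
  reflection.\<close>

lemma fourier_coeff_real:
  assumes "\<forall>l\<in>{1, 2, 3, 4}. fourier_coeff f l \<in> \<real> - {0}" and l: "l \<in> {-4..4}"
  shows "cnj (fourier_coeff f l) = fourier_coeff f l"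
proof -
  have pos: "cnj (fourier_coeff f k) = fourier_coeff f k" if "k \<in> {1..4}" for k
  proof -
    have "k \<in> {1,2,3,4}" using that by auto
    then show ?thesis using assms(1) by (auto simp: Reals_cnj_iff)
  qed
  consider "l = 0" | "l \<in> {1..4}" | "- l \<in> {1..4}" using l by force
  then show ?thesis
  proof cases
    case 1
    then show ?thesis using fourier_coeff_uminus[of f 0] by simp
  next
    case 3
    from pos[OF 3] show ?thesis by (simp add: fourier_coeff_uminus)
  qed (rule pos)
qed

text \<open>The coefficient of g is a real number times M^l(\<theta>), so its conjugate times
  M^l(\<theta>) is a real multiple of a squared modulus.\<close>

lemma Jfun_true_parameter:
  assumes f: "circle_density f" "\<forall>l\<in>{1, 2, 3, 4}. fourier_coeff f l \<in> \<real> - {0}"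
    and \<theta>: "\<theta> \<in> param_set" and l: "l \<in> {-4..4}"
  shows "Jfun (mixture f \<theta>) l \<theta> = 0"
proof -
  have r: "cnj (fourier_coeff f l) = fourier_coeff f l" by (rule fourier_coeff_real[OF f(2) l])
  then have "fourier_coeff f l \<in> \<real>" by (simp add: Reals_cnj_iff)
  then obtain c where c: "fourier_coeff f l = of_real c" by (auto elim: Reals_cases)
  have "cnj (Mcoeff l \<theta>) * Mcoeff l \<theta> = of_real ((norm (Mcoeff l \<theta>))\<^sup>2)"
    unfolding complex_norm_square by (rule mult.commute)
  then have "cnj (fourier_coeff (mixture f \<theta>) l) * Mcoeff l \<theta> = of_real (c * (norm (Mcoeff l \<theta>))\<^sup>2)"
    by (simp add: fourier_coeff_mixture[OF f(1) \<theta>] c mult.assoc)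
  then show ?thesis unfolding Jfun_def by (simp only: Im_complex_of_real)
qed

lemma Im_cnj_Mcoeff_mult:
  "Im (cnj (Mcoeff l \<theta>) * Mcoeff l \<theta>') =
     \<theta> $ 1 * \<theta>' $ 1 * sin (of_int l * (\<theta> $ 2 - \<theta>' $ 2)) + \<theta> $ 1 * (1 - \<theta>' $ 1) * sin (of_int l * (\<theta> $ 2 - \<theta>' $ 3))
     + (1 - \<theta> $ 1) * \<theta>' $ 1 * sin (of_int l * (\<theta> $ 3 - \<theta>' $ 2)) + (1 - \<theta> $ 1) * (1 - \<theta>' $ 1) * sin (of_int l * (\<theta> $ 3 - \<theta>' $ 3))"
  unfolding Mcoeff_def right_diff_distrib sin_diff
  by (simp add: Re_exp Im_exp mult.commute[of _ "of_int l"]) (simp add: algebra_simps)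

text \<open>A nonzero real coefficient of f can be divided out. What remains is the imaginary part
  of a product of two mixtures of phases, a sine sum over the four angle differences.\<close>

lemma Jfun_identifiable:
  assumes f: "circle_density f" "\<forall>l\<in>{1, 2, 3, 4}. fourier_coeff f l \<in> \<real> - {0}"
    and \<theta>0: "\<theta>0 \<in> param_set" and \<theta>: "\<theta> \<in> param_set"
    and J: "\<And>l. l \<in> {-4..4} \<Longrightarrow> Jfun (mixture f \<theta>0) l \<theta> = 0"
  shows "\<theta> = \<theta>0"
proof -
  have "Im (cnj (Mcoeff (int k) \<theta>0) * Mcoeff (int k) \<theta>) = 0" if k: "k \<in> {1,2,3,4::nat}" for k
  proof -
    have "int k \<in> {1,2,3,4}" using k by auto
    with f(2) have "fourier_coeff f (int k) \<in> \<real> - {0}" by blast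
    then obtain c where c: "fourier_coeff f (int k) = of_real c" "c \<noteq> 0" by (auto elim!: Reals_cases)
    have "int k \<in> {-4..4}" using k by auto
    from J[OF this] have "Im (of_real c * (cnj (Mcoeff (int k) \<theta>0) * Mcoeff (int k) \<theta>)) = 0"
      unfolding Jfun_def fourier_coeff_mixture[OF f(1) \<theta>0] c(1) by (simp only: complex_cnj_mult complex_cnj_complex_of_real mult.assoc)
    then have "c * Im (cnj (Mcoeff (int k) \<theta>0) * Mcoeff (int k) \<theta>) = 0"
      by (simp only: Im_complex_of_real Re_complex_of_real times_complex.sel(2)[of "of_real c"])
    with c(2) show ?thesis by (simp del: times_complex.sel)
  qed
  then have "\<forall>k\<in>{1,2,3,4::nat}. \<theta>0 $ 1 * \<theta> $ 1 * sin (real k * (\<theta>0 $ 2 - \<theta> $ 2)) + \<theta>0 $ 1 * (1 - \<theta> $ 1) * sin (real k * (\<theta>0 $ 2 - \<theta> $ 3))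
     + (1 - \<theta>0 $ 1) * \<theta> $ 1 * sin (real k * (\<theta>0 $ 3 - \<theta> $ 2)) + (1 - \<theta>0 $ 1) * (1 - \<theta> $ 1) * sin (real k * (\<theta>0 $ 3 - \<theta> $ 3)) = 0"
    unfolding Im_cnj_Mcoeff_mult by (simp only: of_int_of_nat_eq) blast
  from mixture_identifiable[OF param_setD(1,2)[OF \<theta>0] param_setD(1,2)[OF \<theta>] param_setD(3-6)[OF \<theta>0] param_setD(3-6)[OF \<theta>] param_setD(7)[OF \<theta>0] param_setD(7)[OF \<theta>] this]
  show ?thesis by (simp add: vec_eq_iff forall_3)
qed

section \<open>Expectations and independence of the observations\<close>

lemma distributed_circle_expectation:
  fixes \<phi> :: "real \<Rightarrow> 'b::{banach, second_countable_topology}"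
  assumes Y: "distributed M circle Y (\<lambda>x. ennreal (g x))" and g: "circle_density g"
    and \<phi>: "\<phi> \<in> borel_measurable borel"
  shows "(LINT \<omega>|M. \<phi> (Y \<omega>)) = (LINT x|circle. g x *\<^sub>R \<phi> x)"
proof -
  have "(LINT \<omega>|M. \<phi> (Y \<omega>)) = (LINT x|distr M circle Y. \<phi> x)"
    using Y by (intro integral_distr[symmetric] borel_measurable_circle \<phi>) (simp add: distributed_def)
  also have "distr M circle Y = density circle (\<lambda>x. ennreal (g x))"
    using Y by (simp add: distributed_def)
  also have "(LINT x|\<dots>. \<phi> x) = (LINT x|circle. g x *\<^sub>R \<phi> x)"
    using g by (intro integral_density borel_measurable_circle \<phi>) (auto simp: circle_density_def)
  finally show ?thesis .
qed

lemma distributed_circle_borel_measurable: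
  assumes "distributed M circle Y (\<lambda>x. ennreal (g x))" "\<phi> \<in> borel_measurable borel"
  shows "(\<lambda>\<omega>. \<phi> (Y \<omega>)) \<in> borel_measurable M"
  by (rule measurable_compose[OF _ borel_measurable_circle[OF assms(2)]])
    (use assms(1) in \<open>simp add: distributed_def\<close>)

text \<open>Used with \<open>Suc\<close>: observations are numbered from 1, the summands of the
  limit theorem from 0.\<close>

lemma (in prob_space) indep_vars_reindex_inj:
  assumes "indep_vars (\<lambda>_. N) X (f ` I)" "inj_on f I"
  shows "indep_vars (\<lambda>_. N) (\<lambda>i. X (f i)) I"
  unfolding indep_vars_def2
proof (intro conjI ballI indep_setsI)
  show "random_variable N (X (f i))" if "i \<in> I" for i
    using assms(1) that unfolding indep_vars_def2 by auto
  then show "{X (f i) -` A \<inter> space M |A. A \<in> sets N} \<subseteq> events" if "i \<in> I" for i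
    using that by (auto intro: measurable_sets)
next
  fix A J assume J: "J \<noteq> {}" "J \<subseteq> I" "finite J" and A: "\<forall>j\<in>J. A j \<in> {X (f j) -` A \<inter> space M |A. A \<in> sets N}"
  have inj: "inj_on f J" using assms(2) J(2) by (rule inj_on_subset)
  define A' where "A' = A \<circ> inv_into J f"
  have A': "A' (f j) = A j" if "j \<in> J" for j using inj that by (simp add: A'_def)
  have "prob (\<Inter>k\<in>f ` J. A' k) = (\<Prod>k\<in>f ` J. prob (A' k))"
    using assms(1) J A A' unfolding indep_vars_def2 by (intro indep_setsD[of _ "f ` I"]) auto
  then show "prob (\<Inter>j\<in>J. A j) = (\<Prod>j\<in>J. prob (A j))"
    using A' by (simp add: prod.reindex[OF inj] cong: INF_cong)
qed

section \<open>Slutsky's lemma and empirical Fourier coefficients\<close>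

text \<open>Tightness and characteristic functions both pass from Y to W. The radius grows by 1; the
  characteristic functions differ by at most \<open>norm t\<close> times \<eta> plus twice the
  probability that W and Y are more than \<eta> apart.\<close>

lemma levy_continuity_slutsky:
  fixes W Y :: "nat \<Rightarrow> 'w \<Rightarrow> 'a::euclidean_space"
  assumes M: "prob_space M" and N: "prob_space N" "sets N = sets borel"
    and W: "\<forall>\<^sub>F n in sequentially. W n \<in> borel_measurable M"
    and Y: "\<And>n. Y n \<in> borel_measurable M"
    and tight: "\<And>e. 0 < e \<Longrightarrow> \<exists>R. \<forall>\<^sub>F n in sequentially. measure M {\<omega>\<in>space M. R < norm (Y n \<omega>)} \<le> e"
    and char: "\<And>t. (\<lambda>n. LINT \<omega>|M. exp (\<i> * of_real (t \<bullet> Y n \<omega>))) \<longlonglongrightarrow> (LINT x|N. exp (\<i> * of_real (t \<bullet> x)))"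
    and diff: "\<And>e. 0 < e \<Longrightarrow> (\<lambda>n. measure M {\<omega>\<in>space M. e < norm (W n \<omega> - Y n \<omega>)}) \<longlonglongrightarrow> 0"
  shows "converges_in_distribution M W N"
proof (rule levy_continuity_of_tight[OF M N W])
  interpret prob_space M by fact
  note [measurable] = Y
  fix e :: real assume e: "0 < e"
  obtain R where R: "\<forall>\<^sub>F n in sequentially. prob {\<omega>\<in>space M. R < norm (Y n \<omega>)} \<le> e / 2"
    using tight[of "e / 2"] e by auto
  have "\<forall>\<^sub>F n in sequentially. prob {\<omega>\<in>space M. 1 < norm (W n \<omega> - Y n \<omega>)} < e / 2"
    using e by (intro order_tendstoD(2)[OF diff]) auto
  with R W have "\<forall>\<^sub>F n in sequentially. prob {\<omega>\<in>space M. R + 1 < norm (W n \<omega>)} \<le> e"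
  proof eventually_elim
    case (elim n)
    note [measurable] = elim(2)
    have "prob {\<omega>\<in>space M. R + 1 < norm (W n \<omega>)}
      \<le> prob ({\<omega>\<in>space M. R < norm (Y n \<omega>)} \<union> {\<omega>\<in>space M. 1 < norm (W n \<omega> - Y n \<omega>)})"
    proof (rule finite_measure_mono)
      show "{\<omega>\<in>space M. R + 1 < norm (W n \<omega>)}
        \<subseteq> {\<omega>\<in>space M. R < norm (Y n \<omega>)} \<union> {\<omega>\<in>space M. 1 < norm (W n \<omega> - Y n \<omega>)}"
      proof (clarsimp simp: not_less)
        fix \<omega> assume "R + 1 < norm (W n \<omega>)" "norm (W n \<omega> - Y n \<omega>) \<le> 1"
        with norm_triangle_sub[of "W n \<omega>" "Y n \<omega>"] show "R < norm (Y n \<omega>)" by linarith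
      qed
    qed measurable
    also have "\<dots> \<le> prob {\<omega>\<in>space M. R < norm (Y n \<omega>)} + prob {\<omega>\<in>space M. 1 < norm (W n \<omega> - Y n \<omega>)}"
      by (rule measure_Un_le) measurable
    finally show ?case using elim by linarith
  qed
  then show "\<exists>R. \<forall>\<^sub>F n in sequentially. prob {\<omega>\<in>space M. R < norm (W n \<omega>)} \<le> e" by blast
next
  interpret prob_space M by fact
  note [measurable] = Y
  fix t :: 'a
  let ?c = "\<lambda>Z. (CLINT \<omega>|M. exp (\<i> * of_real (t \<bullet> Z \<omega>)))"
  have bound: "norm (?c (W n) - ?c (Y n)) \<le> norm t * \<eta> + 2 * prob {\<omega>\<in>space M. \<eta> < norm (W n \<omega> - Y n \<omega>)}"
    if Wn: "W n \<in> borel_measurable M" and \<eta>: "0 < \<eta>" for n \<eta>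
  proof -
    note [measurable] = Wn
    let ?A = "{\<omega>\<in>space M. \<eta> < norm (W n \<omega> - Y n \<omega>)}"
    have i: "integrable M (\<lambda>\<omega>. exp (\<i> * of_real (t \<bullet> W n \<omega>)))" "integrable M (\<lambda>\<omega>. exp (\<i> * of_real (t \<bullet> Y n \<omega>)))"
      by (rule integrable_iexp; simp)+
    have "norm (?c (W n) - ?c (Y n)) = norm (CLINT \<omega>|M. exp (\<i> * of_real (t \<bullet> W n \<omega>)) - exp (\<i> * of_real (t \<bullet> Y n \<omega>)))"
      using i by simp
    also have "\<dots> \<le> (LINT \<omega>|M. norm (exp (\<i> * of_real (t \<bullet> W n \<omega>)) - exp (\<i> * of_real (t \<bullet> Y n \<omega>))))"
      by (rule integral_norm_bound)
    also have "\<dots> \<le> (LINT \<omega>|M. norm t * \<eta> + 2 * indicator ?A \<omega>)"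
    proof (rule integral_mono)
      fix \<omega> assume \<omega>: "\<omega> \<in> space M"
      have e1: "norm (exp (\<i> * of_real (t \<bullet> Z \<omega>))) = 1" for Z by (simp add: norm_exp_eq_Re)
      have 2: "norm (exp (\<i> * of_real (t \<bullet> W n \<omega>)) - exp (\<i> * of_real (t \<bullet> Y n \<omega>))) \<le> 2"
        by (rule order_trans[OF norm_triangle_ineq4]) (simp only: e1)
      have "exp (\<i> * of_real (t \<bullet> W n \<omega>)) - exp (\<i> * of_real (t \<bullet> Y n \<omega>))
         = exp (\<i> * of_real (t \<bullet> Y n \<omega>)) * (iexp (t \<bullet> (W n \<omega> - Y n \<omega>)) - 1)"
        by (simp add: algebra_simps exp_add[symmetric] inner_diff_right)
      moreover have "norm (iexp (t \<bullet> (W n \<omega> - Y n \<omega>)) - 1) \<le> \<bar>t \<bullet> (W n \<omega> - Y n \<omega>)\<bar>"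
        using iexp_approx1[of "t \<bullet> (W n \<omega> - Y n \<omega>)" 0] by simp
      ultimately have 3: "norm (exp (\<i> * of_real (t \<bullet> W n \<omega>)) - exp (\<i> * of_real (t \<bullet> Y n \<omega>))) \<le> norm t * norm (W n \<omega> - Y n \<omega>)"
        using Cauchy_Schwarz_ineq2[of t "W n \<omega> - Y n \<omega>"] by (simp only: norm_mult e1)
      show "norm (exp (\<i> * of_real (t \<bullet> W n \<omega>)) - exp (\<i> * of_real (t \<bullet> Y n \<omega>))) \<le> norm t * \<eta> + 2 * indicator ?A \<omega>"
      proof (cases "\<omega> \<in> ?A")
        case True
        have "0 \<le> norm t * \<eta>" using \<eta> by simp
        with True 2 show ?thesis by simp
      next
        case False
        then have "norm t * norm (W n \<omega> - Y n \<omega>) \<le> norm t * \<eta>" using \<omega> by (intro mult_left_mono) auto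
        with False 3 show ?thesis by simp
      qed
    qed (use i in \<open>auto simp: less_top[symmetric]\<close>)
    also have "\<dots> = (LINT \<omega>|M. norm t * \<eta>) + (LINT \<omega>|M. 2 * indicator ?A \<omega>)"
      by (intro Bochner_Integration.integral_add integrable_const integrable_mult_right integrable_real_indicator)
        (auto simp: less_top[symmetric])
    also have "\<dots> = norm t * \<eta> + 2 * prob ?A" by (simp add: prob_space)
    finally show ?thesis .
  qed
  have "(\<lambda>n. ?c (W n) - ?c (Y n)) \<longlonglongrightarrow> 0"
  proof (rule tendstoI)
    fix \<epsilon> :: real assume \<epsilon>: "0 < \<epsilon>"
    \<comment> \<open>The added 1 keeps the divisor positive when t = 0.\<close>
    define T where "T = norm t + 1"
    define \<eta> where "\<eta> = \<epsilon> / (2 * T)"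
    have pos: "0 < T" unfolding T_def by (rule add_nonneg_pos) auto
    have \<eta>: "0 < \<eta>" using \<epsilon> pos by (simp add: \<eta>_def)
    have "T * \<eta> = \<epsilon> / 2" using pos by (simp add: \<eta>_def)
    then have t\<eta>: "norm t * \<eta> \<le> \<epsilon> / 2" using \<eta> unfolding T_def distrib_right by linarith
    have "\<forall>\<^sub>F n in sequentially. prob {\<omega>\<in>space M. \<eta> < norm (W n \<omega> - Y n \<omega>)} < \<epsilon> / 4"
      using \<epsilon> by (intro order_tendstoD(2)[OF diff[OF \<eta>]]) auto
    with W show "\<forall>\<^sub>F n in sequentially. dist (?c (W n) - ?c (Y n)) 0 < \<epsilon>"
    proof eventually_elim
      case (elim n)
      from bound[OF elim(1) \<eta>] elim(2) t\<eta> show ?case by simp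
    qed
  qed
  from tendsto_add[OF this char[of t]] show "(\<lambda>n. ?c (W n)) \<longlonglongrightarrow> (LINT x|N. exp (\<i> * of_real (t \<bullet> x)))" by simp
qed

section \<open>Moments of the empirical Fourier coefficients\<close>

text \<open>An observation takes its values in [0, 2 pi), and a continuous function is bounded on
  the closed interval.\<close>

lemma (in prob_space) integrable_continuous_compose_circle:
  fixes \<phi> :: "real \<Rightarrow> 'b::euclidean_space"
  assumes Y: "distributed M circle Y (\<lambda>x. ennreal (g x))" and \<phi>: "continuous_on UNIV \<phi>"
  shows "integrable M (\<lambda>\<omega>. \<phi> (Y \<omega>))"
proof -
  have "compact (\<phi> ` {0..2*pi})"
    by (intro compact_continuous_image continuous_on_subset[OF \<phi>]) auto
  then obtain B where B: "\<And>x. x \<in> {0..2*pi} \<Longrightarrow> norm (\<phi> x) \<le> B"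
    by (meson bounded_iff compact_imp_bounded imageI)
  have "Y \<in> measurable M circle" using Y by (simp add: distributed_def)
  then have "Y \<omega> \<in> {0..2*pi}" if "\<omega> \<in> space M" for \<omega>
    using measurable_space[OF _ that, of Y circle] by (auto simp: circle_def space_restrict_space)
  with B show ?thesis
    by (intro integrable_const_bound[where B=B] distributed_circle_borel_measurable[OF Y]
        borel_measurable_continuous_onI[OF \<phi>]) auto
qed

lemma continuous_mode: "continuous_on UNIV (\<lambda>x. exp (\<i> * of_int l * of_real x) / (2 * complex_of_real pi))"
  by (intro continuous_intros) auto

lemma expectation_mode:
  assumes Y: "distributed M circle Y (\<lambda>x. ennreal (g x))" and g: "circle_density g"
  shows "(LINT \<omega>|M. exp (\<i> * of_int l * of_real (Y \<omega>)) / (2 * of_real pi)) = cnj (fourier_coeff g l)"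
proof -
  have "(LINT \<omega>|M. exp (\<i> * of_int l * of_real (Y \<omega>)) / (2 * complex_of_real pi))
     = (LINT x|circle. g x *\<^sub>R (exp (\<i> * of_int l * of_real x) / (2 * complex_of_real pi)))"
    by (rule distributed_circle_expectation[OF Y g borel_measurable_continuous_onI[OF continuous_mode]])
  also have "\<dots> = (LINT x|circle. cnj (of_real (g x) * exp (- \<i> * of_int l * of_real x))) / (2 * of_real pi)"
    unfolding integral_divide_zero[symmetric] by (simp add: exp_cnj scaleR_conv_of_real)
  also have "\<dots> = cnj (fourier_coeff g l)"
    unfolding fourier_coeff_def Bochner_Integration.integral_cnj by simp
  finally show ?thesis .
qed

lemma (in prob_space) norm_cnj_fourier_coeff_le:
  assumes Y: "distributed M circle Y (\<lambda>x. ennreal (g x))" and g: "circle_density g"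
  shows "norm (cnj (fourier_coeff g l)) \<le> 1"
proof -
  have i: "integrable M (\<lambda>\<omega>. norm (exp (\<i> * of_int l * of_real (Y \<omega>)) / (2 * complex_of_real pi)))"
    by (intro integrable_norm integrable_continuous_compose_circle[OF Y continuous_mode])
  have "norm (cnj (fourier_coeff g l)) \<le> (LINT \<omega>|M. norm (exp (\<i> * of_int l * of_real (Y \<omega>)) / (2 * complex_of_real pi)))"
    unfolding expectation_mode[OF Y g, symmetric] by (rule integral_norm_bound)
  also have "\<dots> \<le> 1"
    by (rule integral_le_const[OF i]) (rule AE_I2, rule norm_exp_mode)
  finally show ?thesis .
qed

lemma (in prob_space) second_moment_mean_indep:
  fixes \<phi> :: "real \<Rightarrow> real" and X :: "nat \<Rightarrow> 'a \<Rightarrow> real"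
  assumes X: "indep_vars (\<lambda>_. borel) X {1..}" and \<phi>: "\<phi> \<in> borel_measurable borel" "\<And>x. \<bar>\<phi> x\<bar> \<le> B"
    and mean: "\<And>k. k \<ge> 1 \<Longrightarrow> expectation (\<lambda>\<omega>. \<phi> (X k \<omega>)) = 0" and n: "n \<ge> 1"
  shows "expectation (\<lambda>\<omega>. ((\<Sum>k\<in>{1..n}. \<phi> (X k \<omega>)) / real n)\<^sup>2) \<le> B\<^sup>2 / real n"
proof -
  have [measurable]: "X k \<in> borel_measurable M" if "k \<in> {1..n}" for k
    using X that unfolding indep_vars_def2 by auto
  note [measurable] = \<phi>(1)
  have "indep_vars (\<lambda>_. borel) X {1..n}" using X by (rule indep_vars_subset) auto
  then have ind: "indep_vars (\<lambda>_. borel) (\<lambda>k \<omega>. \<phi> (X k \<omega>)) {1..n}"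
    by (rule indep_vars_compose2) (use \<phi> in auto)
  have "expectation (\<lambda>\<omega>. (\<Sum>k\<in>{1..n}. \<phi> (X k \<omega>))\<^sup>2) = (\<Sum>k\<in>{1..n}. expectation (\<lambda>\<omega>. (\<phi> (X k \<omega>))\<^sup>2))"
    by (rule second_moment_sum_indep[where B=B, OF finite_atLeastAtMost ind]) (use mean \<phi> in auto)
  also have "\<dots> \<le> (\<Sum>k\<in>{1..n}. B\<^sup>2)"
  proof (rule sum_mono)
    fix k assume k: "k \<in> {1..n}"
    have b: "(\<phi> x)\<^sup>2 \<le> B\<^sup>2" for x using power_mono[OF \<phi>(2)[of x] abs_ge_zero, of 2] by simp
    have "integrable M (\<lambda>\<omega>. (\<phi> (X k \<omega>))\<^sup>2)"
      by (rule integrable_const_bound[where B="B\<^sup>2"]) (use b k in auto)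
    then show "expectation (\<lambda>\<omega>. (\<phi> (X k \<omega>))\<^sup>2) \<le> B\<^sup>2"
      by (rule integral_le_const) (use b in auto)
  qed
  finally have "expectation (\<lambda>\<omega>. (\<Sum>k\<in>{1..n}. \<phi> (X k \<omega>))\<^sup>2) \<le> real n * B\<^sup>2" by simp
  then have "expectation (\<lambda>\<omega>. (\<Sum>k\<in>{1..n}. \<phi> (X k \<omega>))\<^sup>2) / (real n)\<^sup>2 \<le> real n * B\<^sup>2 / (real n)\<^sup>2"
    by (rule divide_right_mono) simp
  then show ?thesis using n by (simp add: power_divide power2_eq_square)
qed

lemma (in prob_space) emp_coeff_second_moment:
  fixes X :: "nat \<Rightarrow> 'a \<Rightarrow> real"
  assumes indep: "indep_vars (\<lambda>_. borel) X {1..}" and X: "\<And>k. k \<ge> 1 \<Longrightarrow> distributed M circle (X k) (\<lambda>x. ennreal (g x))"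
    and g: "circle_density g" and n: "n \<ge> 1"
  defines "Q \<equiv> \<lambda>\<omega>. \<Sum>l\<in>{-4..4}. (norm (emp_coeff n (\<lambda>k. X k \<omega>) l - cnj (fourier_coeff g l)))\<^sup>2"
  shows "integrable M Q" "expectation Q \<le> 72 / real n"
proof -
  define m where "m l = cnj (fourier_coeff g l)" for l
  define E where "E l x = exp (\<i> * of_int l * of_real x) / (2 * complex_of_real pi)" for l x
  have E[measurable]: "E l \<in> borel_measurable borel" for l
    unfolding E_def by (rule borel_measurable_continuous_onI[OF continuous_mode])
  have [measurable]: "X k \<in> borel_measurable M" if "k \<in> {1..n}" for k
    using indep that unfolding indep_vars_def2 by auto
  define re im where "re l x = Re (E l x) - Re (m l)" and "im l x = Im (E l x) - Im (m l)" for l x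
  have [measurable]: "re l \<in> borel_measurable borel" "im l \<in> borel_measurable borel" for l
    unfolding re_def im_def by measurable
  have m: "norm (m l) \<le> 1" for l unfolding m_def by (rule norm_cnj_fourier_coeff_le[OF X[OF order_refl] g])
  have nE: "norm (E l x) \<le> 1" for l x unfolding E_def by (rule norm_exp_mode)
  have bnd: "\<bar>re l x\<bar> \<le> 2" "\<bar>im l x\<bar> \<le> 2" for l x
    using abs_Re_le_cmod[of "E l x"] abs_Im_le_cmod[of "E l x"] abs_Re_le_cmod[of "m l"] abs_Im_le_cmod[of "m l"] m[of l] nE[of l x]
    unfolding re_def im_def by linarith+
  have iE: "integrable M (\<lambda>\<omega>. E l (X k \<omega>))" if "k \<ge> 1" for k l
    unfolding E_def by (rule integrable_continuous_compose_circle[OF X[OF that] continuous_mode])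
  have eE: "expectation (\<lambda>\<omega>. E l (X k \<omega>)) = m l" if "k \<ge> 1" for k l
    unfolding E_def m_def by (rule expectation_mode[OF X[OF that] g])
  have mean: "expectation (\<lambda>\<omega>. re l (X k \<omega>)) = 0" "expectation (\<lambda>\<omega>. im l (X k \<omega>)) = 0" if "k \<ge> 1" for k l
    unfolding re_def im_def using iE[OF that, of l] eE[OF that, of l] by (simp_all add: prob_space)
  define R I where "R l \<omega> = (\<Sum>k\<in>{1..n}. re l (X k \<omega>)) / real n" and "I l \<omega> = (\<Sum>k\<in>{1..n}. im l (X k \<omega>)) / real n" for l \<omega>
  have ec: "emp_coeff n (\<lambda>k. X k \<omega>) l - m l = Complex (R l \<omega>) (I l \<omega>)" for l \<omega>
    using n by (simp add: complex_eq_iff emp_coeff_def E_def[symmetric] R_def I_def re_def im_def sum_subtractf diff_divide_distrib)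
  have Q: "Q \<omega> = (\<Sum>l\<in>{-4..4}. (R l \<omega>)\<^sup>2 + (I l \<omega>)\<^sup>2)" for \<omega>
    unfolding Q_def m_def[symmetric] ec by (simp add: cmod_power2)
  have mRI[measurable]: "R l \<in> borel_measurable M" "I l \<in> borel_measurable M" for l
    unfolding R_def I_def by measurable
  have avg: "\<bar>(\<Sum>k\<in>{1..n}. y k) / real n\<bar> \<le> 2" if "\<And>k. \<bar>y k\<bar> \<le> 2" for y :: "nat \<Rightarrow> real"
  proof -
    have "\<bar>\<Sum>k\<in>{1..n}. y k\<bar> \<le> (\<Sum>k\<in>{1..n}. 2)" by (intro order_trans[OF sum_abs] sum_mono that)
    then show ?thesis using n by (simp add: divide_le_eq)
  qed
  have bRI: "\<bar>R l \<omega>\<bar> \<le> 2" "\<bar>I l \<omega>\<bar> \<le> 2" for l \<omega>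
    unfolding R_def I_def by (intro avg bnd)+
  have sq: "integrable M (\<lambda>\<omega>. (Z \<omega>)\<^sup>2)" if [measurable]: "Z \<in> borel_measurable M" and "\<And>\<omega>. \<bar>Z \<omega>\<bar> \<le> 2" for Z :: "'a \<Rightarrow> real"
    by (rule integrable_const_bound[where B="2\<^sup>2"]) (use power_mono[OF that(2) abs_ge_zero, where n=2] in auto)
  have iR: "integrable M (\<lambda>\<omega>. (R l \<omega>)\<^sup>2)" and iI: "integrable M (\<lambda>\<omega>. (I l \<omega>)\<^sup>2)" for l
    by (intro sq mRI bRI)+
  show "integrable M Q" unfolding Q using iR iI by auto
  have "expectation Q = (\<Sum>l\<in>{-4..4}. expectation (\<lambda>\<omega>. (R l \<omega>)\<^sup>2) + expectation (\<lambda>\<omega>. (I l \<omega>)\<^sup>2))"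
    unfolding Q using iR iI by simp
  \<comment> \<open>Real and imaginary parts are centred means of variables bounded by 2, each
    contributing 4/n; with nine frequencies this gives 72/n.\<close>
  also have "\<dots> \<le> (\<Sum>l\<in>{-4..4::int}. 2\<^sup>2 / real n + 2\<^sup>2 / real n)"
    unfolding R_def I_def
    by (intro sum_mono add_mono second_moment_mean_indep[OF indep] bnd mean n) measurable
  also have "\<dots> = 72 / real n" by simp
  finally show "expectation Q \<le> 72 / real n" .
qed

section \<open>Asymptotic normality\<close>

lemma (in prob_space) prob_ge_le_expectation_div:
  fixes Q :: "'a \<Rightarrow> real"
  assumes "integrable M Q" "\<And>\<omega>. 0 \<le> Q \<omega>" "0 < c"
    and "\<And>\<omega>. \<omega> \<in> A \<Longrightarrow> \<omega> \<in> space M \<and> c \<le> Q \<omega>"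
  shows "prob A \<le> expectation Q / c"
proof -
  have [measurable]: "Q \<in> borel_measurable M" using assms(1) by auto
  have "prob A \<le> prob {\<omega>\<in>space M. c \<le> Q \<omega>}"
    by (rule finite_measure_mono) (use assms(4) in auto)
  also have "\<dots> \<le> expectation Q / c"
    using integral_Markov_inequality_measure[OF assms(1) sets.empty_sets _ assms(3)] assms(2) by simp
  finally show ?thesis .
qed

lemma sqrt_mult_real_self: "sqrt (real n) * (c / real n) = c / sqrt (real n)"
  by (cases "n = 0") (simp_all add: real_div_sqrt field_simps)

lemma tendsto_const_div_sqrt: "(\<lambda>n. c / sqrt (real n)) \<longlonglongrightarrow> 0"
  by (intro tendsto_divide_0[OF tendsto_const] filterlim_at_top_imp_at_infinity
      filterlim_compose[OF sqrt_at_top filterlim_real_sequentially])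

text \<open>\<open>Y\<close> is the leading linear term of the estimation error and \<open>Q\<close> the squared error of the
  empirical Fourier coefficients, which is of order \<open>1/n\<close> in mean.\<close>

lemma (in prob_space) converges_in_distribution_of_expansion:
  fixes W Y :: "nat \<Rightarrow> 'a \<Rightarrow> 'b::euclidean_space" and Q :: "nat \<Rightarrow> 'a \<Rightarrow> real"
  assumes N: "prob_space N" "sets N = sets borel"
    and W: "\<And>n. n \<ge> n0 \<Longrightarrow> W n \<in> borel_measurable M" and Y: "\<And>n. Y n \<in> borel_measurable M"
    and char: "\<And>t. (\<lambda>n. LINT \<omega>|M. exp (\<i> * of_real (t \<bullet> Y n \<omega>))) \<longlonglongrightarrow> (LINT x|N. exp (\<i> * of_real (t \<bullet> x)))"
    and Q: "\<And>n. n \<ge> 1 \<Longrightarrow> integrable M (Q n)" "\<And>n \<omega>. 0 \<le> Q n \<omega>" "\<And>n. n \<ge> 1 \<Longrightarrow> expectation (Q n) \<le> K / real n"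
    and C: "0 < C" and \<delta>: "0 < \<delta>"
    and YQ: "\<And>n \<omega>. \<omega> \<in> space M \<Longrightarrow> norm (Y n \<omega>) \<le> sqrt (real n) * (C * sqrt (Q n \<omega>))"
    and WQ: "\<And>n \<omega>. \<omega> \<in> space M \<Longrightarrow> n \<ge> n0 \<Longrightarrow> sqrt (Q n \<omega>) \<le> \<delta> \<Longrightarrow>
       norm (W n \<omega> - Y n \<omega>) \<le> sqrt (real n) * (C * (Q n \<omega> + 1 / real n))"
  shows "converges_in_distribution M W N"
proof (rule levy_continuity_slutsky[OF prob_space_axioms N _ Y _ char])
  note [measurable] = Y
  have K: "0 \<le> K"
  proof -
    have "0 \<le> expectation (Q 1)" by (rule integral_nonneg_AE) (simp add: Q(2))
    with Q(3)[of 1] show ?thesis by simp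
  qed
  show "\<forall>\<^sub>F n in sequentially. W n \<in> borel_measurable M"
    using W by (auto simp: eventually_sequentially)
  have markov: "prob A \<le> K / (real n * c)"
    if n: "n \<ge> 1" and c: "0 < c" and A: "\<And>\<omega>. \<omega> \<in> A \<Longrightarrow> \<omega> \<in> space M \<and> c \<le> Q n \<omega>" for A n c
  proof -
    have "prob A \<le> expectation (Q n) / c"
      by (rule prob_ge_le_expectation_div[OF Q(1)[OF n] Q(2) c A])
    also have "\<dots> \<le> K / real n / c" using Q(3)[OF n] c by (intro divide_right_mono) auto
    finally show ?thesis by (simp add: mult.commute)
  qed
  show "\<exists>R. \<forall>\<^sub>F n in sequentially. prob {\<omega>\<in>space M. R < norm (Y n \<omega>)} \<le> e" if e: "0 < e" for e
  proof -
    \<comment> \<open>\<open>norm (Y n \<omega>)\<close> > R forces n Q \<ge> (K + 1)/e, which by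
      Markov has probability at most e K/(K + 1). Using K + 1 avoids a zero radius when K =
      0.\<close>
    define R where "R = C * sqrt ((K + 1) / e)"
    have R: "0 < R" using C K e by (simp add: R_def)
    have "prob {\<omega>\<in>space M. R < norm (Y n \<omega>)} \<le> e" if n: "n \<ge> 1" for n
    proof -
      have "prob {\<omega>\<in>space M. R < norm (Y n \<omega>)} \<le> K / (real n * ((K + 1) / e / real n))"
      proof (rule markov[OF n])
        show "0 < (K + 1) / e / real n" using K e n by simp
        fix \<omega> assume "\<omega> \<in> {\<omega>\<in>space M. R < norm (Y n \<omega>)}"
        then have \<omega>: "\<omega> \<in> space M" and "R < norm (Y n \<omega>)" by auto
        with YQ[OF \<omega>, of n] have "R \<le> C * sqrt (real n * Q n \<omega>)"
          by (simp add: real_sqrt_mult mult_ac)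
        then have "sqrt ((K + 1) / e) \<le> sqrt (real n * Q n \<omega>)"
          unfolding R_def using C by (simp only: mult_le_cancel_left_pos)
        then have "(K + 1) / e \<le> real n * Q n \<omega>" by simp
        then have "(K + 1) / e \<le> Q n \<omega> * real n" by (simp only: mult.commute)
        then have "(K + 1) / e / real n \<le> Q n \<omega>"
          by (rule iffD2[OF pos_divide_le_eq, rotated]) (use n in simp)
        with \<omega> show "\<omega> \<in> space M \<and> (K + 1) / e / real n \<le> Q n \<omega>" by simp
      qed
      also have "\<dots> = e * (K / (K + 1))" using n by simp
      also have "\<dots> \<le> e * 1" using K e by (intro mult_left_mono) auto
      finally show ?thesis by simp
    qed
    then show ?thesis by (auto simp: eventually_sequentially)
  qed
  show "(\<lambda>n. prob {\<omega>\<in>space M. e < norm (W n \<omega> - Y n \<omega>)}) \<longlonglongrightarrow> 0" if e: "0 < e" for e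
  proof (rule real_tendsto_sandwich[where f="\<lambda>_. 0"])
    show "(\<lambda>n. (K / \<delta>\<^sup>2) / real n + (2 * C * K / e) / sqrt (real n)) \<longlonglongrightarrow> 0"
      using tendsto_add[OF lim_const_over_n[of "K / \<delta>\<^sup>2"] tendsto_const_div_sqrt[of "2 * C * K / e"]] by simp
    have ev1: "\<forall>\<^sub>F n in sequentially. 2 * C / sqrt (real n) < e"
      using e by (intro order_tendstoD(2)[OF tendsto_const_div_sqrt])
    have ev2: "\<forall>\<^sub>F n in sequentially. n \<ge> max 1 n0" by (rule eventually_ge_at_top)
    from ev1 ev2 show "\<forall>\<^sub>F n in sequentially. prob {\<omega>\<in>space M. e < norm (W n \<omega> - Y n \<omega>)}
        \<le> (K / \<delta>\<^sup>2) / real n + (2 * C * K / e) / sqrt (real n)"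
    proof eventually_elim
      case (elim n)
      have n: "n \<ge> 1" "n \<ge> n0" using elim(2) by auto
      have [measurable]: "W n \<in> borel_measurable M" "Q n \<in> borel_measurable M" using W n Q(1) by auto
      have "2 * C / sqrt (real n) = 2 * (C / sqrt (real n))" by simp
      with elim(1) have C2: "C / sqrt (real n) < e / 2" by linarith
      \<comment> \<open>The value of Q at which sqrt n times C Q reaches e/2; the remaining part
        C/sqrt n of the error is already below e/2.\<close>
      define c where "c = e / (2 * C * sqrt (real n))"
      have c: "0 < c" using e C n by (simp add: c_def)
      let ?A = "{\<omega>\<in>space M. \<delta>\<^sup>2 \<le> Q n \<omega>}" and ?B = "{\<omega>\<in>space M. c \<le> Q n \<omega>}"
      have "prob {\<omega>\<in>space M. e < norm (W n \<omega> - Y n \<omega>)} \<le> prob (?A \<union> ?B)"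
      proof (rule finite_measure_mono)
        show "{\<omega>\<in>space M. e < norm (W n \<omega> - Y n \<omega>)} \<subseteq> ?A \<union> ?B"
        proof
          fix \<omega> assume "\<omega> \<in> {\<omega>\<in>space M. e < norm (W n \<omega> - Y n \<omega>)}"
          then have \<omega>: "\<omega> \<in> space M" and lt: "e < norm (W n \<omega> - Y n \<omega>)" by auto
          show "\<omega> \<in> ?A \<union> ?B"
          proof (rule ccontr)
            assume "\<omega> \<notin> ?A \<union> ?B"
            with \<omega> have "Q n \<omega> \<le> \<delta>\<^sup>2" "Q n \<omega> < c" by auto
            then have "sqrt (Q n \<omega>) \<le> \<delta>" using \<delta> by (intro real_le_lsqrt) auto
            from WQ[OF \<omega> n(2) this] lt have "e < sqrt (real n) * (C * (Q n \<omega> + 1 / real n))" by linarith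
            also have "\<dots> = sqrt (real n) * C * Q n \<omega> + C / sqrt (real n)"
              using sqrt_mult_real_self[of n C] by (simp add: algebra_simps)
            also have "\<dots> < sqrt (real n) * C * c + e / 2"
              using C2 \<open>Q n \<omega> < c\<close> C n by (intro add_strict_mono mult_strict_left_mono) auto
            also have "\<dots> = e" using C n by (simp add: c_def)
            finally show False by simp
          qed
        qed
      qed measurable
      also have "\<dots> \<le> prob ?A + prob ?B" by (rule measure_Un_le) measurable
      also have "\<dots> \<le> K / (real n * \<delta>\<^sup>2) + K / (real n * c)"
        using \<delta> c n by (intro add_mono markov) auto
      also have "K / (real n * c) = (2 * C * K / e) / sqrt (real n)"
      proof -
        have "real n * c = sqrt (real n) * e / (2 * C)"
          using n C by (simp add: c_def field_simps)
        then show ?thesis by (simp add: mult_ac)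
      qed
      finally show ?case by (simp add: mult.commute)
    qed
  qed (auto simp: eventually_sequentially)
qed

lemma matrix_inv_mult:
  fixes A :: "real^'n^'n"
  assumes "invertible A"
  shows "matrix_inv A ** A = mat 1" "A ** matrix_inv A = mat 1"
  using someI_ex[OF assms[unfolded invertible_def]] unfolding matrix_inv_def by auto

lemma transpose_matrix_inv:
  fixes A :: "real^'n^'n"
  assumes "invertible A" "transpose A = A"
  shows "transpose (matrix_inv A) = matrix_inv A"
proof -
  have "transpose (matrix_inv A) = transpose (matrix_inv A) ** (A ** matrix_inv A)"
    by (simp add: matrix_inv_mult[OF assms(1)])
  also have "\<dots> = (transpose (matrix_inv A) ** transpose A) ** matrix_inv A"
    by (simp add: assms(2) matrix_mul_assoc)
  also have "transpose (matrix_inv A) ** transpose A = mat 1"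
    by (simp add: matrix_transpose_mul[symmetric] matrix_inv_mult[OF assms(1)])
  finally show ?thesis by simp
qed

lemma continuous_on_outer [continuous_intros]:
  "continuous_on S f \<Longrightarrow> continuous_on S (\<lambda>x. outer (f x :: real^'n))"
proof -
  have "outer v = (\<chi> i j. v $ i * v $ j)" for v :: "real^'n" by (simp add: vec_eq_iff outer_nth)
  then show "continuous_on S f \<Longrightarrow> continuous_on S (\<lambda>x. outer (f x :: real^'n))"
    by (auto intro!: continuous_intros)
qed

lemma continuous_Zvar: "continuous_on S (\<lambda>x. Zvar l x \<theta>)"
  unfolding Zvar_def by (intro continuous_intros) auto

theorem theorem5:
  fixes M :: "'w measure"
    and X :: "nat \<Rightarrow> 'w \<Rightarrow> real"
    and f g :: "real \<Rightarrow> real"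
    and \<Theta> :: "(real ^ 3) set"
    and \<theta>0 :: "real ^ 3"
    and est :: "nat \<Rightarrow> 'w \<Rightarrow> real ^ 3"
    and U :: "'w \<Rightarrow> real ^ 3"
    and A V \<Sigma> :: "real ^ 3 ^ 3"
  assumes prob: "prob_space M"
    and \<Theta>_compact: "compact \<Theta>"
    and \<Theta>_subset: "\<Theta> \<subseteq> param_set"
    and f_density: "circle_density f"
    and f_coeffs: "\<forall>l\<in>{1, 2, 3, 4}. fourier_coeff f l \<in> \<real> - {0}"
    and \<theta>0_in: "\<theta>0 \<in> \<Theta>"
    and \<theta>0_interior: "\<theta>0 \<in> interior \<Theta>"
    and g_def: "g = mixture f \<theta>0"
    and X_indep: "prob_space.indep_vars M (\<lambda>_. borel) X {1..}"
    and X_density: "\<forall>k\<ge>1. distributed M circle (X k) (\<lambda>x. ennreal (g x))"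
    and est_measurable: "\<forall>n\<ge>2. est n \<in> borel_measurable M"
    and est_argmin: "\<forall>n\<ge>2. \<forall>\<omega>\<in>space M.
          is_arg_min (empirical_contrast n (\<lambda>k. X k \<omega>)) (\<lambda>\<theta>. \<theta> \<in> \<Theta>) (est n \<omega>)"
    and A_def: "A = hessian (contrast g) \<theta>0"
    and U_def: "U = (\<lambda>\<omega>. \<Sum>l\<in>{-4..4}. Zvar l (X 1 \<omega>) \<theta>0 *\<^sub>R gradient (Jfun g l) \<theta>0)"
    and V_def: "V = 4 *\<^sub>R prob_space.expectation M (\<lambda>\<omega>. outer (U \<omega>))"
    and \<Sigma>_def: "\<Sigma> = matrix_inv A ** V ** matrix_inv A"
  shows "A = 2 *\<^sub>R (\<Sum>l\<in>{-4..4}. outer (gradient (Jfun g l) \<theta>0))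
    \<and> (invertible A \<longrightarrow>
        (\<exists>N. multivariate_normal 0 \<Sigma> N \<and>
             converges_in_distribution M (\<lambda>n \<omega>. sqrt (real n) *\<^sub>R (est n \<omega> - \<theta>0)) N))"
proof -
  interpret prob_space M by (rule prob)
  have \<theta>0: "\<theta>0 \<in> param_set" using \<theta>0_in \<Theta>_subset by blast
  have g: "circle_density g" unfolding g_def by (rule circle_density_mixture[OF f_density \<theta>0])
  have J0: "Jfun g l \<theta>0 = 0" if "l \<in> {-4..4}" for l
    unfolding g_def by (rule Jfun_true_parameter[OF f_density f_coeffs \<theta>0 that])
  define m where "m l = cnj (fourier_coeff g l)" for l
  define a where "a l = gradient (Jfun g l) \<theta>0" for l
  have A: "A = 2 *\<^sub>R (\<Sum>l\<in>{-4..4}. outer (a l))"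
    unfolding A_def a_def by (rule hessian_contrast[OF J0])
  have "\<exists>N. multivariate_normal 0 \<Sigma> N \<and>
             converges_in_distribution M (\<lambda>n \<omega>. sqrt (real n) *\<^sub>R (est n \<omega> - \<theta>0)) N"
    if inv: "invertible A"
  proof -
    define B where "B = matrix_inv A"
    have BA: "B ** A = mat 1" unfolding B_def by (rule matrix_inv_mult[OF inv])
    have "transpose A = A"
      by (simp add: A vec_eq_iff transpose_def outer_nth mult.commute)
    then have Bt: "transpose B = B" unfolding B_def by (rule transpose_matrix_inv[OF inv])
    have X: "distributed M circle (X k) (\<lambda>x. ennreal (g x))" if "k \<ge> 1" for k
      using X_density that by blast
    \<comment> \<open>The contribution of one observation to the score at \<theta>0, so that U is u
      at the first observation and the leading term is -2B times the mean of u.\<close>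
    define u where "u x = (\<Sum>l\<in>{-4..4}. Zvar l x \<theta>0 *\<^sub>R a l)" for x
    have cu: "continuous_on UNIV u"
      unfolding u_def by (intro continuous_on_sum continuous_on_scaleR continuous_Zvar continuous_on_const)
    have U: "U = (\<lambda>\<omega>. u (X 1 \<omega>))" by (simp add: U_def u_def a_def)
    \<comment> \<open>Multiplying by a fixed vector is a bounded linear map of the matrix, so it
      commutes with the matrix-valued expectation.\<close>
    have Vx: "V *v t = 4 *\<^sub>R expectation (\<lambda>\<omega>. (U \<omega> \<bullet> t) *\<^sub>R U \<omega>)" for t
    proof -
      have i: "integrable M (\<lambda>\<omega>. outer (U \<omega>))"
        unfolding U by (rule integrable_continuous_compose_circle[OF X[OF order_refl]]) (intro continuous_intros cu)
      have "bounded_linear (\<lambda>D :: real^3^3. D *v t)"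
        by (intro linear_conv_bounded_linear[THEN iffD1] linearI)
          (simp_all add: matrix_vector_mult_add_rdistrib scaleR_matrix_vector_assoc)
      from integral_bounded_linear[OF this i] show ?thesis
        by (simp add: V_def scaleR_matrix_vector_assoc[symmetric] outer_mult_vec)
    qed
    have iU: "integrable M (\<lambda>\<omega>. (U \<omega> \<bullet> t) *\<^sub>R U \<omega>)" for t
      unfolding U by (rule integrable_continuous_compose_circle[OF X[OF order_refl]]) (intro continuous_intros cu)
    have VV: "s \<bullet> (V *v t) = 4 * expectation (\<lambda>\<omega>. (U \<omega> \<bullet> t) * (U \<omega> \<bullet> s))" for s t
      using integral_inner_right[OF iU, of s t] by (simp add: Vx inner_commute)
    have Vt: "transpose V = V"
    proof -
      have "V $ i $ j = axis i 1 \<bullet> (V *v axis j 1)" for i j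
        by (simp add: inner_axis' matrix_vector_mult_basis column_def)
      then show ?thesis by (simp add: vec_eq_iff transpose_def VV mult.commute)
    qed
    have \<Sigma>: "\<Sigma> = B ** V ** B" by (simp add: \<Sigma>_def B_def)
    have \<Sigma>t: "transpose \<Sigma> = \<Sigma>" by (simp add: \<Sigma> matrix_transpose_mul Bt Vt matrix_mul_assoc)
    \<comment> \<open>The form t applied to -2B u(x), with the symmetric B moved to t. The square of
      -2 is the factor 4 in V.\<close>
    define \<psi> where "\<psi> t x = - 2 * ((B *v t) \<bullet> u x)" for t x
    have c\<psi>: "continuous_on UNIV (\<psi> t)" for t unfolding \<psi>_def by (intro continuous_intros cu)
    have m\<psi>[measurable]: "\<psi> t \<in> borel_measurable borel" for t by (rule borel_measurable_continuous_onI[OF c\<psi>])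
    \<comment> \<open>Serves twice: as the variance in the limit theorem, and as the proof that
      \<Sigma> is positive semidefinite, from which the normal law is constructed.\<close>
    have q\<Sigma>: "t \<bullet> (\<Sigma> *v t) = expectation (\<lambda>\<omega>. (\<psi> t (X 1 \<omega>))\<^sup>2)" for t
    proof -
      have "t \<bullet> (\<Sigma> *v t) = (B *v t) \<bullet> (V *v (B *v t))"
        by (simp add: \<Sigma> matrix_vector_mul_assoc[symmetric] inner_symmetric_matrix[OF Bt])
      then show ?thesis by (simp add: VV \<psi>_def U power2_eq_square inner_commute mult_ac)
    qed
    obtain N where N: "multivariate_normal 0 \<Sigma> N"
      using multivariate_normal_exists[OF \<Sigma>t] q\<Sigma> by auto
    have Nc: "(LINT x|N. exp (\<i> * of_real (t \<bullet> x))) = exp (- of_real (t \<bullet> (\<Sigma> *v t)) / 2)" for t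
      using N by (simp add: multivariate_normal_def)
    have J0': "Im (m l * Mcoeff l \<theta>0) = 0" if "l \<in> {-4..4}" for l
      using J0[OF that] unfolding Jfun_def m_def .
    have al: "a l \<bullet> v = Im (m l * DMcoeff l \<theta>0 v)" for l v
      unfolding a_def m_def by (rule inner_gradient[OF has_derivative_Jfun])
    have m1: "norm (m l) \<le> 1" for l unfolding m_def by (rule norm_cnj_fourier_coeff_le[OF X[OF order_refl] g])
    have p\<Theta>: "0 \<le> \<theta> $ 1 \<and> \<theta> $ 1 \<le> 1" if "\<theta> \<in> \<Theta>" for \<theta>
      using \<Theta>_subset that param_setD(1,2)[of \<theta>] by force
    have ident: "\<theta> = \<theta>0" if "\<theta> \<in> \<Theta>" "\<And>l. l \<in> {-4..4} \<Longrightarrow> Im (m l * Mcoeff l \<theta>) = 0" for \<theta>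
    proof (rule Jfun_identifiable[OF f_density f_coeffs \<theta>0])
      show "\<theta> \<in> param_set" using that(1) \<Theta>_subset by blast
      show "Jfun (mixture f \<theta>0) l \<theta> = 0" if "l \<in> {-4..4}" for l
        using \<open>\<And>l. l \<in> {-4..4} \<Longrightarrow> Im (m l * Mcoeff l \<theta>) = 0\<close>[OF that] unfolding Jfun_def m_def g_def .
    qed
    define e where "e n \<omega> = emp_coeff n (\<lambda>k. X k \<omega>)" for n \<omega>
    define L where "L n \<omega> = 2 *\<^sub>R (B *v (\<Sum>l\<in>{-4..4}. Im (e n \<omega> l * Mcoeff l \<theta>0) *\<^sub>R a l))" for n \<omega>
    obtain C \<delta> n0 where C: "0 < C" and \<delta>: "0 < \<delta>"
      and exp1: "\<And>n x \<theta> D. n \<ge> n0 \<Longrightarrow> is_arg_min (empirical_contrast n x) (\<lambda>\<theta>. \<theta> \<in> \<Theta>) \<theta> \<Longrightarrow>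
       (\<And>l. l \<in> {-4..4} \<Longrightarrow> norm (emp_coeff n x l - m l) \<le> D) \<Longrightarrow> D \<le> \<delta> \<Longrightarrow>
       norm (\<theta> - \<theta>0 + 2 *\<^sub>R (B *v (\<Sum>l\<in>{-4..4}. Im (emp_coeff n x l * Mcoeff l \<theta>0) *\<^sub>R a l)))
         \<le> C * (D\<^sup>2 + 1 / real n)"
      and exp2: "\<And>n x D. (\<And>l. l \<in> {-4..4} \<Longrightarrow> norm (emp_coeff n x l - m l) \<le> D) \<Longrightarrow>
       norm (2 *\<^sub>R (B *v (\<Sum>l\<in>{-4..4}. Im (emp_coeff n x l * Mcoeff l \<theta>0) *\<^sub>R a l))) \<le> C * D"
      apply (rule argmin_expansion[OF \<Theta>_compact p\<Theta> \<theta>0_interior m1 J0' ident al A BA])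
          apply (blast, blast, blast, blast)
      subgoal premises p for C \<delta> n0
        by (rule p(1)[OF p(2) p(3) p(4) p(5)])
      done
    \<comment> \<open>A sum of squares over the frequencies, so that sqrt Q dominates every
      deviation and can be taken for D in the expansion.\<close>
    define Q where "Q n \<omega> = (\<Sum>l\<in>{-4..4}. (norm (e n \<omega> l - m l))\<^sup>2)" for n \<omega>
    have Q0: "0 \<le> Q n \<omega>" for n \<omega> unfolding Q_def by (intro sum_nonneg) auto
    have eQ: "norm (e n \<omega> l - m l) \<le> sqrt (Q n \<omega>)" if "l \<in> {-4..4}" for n \<omega> l
      unfolding Q_def using that
      by (intro real_le_rsqrt member_le_sum[of l "{-4..4}" "\<lambda>l. (norm (e n \<omega> l - m l))\<^sup>2"]) auto
    define Y where "Y n \<omega> = - (sqrt (real n) *\<^sub>R L n \<omega>)" for n \<omega>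
    define W where "W n \<omega> = sqrt (real n) *\<^sub>R (est n \<omega> - \<theta>0)" for n \<omega>
    have L\<psi>: "- (t \<bullet> L n \<omega>) = (\<Sum>k\<in>{1..n}. \<psi> t (X k \<omega>)) / real n" if n: "n \<ge> 1" for t n \<omega>
    proof -
      have Im: "Im (e n \<omega> l * Mcoeff l \<theta>0) = (\<Sum>k\<in>{1..n}. Zvar l (X k \<omega>) \<theta>0) / real n" for l
        using sum_Zvar[of n l "\<lambda>k. X k \<omega>" \<theta>0] n unfolding e_def by (simp add: field_simps)
      have "(\<Sum>l\<in>{-4..4}. Im (e n \<omega> l * Mcoeff l \<theta>0) *\<^sub>R a l) = (1 / real n) *\<^sub>R (\<Sum>l\<in>{-4..4}. \<Sum>k\<in>{1..n}. Zvar l (X k \<omega>) \<theta>0 *\<^sub>R a l)"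
        unfolding Im by (simp add: scaleR_sum_right scaleR_sum_left sum_divide_distrib)
      also have "\<dots> = (1 / real n) *\<^sub>R (\<Sum>k\<in>{1..n}. u (X k \<omega>))"
        unfolding u_def by (subst sum.swap) simp
      finally have "L n \<omega> = 2 *\<^sub>R (B *v ((1 / real n) *\<^sub>R (\<Sum>k\<in>{1..n}. u (X k \<omega>))))"
        unfolding L_def by simp
      then have "t \<bullet> L n \<omega> = 2 * ((B *v t) \<bullet> ((1 / real n) *\<^sub>R (\<Sum>k\<in>{1..n}. u (X k \<omega>))))"
        by (simp only: inner_scaleR_right inner_symmetric_matrix[OF Bt])
      then show ?thesis
        by (simp add: \<psi>_def inner_sum_right sum_distrib_left sum_divide_distrib sum_negf)
    qed
    \<comment> \<open>For n = 0 the factor sqrt n and the empty sum make both sides zero.\<close>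
    have Y\<psi>: "t \<bullet> Y n \<omega> = (\<Sum>i<n. \<psi> t (X (Suc i) \<omega>)) / sqrt (real n)" for t n \<omega>
    proof (cases "n = 0")
      case False
      have "t \<bullet> Y n \<omega> = sqrt (real n) * (- (t \<bullet> L n \<omega>))" by (simp add: Y_def)
      also have "\<dots> = (\<Sum>k\<in>{1..n}. \<psi> t (X k \<omega>)) / sqrt (real n)"
        using False sqrt_mult_real_self[of n "\<Sum>k\<in>{1..n}. \<psi> t (X k \<omega>)"] by (simp add: L\<psi>)
      also have "(\<Sum>k\<in>{1..n}. \<psi> t (X k \<omega>)) = (\<Sum>i<n. \<psi> t (X (Suc i) \<omega>))"
        by (simp add: sum.atLeast1_atMost_eq)
      finally show ?thesis .
    qed (simp add: Y_def)
    have rv: "X (Suc i) \<in> borel_measurable M" for i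
      using X_indep unfolding indep_vars_def2 by auto
    have mY: "Y n \<in> borel_measurable M" for n
    proof -
      have [measurable]: "X k \<in> borel_measurable M" if "k \<in> {1..n}" for k
        using rv[of "k - 1"] that by simp
      have "continuous_on UNIV (\<lambda>x. exp (\<i> * of_int l * complex_of_real x) / (2 * of_real pi))" for l
        by (rule continuous_mode)
      from borel_measurable_continuous_onI[OF this]
      have [measurable]: "(\<lambda>\<omega>. e n \<omega> l) \<in> borel_measurable M" for l
        unfolding e_def emp_coeff_def
        by (intro borel_measurable_divide borel_measurable_sum borel_measurable_const)
          (rule measurable_compose[of "X _" M borel], auto)
      have "(\<lambda>z. B *v z) \<in> borel_measurable borel"
        by (intro borel_measurable_continuous_onI linear_continuous_on matrix_vector_mul_bounded_linear)
      then have "(\<lambda>\<omega>. B *v (\<Sum>l\<in>{-4..4}. Im (e n \<omega> l * Mcoeff l \<theta>0) *\<^sub>R a l)) \<in> borel_measurable M"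
        by (rule measurable_compose[rotated]) measurable
      then show ?thesis unfolding Y_def L_def by measurable
    qed
    have char: "(\<lambda>n. CLINT \<omega>|M. exp (\<i> * of_real (t \<bullet> Y n \<omega>))) \<longlonglongrightarrow> (CLINT x|N. exp (\<i> * of_real (t \<bullet> x)))" for t
    proof -
      define \<xi> where "\<xi> i \<omega> = \<psi> t (X (Suc i) \<omega>)" for i \<omega>
      have "range Suc = {1..}" by (auto simp: image_iff Suc_le_eq gr0_conv_Suc)
      then have "indep_vars (\<lambda>_. borel) (\<lambda>i. X (Suc i)) UNIV"
        using indep_vars_reindex_inj[of borel X Suc UNIV] X_indep by simp
      then have ind: "indep_vars (\<lambda>_. borel) \<xi> UNIV"
        unfolding \<xi>_def by (rule indep_vars_compose2) auto
      have same: "expectation (\<lambda>\<omega>. \<phi> (X (Suc i) \<omega>)) = expectation (\<lambda>\<omega>. \<phi> (X 1 \<omega>))"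
        if "\<phi> \<in> borel_measurable borel" for \<phi> :: "real \<Rightarrow> real" and i
        using distributed_circle_expectation[OF X g that] by simp
      have "(\<lambda>n. CLINT \<omega>|M. iexp ((\<Sum>i<n. \<xi> i \<omega>) / sqrt (real n))) \<longlonglongrightarrow> exp (- of_real (t \<bullet> (\<Sigma> *v t)) / 2)"
      proof (rule tendsto_expectation_iexp_sum_iid[OF ind])
        have iZ: "integrable M (\<lambda>\<omega>. Zvar l (X 1 \<omega>) \<theta>0)" for l
          by (rule integrable_continuous_compose_circle[OF X[OF order_refl] continuous_Zvar])
        \<comment> \<open>The mean of Z^l at \<theta>0 is J^l(\<theta>0), so the summands are
          centred because \<theta>0 is a zero of every J^l.\<close>
        have Z: "expectation (\<lambda>\<omega>. Zvar l (X 1 \<omega>) \<theta>0) = 0" if "l \<in> {-4..4}" for l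
        proof -
          define E where "E x = exp (\<i> * of_int l * of_real x) / (2 * complex_of_real pi)" for x
          have iE: "integrable M (\<lambda>\<omega>. E (X 1 \<omega>))"
            unfolding E_def by (rule integrable_continuous_compose_circle[OF X[OF order_refl] continuous_mode])
          have "expectation (\<lambda>\<omega>. Im (E (X 1 \<omega>) * Mcoeff l \<theta>0)) = Im (expectation (\<lambda>\<omega>. E (X 1 \<omega>) * Mcoeff l \<theta>0))"
            by (rule integral_Im) (use iE in simp)
          also have "expectation (\<lambda>\<omega>. E (X 1 \<omega>) * Mcoeff l \<theta>0) = expectation (\<lambda>\<omega>. E (X 1 \<omega>)) * Mcoeff l \<theta>0"
            by (rule integral_mult_left_zero)
          also have "expectation (\<lambda>\<omega>. E (X 1 \<omega>)) = m l"
            unfolding E_def m_def by (rule expectation_mode[OF X[OF order_refl] g])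
          finally show ?thesis using J0'[OF that] unfolding Zvar_def E_def by (simp only:)
        qed
        have "expectation (\<lambda>\<omega>. \<psi> t (X 1 \<omega>)) = expectation (\<lambda>\<omega>. \<Sum>l\<in>{-4..4}. (- 2 * ((B *v t) \<bullet> a l)) * Zvar l (X 1 \<omega>) \<theta>0)"
          by (simp add: \<psi>_def u_def inner_sum_right sum_distrib_left sum_negf mult_ac)
        also have "\<dots> = (\<Sum>l\<in>{-4..4}. (- 2 * ((B *v t) \<bullet> a l)) * expectation (\<lambda>\<omega>. Zvar l (X 1 \<omega>) \<theta>0))"
          using iZ by (subst Bochner_Integration.integral_sum) auto
        also have "\<dots> = 0" by (intro sum.neutral ballI) (simp only: Z mult_zero_right)
        finally have 0: "expectation (\<lambda>\<omega>. \<psi> t (X 1 \<omega>)) = 0" .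
        show "expectation (\<xi> i) = 0" for i
          unfolding \<xi>_def by (rule trans[OF same[OF m\<psi>] 0])
        show "integrable M (\<lambda>\<omega>. (\<xi> i \<omega>)\<^sup>2)" for i
          unfolding \<xi>_def by (rule integrable_continuous_compose_circle[OF X]) (auto intro!: continuous_intros c\<psi>)
        show "expectation (\<lambda>\<omega>. (\<xi> i \<omega>)\<^sup>2) = t \<bullet> (\<Sigma> *v t)" for i
          unfolding \<xi>_def q\<Sigma> by (rule same) measurable
        show "distr M borel (\<xi> i) = distr (density circle (\<lambda>x. ennreal (g x))) borel (\<psi> t)" for i
        proof -
          have d: "distr M circle (X (Suc i)) = density circle (\<lambda>x. ennreal (g x))" "X (Suc i) \<in> measurable M circle"
            using X[of "Suc i"] by (auto simp: distributed_def)
          have "distr (distr M circle (X (Suc i))) borel (\<psi> t) = distr M borel (\<psi> t \<circ> X (Suc i))"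
            by (rule distr_distr[OF borel_measurable_circle[OF m\<psi>] d(2)])
          then show ?thesis unfolding d(1) \<xi>_def by (simp add: comp_def)
        qed
      qed
      then show ?thesis unfolding Nc Y\<psi> \<xi>_def .
    qed
    have "converges_in_distribution M W N"
    proof (rule converges_in_distribution_of_expansion[where Y=Y and Q=Q and ?n0.0="max 2 n0" and K=72, OF _ _ _ mY char _ Q0 _ C \<delta>])
      show "prob_space N" "sets N = sets borel" using N by (auto simp: multivariate_normal_def)
      show "W n \<in> borel_measurable M" if "max 2 n0 \<le> n" for n
      proof -
        have [measurable]: "est n \<in> borel_measurable M" using est_measurable that by simp
        show ?thesis unfolding W_def by measurable
      qed
      show "integrable M (Q n)" "expectation (Q n) \<le> 72 / real n" if "n \<ge> 1" for n
        using emp_coeff_second_moment[OF X_indep X g that] unfolding Q_def e_def m_def by auto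
      show "norm (Y n \<omega>) \<le> sqrt (real n) * (C * sqrt (Q n \<omega>))" for n \<omega>
      proof -
        have "norm (L n \<omega>) \<le> C * sqrt (Q n \<omega>)"
          unfolding L_def e_def by (rule exp2) (rule eQ[unfolded e_def])
        then show ?thesis by (simp add: Y_def mult_left_mono)
      qed
      show "norm (W n \<omega> - Y n \<omega>) \<le> sqrt (real n) * (C * (Q n \<omega> + 1 / real n))"
        if "\<omega> \<in> space M" "max 2 n0 \<le> n" "sqrt (Q n \<omega>) \<le> \<delta>" for n \<omega>
      proof -
        have "W n \<omega> - Y n \<omega> = sqrt (real n) *\<^sub>R (est n \<omega> - \<theta>0 + L n \<omega>)"
          by (simp add: W_def Y_def algebra_simps)
        moreover have "norm (est n \<omega> - \<theta>0 + L n \<omega>) \<le> C * ((sqrt (Q n \<omega>))\<^sup>2 + 1 / real n)"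
          unfolding L_def e_def
        \<comment> \<open>The deterministic expansion is applied at each sample point with D =
          \<open>sqrt (Q n \<omega>)\<close>, whose square gives Q back.\<close>
        proof (rule exp1[of n "\<lambda>k. X k \<omega>"])
          show "is_arg_min (empirical_contrast n (\<lambda>k. X k \<omega>)) (\<lambda>\<theta>. \<theta> \<in> \<Theta>) (est n \<omega>)"
            using est_argmin that by simp
          show "norm (emp_coeff n (\<lambda>k. X k \<omega>) l - m l) \<le> sqrt (Q n \<omega>)" if "l \<in> {-4..4}" for l
            using eQ[OF that, of n \<omega>] unfolding e_def .
        qed (use that in auto)
        ultimately show ?thesis using Q0 by (simp add: mult_left_mono)
      qed
    qed
    with N show ?thesis unfolding W_def by blast
  qed
  then show ?thesis using A by (simp add: a_def)
qed

end
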